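(* Let $\mathbf{P}$ be a small additive category. The following are equivalent: (1) $\mathbf{P}$ has weak kernels; (2) $\mathcal{Q}(\mathbf{P})$ has kernels; (3) $\mathcal{Q}(\mathbf{P})$ is abelian; (4) $\mathrm{fp}(\mathbf{P}^{\mathrm{op}}, \mathrm{Ab})$ is abelian; (5) $\mathcal{Q}(\mathbf{P})$ and $\mathrm{fp}(\mathbf{P}^{\mathrm{op}}, \mathrm{Ab})$ are equal as full and replete subcategories of $\mathrm{Mod}\text{-}\mathbf{P}$ (where $\mathcal{Q}(\mathbf{P})$ is identified with the essential image of $\overline{M}: \mathcal{Q}(\mathbf{P}) \to \mathrm{Mod}\text{-}\mathbf{P}$); (6) $\mathcal{Q}(\mathbf{P})$ and $\mathrm{fp}(\mathbf{P}^{\mathrm{op}}, \mathrm{Ab})$ are equivalent as (abstract) categories; (7) $\mathrm{fp}(\mathbf{P}^{\mathrm{op}}, \mathrm{Ab})$ has epi-mono factorizations.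
   Context: Composition is written diagrammatically: for $\alpha: A \to B$ and $\beta: B \to C$, the composite is $\alpha\cdot\beta: A \to C$. Functors between additive categories are additive. A cospan in $\mathbf{P}$ is a pair of morphisms $(A \xrightarrow{\gamma} B \xleftarrow{\rho} C)$ with common codomain. $\mathrm{Syz}(A \xrightarrow{\gamma} B \xleftarrow{\rho} C)$ is the full subcategory of the slice category of $\mathbf{P}$ over $A$ whose objects, called syzygies, are the morphisms $\sigma: S \to A$ for which there exists $\omega: S \to C$ (a syzygy witness) with $\sigma\cdot\gamma = \omega\cdot\rho$. The additive category $\mathrm{Aux}(\mathbf{P})$ has as objects the cospans $(A \xrightarrow{\gamma_A} \Omega_A \xleftarrow{\rho_A} R_A)$ in $\mathbf{P}$; a morphism from $(A \xrightarrow{\gamma_A} \Omega_A \xleftarrow{\rho_A} R_A)$ to $(B \xrightarrow{\gamma_B} \Omega_B \xleftarrow{\rho_B} R_B)$ is a morphism $\alpha: A \to B$ in $\mathbf{P}$ such that $\sigma \in \mathrm{Syz}(A \xrightarrow{\gamma_A} \Omega_A \xleftarrow{\rho_A} R_A)$ implies $\sigma\cdot\alpha \in \mathrm{Syz}(B \xrightarrow{\gamma_B} \Omega_B \xleftarrow{\rho_B} R_B)$; composition and identities are those of $\mathbf{P}$. The ideal $\mathbf{I}(\mathbf{P})$ of $\mathrm{Aux}(\mathbf{P})$ consists of the morphisms $\alpha$ (notation as before) for which there exists $\zeta: A \to R_B$ with $\alpha\cdot\gamma_B = \zeta\cdot\rho_B$. $\mathcal{Q}(\mathbf{P}) := \mathrm{Aux}(\mathbf{P})/\mathbf{I}(\mathbf{P})$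 is the additive quotient category; the class of $\alpha$ is denoted $\overline{\alpha}$. $\mathrm{Mod}\text{-}\mathbf{P}$ is the category of additive functors $\mathbf{P}^{\mathrm{op}} \to \mathrm{Ab}$; write $(-,A) := \mathrm{Hom}_{\mathbf{P}}(-,A)$. The functor $\overline{M}: \mathcal{Q}(\mathbf{P}) \to \mathrm{Mod}\text{-}\mathbf{P}$ is full and faithful and sends $(A \xrightarrow{\gamma_A} \Omega_A \xleftarrow{\rho_A} R_A)$ to $\frac{\mathrm{im}(-,\gamma_A)}{\mathrm{im}(-,\rho_A)\cap \mathrm{im}(-,\gamma_A)}$. With $\epsilon_A: (-,A) \to \frac{\mathrm{im}(-,\gamma_A)}{\mathrm{im}(-,\rho_A)\cap \mathrm{im}(-,\gamma_A)}$ the natural epimorphism (coastriction of $(-,\gamma_A)$ to its image followed by projection), $\overline{M}(\overline{\alpha})$ is the unique morphism with $\epsilon_A \cdot \overline{M}(\overline{\alpha}) = (-,\alpha)\cdot \epsilon_B$. Its essential image is the smallest full replete (closed under isomorphism) subcategory of $\mathrm{Mod}\text{-}\mathbf{P}$ containing all $\overline{M}(X)$. $\mathrm{fp}(\mathbf{P}^{\mathrm{op}}, \mathrm{Ab})$ is the full subcategory of $\mathrm{Mod}\text{-}\mathbf{P}$ of finitely presented functors, i.e. those $F$ admitting an exact sequence $(-,B) \xrightarrow{(-,\alpha)} (-,A) \to F \to 0$ for some morphism $\alpha: B \to A$ in $\mathbf{P}$. $\mathbf{P}$ has weak kernels if every $\alpha: A \to B$ admits $\kappa: K \to A$ with $\kappa\cdot\alpha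 = 0$ such that each $\tau: T \to A$ with $\tau\cdot\alpha = 0$ factors (not necessarily uniquely) as $\tau = u\cdot\kappa$. A category has epi-mono factorizations if every morphism has an essentially unique factorization into an epimorphism followed by a monomorphism. *)

theory Defs
  imports "HOL-Algebra.Weak_Morphisms"
begin

text \<open>
  A category enriched in abelian groups. The hom-sets are indexed by their source and target and
  need not be disjoint. Following the group library, the abelian group structure of a hom-set is
  written multiplicatively: its \<open>\<otimes>\<close> is the sum of morphisms and its \<open>\<one>\<close> is the zero morphism.
  Composition is diagrammatic: \<open>cmp C A B D f g\<close> is \<open>f \<cdot> g\<close> for \<open>f : A \<rightarrow> B\<close> and \<open>g : B \<rightarrow> D\<close>.
\<close>

record ('o, 'm) acat =
  obj :: "'o set"
  homg :: "'o \<Rightarrow> 'o \<Rightarrow> 'm monoid"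
  cmp :: "'o \<Rightarrow> 'o \<Rightarrow> 'o \<Rightarrow> 'm \<Rightarrow> 'm \<Rightarrow> 'm"
  idn :: "'o \<Rightarrow> 'm"

abbreviation arr :: "('o, 'm) acat \<Rightarrow> 'o \<Rightarrow> 'o \<Rightarrow> 'm set"
  where "arr C A B \<equiv> carrier (homg C A B)"

abbreviation zero_arr :: "('o, 'm) acat \<Rightarrow> 'o \<Rightarrow> 'o \<Rightarrow> 'm"
  where "zero_arr C A B \<equiv> \<one>\<^bsub>homg C A B\<^esub>"

locale preadditive_cat =
  fixes C :: "('o, 'm) acat"
  assumes hom_comm_group: "\<lbrakk>A \<in> obj C; B \<in> obj C\<rbrakk> \<Longrightarrow> comm_group (homg C A B)"
    and idn_closed: "A \<in> obj C \<Longrightarrow> idn C A \<in> arr C A A"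
    and cmp_closed: "\<lbrakk>A \<in> obj C; B \<in> obj C; D \<in> obj C; f \<in> arr C A B; g \<in> arr C B D\<rbrakk>
      \<Longrightarrow> cmp C A B D f g \<in> arr C A D"
    and idn_left: "\<lbrakk>A \<in> obj C; B \<in> obj C; f \<in> arr C A B\<rbrakk> \<Longrightarrow> cmp C A A B (idn C A) f = f"
    and idn_right: "\<lbrakk>A \<in> obj C; B \<in> obj C; f \<in> arr C A B\<rbrakk> \<Longrightarrow> cmp C A B B f (idn C B) = f"
    and cmp_assoc: "\<lbrakk>A \<in> obj C; B \<in> obj C; D \<in> obj C; E \<in> obj C;
        f \<in> arr C A B; g \<in> arr C B D; h \<in> arr C D E\<rbrakk>
      \<Longrightarrow> cmp C A D E (cmp C A B D f g) h = cmp C A B E f (cmp C B D E g h)"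
    and cmp_add_left: "\<lbrakk>A \<in> obj C; B \<in> obj C; D \<in> obj C;
        f \<in> arr C A B; f' \<in> arr C A B; g \<in> arr C B D\<rbrakk>
      \<Longrightarrow> cmp C A B D (f \<otimes>\<^bsub>homg C A B\<^esub> f') g
          = cmp C A B D f g \<otimes>\<^bsub>homg C A D\<^esub> cmp C A B D f' g"
    and cmp_add_right: "\<lbrakk>A \<in> obj C; B \<in> obj C; D \<in> obj C;
        f \<in> arr C A B; g \<in> arr C B D; g' \<in> arr C B D\<rbrakk>
      \<Longrightarrow> cmp C A B D f (g \<otimes>\<^bsub>homg C B D\<^esub> g')
          = cmp C A B D f g \<otimes>\<^bsub>homg C A D\<^esub> cmp C A B D f g'"

definition is_zero_object :: "('o, 'm) acat \<Rightarrow> 'o \<Rightarrow> bool" where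
  "is_zero_object C Z \<longleftrightarrow> Z \<in> obj C \<and>
     (\<forall>A\<in>obj C. (\<exists>!f. f \<in> arr C A Z) \<and> (\<exists>!f. f \<in> arr C Z A))"

definition is_biproduct ::
  "('o, 'm) acat \<Rightarrow> 'o \<Rightarrow> 'o \<Rightarrow> 'o \<Rightarrow> 'm \<Rightarrow> 'm \<Rightarrow> 'm \<Rightarrow> 'm \<Rightarrow> bool" where
  "is_biproduct C A B S i j p q \<longleftrightarrow>
     S \<in> obj C \<and> i \<in> arr C A S \<and> j \<in> arr C B S \<and> p \<in> arr C S A \<and> q \<in> arr C S B \<and>
     cmp C A S A i p = idn C A \<and> cmp C B S B j q = idn C B \<and>
     cmp C A S B i q = zero_arr C A B \<and> cmp C B S A j p = zero_arr C B A \<and>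
     cmp C S A S p i \<otimes>\<^bsub>homg C S S\<^esub> cmp C S B S q j = idn C S"

locale additive_cat = preadditive_cat +
  assumes ex_zero_object: "\<exists>Z. is_zero_object C Z"
    and ex_biproduct: "\<lbrakk>A \<in> obj C; B \<in> obj C\<rbrakk> \<Longrightarrow> \<exists>S i j p q. is_biproduct C A B S i j p q"

definition is_weak_kernel :: "('o, 'm) acat \<Rightarrow> 'o \<Rightarrow> 'o \<Rightarrow> 'm \<Rightarrow> 'o \<Rightarrow> 'm \<Rightarrow> bool" where
  "is_weak_kernel C A B f K k \<longleftrightarrow>
     K \<in> obj C \<and> k \<in> arr C K A \<and> cmp C K A B k f = zero_arr C K B \<and>
     (\<forall>T\<in>obj C. \<forall>t\<in>arr C T A. cmp C T A B t f = zero_arr C T B \<longrightarrow>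
        (\<exists>u. u \<in> arr C T K \<and> t = cmp C T K A u k))"

definition is_kernel :: "('o, 'm) acat \<Rightarrow> 'o \<Rightarrow> 'o \<Rightarrow> 'm \<Rightarrow> 'o \<Rightarrow> 'm \<Rightarrow> bool" where
  "is_kernel C A B f K k \<longleftrightarrow>
     K \<in> obj C \<and> k \<in> arr C K A \<and> cmp C K A B k f = zero_arr C K B \<and>
     (\<forall>T\<in>obj C. \<forall>t\<in>arr C T A. cmp C T A B t f = zero_arr C T B \<longrightarrow>
        (\<exists>!u. u \<in> arr C T K \<and> t = cmp C T K A u k))"

definition is_cokernel :: "('o, 'm) acat \<Rightarrow> 'o \<Rightarrow> 'o \<Rightarrow> 'm \<Rightarrow> 'o \<Rightarrow> 'm \<Rightarrow> bool" where
  "is_cokernel C A B f Q c \<longleftrightarrow>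
     Q \<in> obj C \<and> c \<in> arr C B Q \<and> cmp C A B Q f c = zero_arr C A Q \<and>
     (\<forall>T\<in>obj C. \<forall>t\<in>arr C B T. cmp C A B T f t = zero_arr C A T \<longrightarrow>
        (\<exists>!u. u \<in> arr C Q T \<and> t = cmp C B Q T c u))"

definition has_weak_kernels :: "('o, 'm) acat \<Rightarrow> bool" where
  "has_weak_kernels C \<longleftrightarrow>
     (\<forall>A\<in>obj C. \<forall>B\<in>obj C. \<forall>f\<in>arr C A B. \<exists>K k. is_weak_kernel C A B f K k)"

definition has_kernels :: "('o, 'm) acat \<Rightarrow> bool" where
  "has_kernels C \<longleftrightarrow> (\<forall>A\<in>obj C. \<forall>B\<in>obj C. \<forall>f\<in>arr C A B. \<exists>K k. is_kernel C A B f K k)"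

definition has_cokernels :: "('o, 'm) acat \<Rightarrow> bool" where
  "has_cokernels C \<longleftrightarrow> (\<forall>A\<in>obj C. \<forall>B\<in>obj C. \<forall>f\<in>arr C A B. \<exists>Q c. is_cokernel C A B f Q c)"

definition is_mono :: "('o, 'm) acat \<Rightarrow> 'o \<Rightarrow> 'o \<Rightarrow> 'm \<Rightarrow> bool" where
  "is_mono C A B f \<longleftrightarrow> f \<in> arr C A B \<and>
     (\<forall>T\<in>obj C. \<forall>g\<in>arr C T A. \<forall>h\<in>arr C T A. cmp C T A B g f = cmp C T A B h f \<longrightarrow> g = h)"

definition is_epi :: "('o, 'm) acat \<Rightarrow> 'o \<Rightarrow> 'o \<Rightarrow> 'm \<Rightarrow> bool" where
  "is_epi C A B f \<longleftrightarrow> f \<in> arr C A B \<and>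
     (\<forall>T\<in>obj C. \<forall>g\<in>arr C B T. \<forall>h\<in>arr C B T. cmp C A B T f g = cmp C A B T f h \<longrightarrow> g = h)"

locale abelian_cat = additive_cat +
  assumes kernels: "has_kernels C"
    and cokernels: "has_cokernels C"
    and mono_normal: "\<lbrakk>A \<in> obj C; B \<in> obj C; is_mono C A B f\<rbrakk>
      \<Longrightarrow> \<exists>D\<in>obj C. \<exists>g\<in>arr C B D. is_kernel C B D g A f"
    and epi_conormal: "\<lbrakk>A \<in> obj C; B \<in> obj C; is_epi C A B f\<rbrakk>
      \<Longrightarrow> \<exists>D\<in>obj C. \<exists>g\<in>arr C D A. is_cokernel C D A g B f"

definition is_isomorphism :: "('o, 'm) acat \<Rightarrow> 'o \<Rightarrow> 'o \<Rightarrow> 'm \<Rightarrow> bool" where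
  "is_isomorphism C A B f \<longleftrightarrow> f \<in> arr C A B \<and>
     (\<exists>g\<in>arr C B A. cmp C A B A f g = idn C A \<and> cmp C B A B g f = idn C B)"

definition isomorphic :: "('o, 'm) acat \<Rightarrow> 'o \<Rightarrow> 'o \<Rightarrow> bool" where
  "isomorphic C A B \<longleftrightarrow> (\<exists>f. is_isomorphism C A B f)"

definition is_epi_mono_fact ::
  "('o, 'm) acat \<Rightarrow> 'o \<Rightarrow> 'o \<Rightarrow> 'm \<Rightarrow> 'o \<Rightarrow> 'm \<Rightarrow> 'm \<Rightarrow> bool" where
  "is_epi_mono_fact C A B f I e m \<longleftrightarrow>
     I \<in> obj C \<and> is_epi C A I e \<and> is_mono C I B m \<and> f = cmp C A I B e m"

definition has_epi_mono_factorizations :: "('o, 'm) acat \<Rightarrow> bool" where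
  "has_epi_mono_factorizations C \<longleftrightarrow>
     (\<forall>A\<in>obj C. \<forall>B\<in>obj C. \<forall>f\<in>arr C A B.
        (\<exists>I e m. is_epi_mono_fact C A B f I e m) \<and>
        (\<forall>I e m I' e' m'. is_epi_mono_fact C A B f I e m \<longrightarrow> is_epi_mono_fact C A B f I' e' m' \<longrightarrow>
           (\<exists>!t. is_isomorphism C I I' t \<and> cmp C A I I' e t = e' \<and> cmp C I I' B t m' = m)))"

definition op_cat :: "('o, 'm) acat \<Rightarrow> ('o, 'm) acat" where
  "op_cat C = \<lparr>obj = obj C, homg = (\<lambda>A B. homg C B A),
     cmp = (\<lambda>A B D f g. cmp C D B A g f), idn = idn C\<rparr>"

definition full_subcat :: "('o, 'm) acat \<Rightarrow> 'o set \<Rightarrow> ('o, 'm) acat" where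
  "full_subcat C S = C\<lparr>obj := S\<rparr>"


text \<open>Functors are additive. As records, they may take arbitrary values outside the category.\<close>

record ('o, 'm, 'p, 'n) afunctor =
  fob :: "'o \<Rightarrow> 'p"
  far :: "'o \<Rightarrow> 'o \<Rightarrow> 'm \<Rightarrow> 'n"

definition is_functor :: "('o, 'm) acat \<Rightarrow> ('p, 'n) acat \<Rightarrow> ('o, 'm, 'p, 'n) afunctor \<Rightarrow> bool" where
  "is_functor C D F \<longleftrightarrow>
     (\<forall>A\<in>obj C. fob F A \<in> obj D) \<and>
     (\<forall>A\<in>obj C. \<forall>B\<in>obj C. far F A B \<in> hom (homg C A B) (homg D (fob F A) (fob F B))) \<and>
     (\<forall>A\<in>obj C. far F A A (idn C A) = idn D (fob F A)) \<and>
     (\<forall>A\<in>obj C. \<forall>B\<in>obj C. \<forall>E\<in>obj C. \<forall>f\<in>arr C A B. \<forall>g\<in>arr C B E.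
        far F A E (cmp C A B E f g)
          = cmp D (fob F A) (fob F B) (fob F E) (far F A B f) (far F B E g))"

definition id_functor :: "('o, 'm, 'o, 'm) afunctor" where
  "id_functor = \<lparr>fob = (\<lambda>A. A), far = (\<lambda>A B f. f)\<rparr>"

definition comp_functor ::
  "('o, 'm, 'p, 'n) afunctor \<Rightarrow> ('p, 'n, 'q, 'k) afunctor \<Rightarrow> ('o, 'm, 'q, 'k) afunctor" where
  "comp_functor F G = \<lparr>fob = (\<lambda>A. fob G (fob F A)),
     far = (\<lambda>A B f. far G (fob F A) (fob F B) (far F A B f))\<rparr>"

definition nat_trans :: "('o, 'm) acat \<Rightarrow> ('p, 'n) acat \<Rightarrow>
    ('o, 'm, 'p, 'n) afunctor \<Rightarrow> ('o, 'm, 'p, 'n) afunctor \<Rightarrow> ('o \<Rightarrow> 'n) set" where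
  "nat_trans C D F G = {t \<in> (\<Pi>\<^sub>E A\<in>obj C. arr D (fob F A) (fob G A)).
     \<forall>A\<in>obj C. \<forall>B\<in>obj C. \<forall>f\<in>arr C A B.
       cmp D (fob F A) (fob F B) (fob G B) (far F A B f) (t B)
         = cmp D (fob F A) (fob G A) (fob G B) (t A) (far G A B f)}"

definition functor_cat :: "('o, 'm) acat \<Rightarrow> ('p, 'n) acat \<Rightarrow>
    (('o, 'm, 'p, 'n) afunctor, 'o \<Rightarrow> 'n) acat" where
  "functor_cat C D = \<lparr>obj = {F. is_functor C D F},
     homg = (\<lambda>F G. \<lparr>carrier = nat_trans C D F G,
        mult = (\<lambda>s t. \<lambda>A\<in>obj C. s A \<otimes>\<^bsub>homg D (fob F A) (fob G A)\<^esub> t A),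
        one = (\<lambda>A\<in>obj C. zero_arr D (fob F A) (fob G A))\<rparr>),
     cmp = (\<lambda>F G H s t. \<lambda>A\<in>obj C. cmp D (fob F A) (fob G A) (fob H A) (s A) (t A)),
     idn = (\<lambda>F. \<lambda>A\<in>obj C. idn D (fob F A))\<rparr>"

definition equivalent_cats :: "('o, 'm) acat \<Rightarrow> ('p, 'n) acat \<Rightarrow> bool" where
  "equivalent_cats C D \<longleftrightarrow> (\<exists>F G. is_functor C D F \<and> is_functor D C G \<and>
     isomorphic (functor_cat C C) (comp_functor F G) id_functor \<and>
     isomorphic (functor_cat D D) (comp_functor G F) id_functor)"

definition replete :: "('o, 'm) acat \<Rightarrow> 'o set \<Rightarrow> bool" where
  "replete C S \<longleftrightarrow> (\<forall>A\<in>S. \<forall>B\<in>obj C. isomorphic C A B \<longrightarrow> B \<in> S)"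

definition ess_image :: "('o, 'm) acat \<Rightarrow> ('p, 'n) acat \<Rightarrow> ('o, 'm, 'p, 'n) afunctor \<Rightarrow> 'p set" where
  "ess_image C D F = \<Inter>{S. S \<subseteq> obj D \<and> replete D S \<and> fob F ` obj C \<subseteq> S}"


record ('o, 'm) cospan =
  csA :: 'o
  csO :: 'o
  csR :: 'o
  gam :: 'm
  rho :: 'm

definition is_cospan :: "('o, 'm) acat \<Rightarrow> ('o, 'm) cospan \<Rightarrow> bool" where
  "is_cospan P X \<longleftrightarrow> csA X \<in> obj P \<and> csO X \<in> obj P \<and> csR X \<in> obj P \<and>
     gam X \<in> arr P (csA X) (csO X) \<and> rho X \<in> arr P (csR X) (csO X)"

text \<open>\<open>syz P X S\<close> is the set of those syzygies of \<open>X\<close> whose source is \<open>S\<close>.\<close>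

definition syz :: "('o, 'm) acat \<Rightarrow> ('o, 'm) cospan \<Rightarrow> 'o \<Rightarrow> 'm set" where
  "syz P X S = {s \<in> arr P S (csA X). \<exists>w\<in>arr P S (csR X).
     cmp P S (csA X) (csO X) s (gam X) = cmp P S (csR X) (csO X) w (rho X)}"

definition Aux :: "('o, 'm) acat \<Rightarrow> (('o, 'm) cospan, 'm) acat" where
  "Aux P = \<lparr>obj = {X. is_cospan P X},
     homg = (\<lambda>X Y. (homg P (csA X) (csA Y))
       \<lparr>carrier := {a \<in> arr P (csA X) (csA Y).
          \<forall>S\<in>obj P. \<forall>s\<in>syz P X S. cmp P S (csA X) (csA Y) s a \<in> syz P Y S}\<rparr>),
     cmp = (\<lambda>X Y Z. cmp P (csA X) (csA Y) (csA Z)),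
     idn = (\<lambda>X. idn P (csA X))\<rparr>"

definition Aux_ideal ::
  "('o, 'm) acat \<Rightarrow> ('o, 'm) cospan \<Rightarrow> ('o, 'm) cospan \<Rightarrow> 'm set" where
  "Aux_ideal P X Y = {a \<in> arr (Aux P) X Y. \<exists>z\<in>arr P (csA X) (csR Y).
     cmp P (csA X) (csA Y) (csO Y) a (gam Y) = cmp P (csA X) (csR Y) (csO Y) z (rho Y)}"

text \<open>
  Additive quotient by an ideal: morphisms are cosets of \<open>I A B\<close>. The composite of two classes is
  written as the union of the classes of the composites of all representatives; for an ideal, all
  of these classes coincide.
\<close>

definition quotient_cat :: "('o, 'm) acat \<Rightarrow> ('o \<Rightarrow> 'o \<Rightarrow> 'm set) \<Rightarrow> ('o, 'm set) acat" where
  "quotient_cat C I = \<lparr>obj = obj C,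
     homg = (\<lambda>A B. homg C A B Mod I A B),
     cmp = (\<lambda>A B D U V. \<Union>f\<in>U. \<Union>g\<in>V. I A D #>\<^bsub>homg C A D\<^esub> cmp C A B D f g),
     idn = (\<lambda>A. I A A #>\<^bsub>homg C A A\<^esub> idn C A)\<rparr>"

definition Q_cat :: "('o, 'm) acat \<Rightarrow> (('o, 'm) cospan, 'm set) acat" where
  "Q_cat P = quotient_cat (Aux P) (Aux_ideal P)"


text \<open>
  The category of abelian groups whose elements are taken from the type \<open>'g\<close>, which plays the role
  of the ambient universe. A category over \<open>'o\<close> and \<open>'m\<close> is small relative to \<open>'g\<close> once \<open>'g\<close>
  accommodates its hom-groups and their groups of cosets, i.e. given an injection
  \<open>u :: 'm set \<Rightarrow> 'g\<close>; up to isomorphism nothing below depends on the choice of \<open>u\<close>.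
\<close>

definition Ab_cat :: "('g monoid, 'g \<Rightarrow> 'g) acat" where
  "Ab_cat = \<lparr>obj = {G. comm_group G},
     homg = (\<lambda>G H. \<lparr>carrier = hom G H \<inter> extensional (carrier G),
        mult = (\<lambda>h k. \<lambda>x\<in>carrier G. h x \<otimes>\<^bsub>H\<^esub> k x),
        one = (\<lambda>x\<in>carrier G. \<one>\<^bsub>H\<^esub>)\<rparr>),
     cmp = (\<lambda>G H K h k. compose (carrier G) k h),
     idn = (\<lambda>G. \<lambda>x\<in>carrier G. x)\<rparr>"

type_synonym ('o, 'm, 'g) presheaf = "('o, 'm, 'g monoid, 'g \<Rightarrow> 'g) afunctor"

definition Mod_cat :: "('o, 'm) acat \<Rightarrow> (('o, 'm, 'g) presheaf, 'o \<Rightarrow> 'g \<Rightarrow> 'g) acat" where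
  "Mod_cat P = functor_cat (op_cat P) Ab_cat"

text \<open>
  The hom-functors of \<open>P\<close> take values in groups over \<open>'m\<close>, and their subquotients in groups over
  \<open>'m set\<close>. An injection \<open>e\<close> transports such a functor, and transformations between such functors
  (along \<open>e\<close> and \<open>e'\<close>), to the universe \<open>'g\<close>.
\<close>

definition transport :: "('a \<Rightarrow> 'g) \<Rightarrow> ('o, 'm, 'a) presheaf \<Rightarrow> ('o, 'm, 'g) presheaf" where
  "transport e F = \<lparr>fob = (\<lambda>A. image_group e (fob F A)),
     far = (\<lambda>A B f. \<lambda>y\<in>e ` carrier (fob F A). e (far F A B f (inv_into (carrier (fob F A)) e y)))\<rparr>"

definition transport_trans :: "('o, 'm) acat \<Rightarrow> ('a \<Rightarrow> 'g) \<Rightarrow> ('b \<Rightarrow> 'g) \<Rightarrow>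
    ('o, 'm, 'a) presheaf \<Rightarrow> ('o \<Rightarrow> 'a \<Rightarrow> 'b) \<Rightarrow> ('o \<Rightarrow> 'g \<Rightarrow> 'g)" where
  "transport_trans P e e' F t = (\<lambda>T\<in>obj P. \<lambda>y\<in>e ` carrier (fob F T).
     e' (t T (inv_into (carrier (fob F T)) e y)))"

definition hom_functor :: "('o, 'm) acat \<Rightarrow> 'o \<Rightarrow> ('o, 'm, 'm) presheaf" where
  "hom_functor P A = \<lparr>fob = (\<lambda>T. homg P T A),
     far = (\<lambda>T T' f. \<lambda>t\<in>arr P T A. cmp P T' T A f t)\<rparr>"

text \<open>\<open>(-,A)\<close> and \<open>(-,\<alpha>)\<close> as an object and a morphism of \<open>Mod_cat P\<close>\<close>

definition rep :: "('m set \<Rightarrow> 'g) \<Rightarrow> ('o, 'm) acat \<Rightarrow> 'o \<Rightarrow> ('o, 'm, 'g) presheaf" where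
  "rep u P A = transport (\<lambda>f. u {f}) (hom_functor P A)"

definition rep_map ::
  "('m set \<Rightarrow> 'g) \<Rightarrow> ('o, 'm) acat \<Rightarrow> 'o \<Rightarrow> 'o \<Rightarrow> 'm \<Rightarrow> 'o \<Rightarrow> 'g \<Rightarrow> 'g" where
  "rep_map u P A B a = transport_trans P (\<lambda>f. u {f}) (\<lambda>f. u {f}) (hom_functor P A)
     (\<lambda>T t. cmp P T A B t a)"

text \<open>Exactness of \<open>(-,B) \<rightarrow> (-,A) \<rightarrow> F \<rightarrow> 0\<close> in \<open>Mod_cat P\<close> is pointwise.\<close>

definition finitely_presented ::
  "('m set \<Rightarrow> 'g) \<Rightarrow> ('o, 'm) acat \<Rightarrow> ('o, 'm, 'g) presheaf \<Rightarrow> bool" where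
  "finitely_presented u P F \<longleftrightarrow> (\<exists>A\<in>obj P. \<exists>B\<in>obj P. \<exists>a\<in>arr P B A.
     \<exists>e\<in>arr (Mod_cat P) (rep u P A) F. \<forall>T\<in>obj P.
       rep_map u P B A a T ` carrier (fob (rep u P B) T)
         = kernel (fob (rep u P A) T) (fob F T) (e T) \<and>
       e T ` carrier (fob (rep u P A) T) = carrier (fob F T))"

definition fp_objs :: "('m set \<Rightarrow> 'g) \<Rightarrow> ('o, 'm) acat \<Rightarrow> ('o, 'm, 'g) presheaf set" where
  "fp_objs u P = {F \<in> obj (Mod_cat P). finitely_presented u P F}"

definition fp_cat :: "('m set \<Rightarrow> 'g) \<Rightarrow> ('o, 'm) acat \<Rightarrow>
    (('o, 'm, 'g) presheaf, 'o \<Rightarrow> 'g \<Rightarrow> 'g) acat" where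
  "fp_cat u P = full_subcat (Mod_cat P) (fp_objs u P)"

definition im_gam :: "('o, 'm) acat \<Rightarrow> ('o, 'm) cospan \<Rightarrow> 'o \<Rightarrow> 'm set" where
  "im_gam P X T = (\<lambda>t. cmp P T (csA X) (csO X) t (gam X)) ` arr P T (csA X)"

definition im_rho :: "('o, 'm) acat \<Rightarrow> ('o, 'm) cospan \<Rightarrow> 'o \<Rightarrow> 'm set" where
  "im_rho P X T = (\<lambda>t. cmp P T (csR X) (csO X) t (rho X)) ` arr P T (csR X)"

text \<open>
  \<open>im(-,\<gamma>) / (im(-,\<rho>) \<inter> im(-,\<gamma>))\<close> as a functor to groups of cosets, with the natural epimorphism
  from \<open>(-,A)\<close>. On morphisms, the functor sends the class of \<open>s\<close> to the class of \<open>f \<cdot> s\<close>, again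
  written as a union over all representatives.
\<close>

definition M_functor :: "('o, 'm) acat \<Rightarrow> ('o, 'm) cospan \<Rightarrow> ('o, 'm, 'm set) presheaf" where
  "M_functor P X = \<lparr>
     fob = (\<lambda>T. (homg P T (csO X))\<lparr>carrier := im_gam P X T\<rparr> Mod (im_rho P X T \<inter> im_gam P X T)),
     far = (\<lambda>T T' f.
       \<lambda>V\<in>carrier ((homg P T (csO X))\<lparr>carrier := im_gam P X T\<rparr> Mod (im_rho P X T \<inter> im_gam P X T)).
         \<Union>s\<in>V. (im_rho P X T' \<inter> im_gam P X T') #>\<^bsub>homg P T' (csO X)\<^esub> cmp P T' T (csO X) f s)\<rparr>"

definition M_eps ::
  "('m set \<Rightarrow> 'g) \<Rightarrow> ('o, 'm) acat \<Rightarrow> ('o, 'm) cospan \<Rightarrow> 'o \<Rightarrow> 'g \<Rightarrow> 'g" where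
  "M_eps u P X = transport_trans P (\<lambda>f. u {f}) u (hom_functor P (csA X))
     (\<lambda>T t. (im_rho P X T \<inter> im_gam P X T) #>\<^bsub>homg P T (csO X)\<^esub> cmp P T (csA X) (csO X) t (gam X))"

definition M_bar :: "('m set \<Rightarrow> 'g) \<Rightarrow> ('o, 'm) acat \<Rightarrow>
    (('o, 'm) cospan, 'm set, ('o, 'm, 'g) presheaf, 'o \<Rightarrow> 'g \<Rightarrow> 'g) afunctor" where
  "M_bar u P = \<lparr>fob = (\<lambda>X. transport u (M_functor P X)),
     far = (\<lambda>X Y V. THE h. h \<in> arr (Mod_cat P) (transport u (M_functor P X)) (transport u (M_functor P Y)) \<and>
       (\<forall>a\<in>V. cmp (Mod_cat P) (rep u P (csA X)) (transport u (M_functor P X)) (transport u (M_functor P Y))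
                 (M_eps u P X) h
             = cmp (Mod_cat P) (rep u P (csA X)) (rep u P (csA Y)) (transport u (M_functor P Y))
                 (rep_map u P (csA X) (csA Y) a) (M_eps u P Y)))\<rparr>"

end

theory Submission
  imports Defs
begin

text \<open>
  Both sides are compared with weak kernels. The ideal of \<open>Aux(P)\<close> consists of the syzygies of the
  target, so an object of \<open>Q(P)\<close> amounts to an object \<open>A\<close> of \<open>P\<close> with the subfunctor \<open>N\<close> of
  \<open>(-,A)\<close> formed by its syzygies, and the functor it represents is \<open>(-,A)/N\<close>. In this description
  \<open>Q(P)\<close> always has cokernels and epi-mono factorizations, monomorphisms are pointwise injective,
  and an epimorphism splits modulo syzygies. The finitely presented functors are those for
  which \<open>N\<close> is the image of a single morphism, that is, they come from the cospans \<open>A = A \<leftarrow> R\<close>.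

  If \<open>P\<close> has weak kernels, then every \<open>N\<close> is such an image, so both categories agree, and kernels exist
  because weak pullbacks do. Conversely, kernels in either category yield weak kernels by testing on
  representable functors, and so does a finite presentation of the image of \<open>(-,\<alpha>)\<close>, because
  the kernel of an epimorphism from \<open>(-,A)\<close> to a finitely presented functor is finitely generated. Such
  a presentation is provided by an epi-mono factorization of \<open>\<alpha>\<close> among the finitely presented functors, and an
  abstract equivalence transports epi-mono factorizations from \<open>Q(P)\<close> to them.
\<close>

section \<open>Preadditive categories\<close>

text \<open>What makes Q(P) manageable although P has few limits is that three operations on the
  syzygy subfunctor stay inside cospans: enlarging it by the image of a morphism changes only the
  relation part, pulling it back along a morphism changes only the first object and
  \<open>gam\<close>, and intersecting takes biproducts. A pulled back subfunctor need not be
  generated by one morphism; there the finitely presented functors fall short and weak kernels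
  enter.

  Enlarging keeps \<open>gam\<close> an identity, so cokernels, and with them the splitting of
  epimorphisms, are available among presenting cospans too. The arguments about finitely presented
  functors are therefore carried out in full subcategories of Q(P) and passed through
  \<open>realization\<close>.

  The weak kernel hidden in a presentation comes from Schanuel's argument: with phi : A -> D and psi
  : D -> A, each t : T -> A is the sum of t phi psi and t (1 - phi psi). An abstract equivalence
  gives no control over representable functors, so only properties in categorical terms, such as
  epi-mono factorizations, can be moved along it.\<close>

context preadditive_cat
begin

lemma hom_group: "\<lbrakk>A \<in> obj C; B \<in> obj C\<rbrakk> \<Longrightarrow> group (homg C A B)"
  using hom_comm_group comm_group.axioms(2) by blast

lemma zero_closed [simp]: "\<lbrakk>A \<in> obj C; B \<in> obj C\<rbrakk> \<Longrightarrow> zero_arr C A B \<in> arr C A B"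
  by (simp add: hom_group group.is_monoid monoid.one_closed)

lemma add_closed [simp]: "\<lbrakk>A \<in> obj C; B \<in> obj C; f \<in> arr C A B; g \<in> arr C A B\<rbrakk>
    \<Longrightarrow> f \<otimes>\<^bsub>homg C A B\<^esub> g \<in> arr C A B"
  by (simp add: hom_group group.is_monoid monoid.m_closed)

lemma neg_closed [simp]: "\<lbrakk>A \<in> obj C; B \<in> obj C; f \<in> arr C A B\<rbrakk>
    \<Longrightarrow> inv\<^bsub>homg C A B\<^esub> f \<in> arr C A B"
  by (simp add: hom_group group.inv_closed)

lemmas [simp] = idn_closed cmp_closed idn_left idn_right

lemma cmp_left_hom: "\<lbrakk>A \<in> obj C; B \<in> obj C; D \<in> obj C; g \<in> arr C B D\<rbrakk>
    \<Longrightarrow> (\<lambda>f. cmp C A B D f g) \<in> hom (homg C A B) (homg C A D)"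
  by (auto intro!: homI simp: cmp_add_left)

lemma cmp_right_hom: "\<lbrakk>A \<in> obj C; B \<in> obj C; D \<in> obj C; f \<in> arr C A B\<rbrakk>
    \<Longrightarrow> (\<lambda>g. cmp C A B D f g) \<in> hom (homg C B D) (homg C A D)"
  by (auto intro!: homI simp: cmp_add_right)

lemma cmp_zero_left [simp]: "\<lbrakk>A \<in> obj C; B \<in> obj C; D \<in> obj C; g \<in> arr C B D\<rbrakk>
    \<Longrightarrow> cmp C A B D (zero_arr C A B) g = zero_arr C A D"
  using hom_one[OF cmp_left_hom hom_group hom_group] by simp

lemma cmp_zero_right [simp]: "\<lbrakk>A \<in> obj C; B \<in> obj C; D \<in> obj C; f \<in> arr C A B\<rbrakk>
    \<Longrightarrow> cmp C A B D f (zero_arr C B D) = zero_arr C A D"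
  using hom_one[OF cmp_right_hom hom_group hom_group] by simp

lemma cmp_neg_left: "\<lbrakk>A \<in> obj C; B \<in> obj C; D \<in> obj C; f \<in> arr C A B; g \<in> arr C B D\<rbrakk>
    \<Longrightarrow> cmp C A B D (inv\<^bsub>homg C A B\<^esub> f) g = inv\<^bsub>homg C A D\<^esub> cmp C A B D f g"
  using group_hom.hom_inv[OF group_hom.intro[OF hom_group hom_group group_hom_axioms.intro[OF cmp_left_hom]]]
  by simp

lemma cmp_neg_right: "\<lbrakk>A \<in> obj C; B \<in> obj C; D \<in> obj C; f \<in> arr C A B; g \<in> arr C B D\<rbrakk>
    \<Longrightarrow> cmp C A B D f (inv\<^bsub>homg C B D\<^esub> g) = inv\<^bsub>homg C A D\<^esub> cmp C A B D f g"
  using group_hom.hom_inv[OF group_hom.intro[OF hom_group hom_group group_hom_axioms.intro[OF cmp_right_hom]]]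
  by simp

section \<open>Isomorphisms, monomorphisms and kernels\<close>

lemma isomorphism_idn: "A \<in> obj C \<Longrightarrow> is_isomorphism C A A (idn C A)"
  unfolding is_isomorphism_def by (metis idn_closed idn_left)

lemma isomorphism_cmp:
  assumes obj: "A \<in> obj C" "B \<in> obj C" "D \<in> obj C"
    and f: "is_isomorphism C A B f" and g: "is_isomorphism C B D g"
  shows "is_isomorphism C A D (cmp C A B D f g)"
proof -
  from f obtain f' where f: "f \<in> arr C A B" and f': "f' \<in> arr C B A"
    and ff: "cmp C A B A f f' = idn C A" "cmp C B A B f' f = idn C B"
    unfolding is_isomorphism_def by blast
  from g obtain g' where g: "g \<in> arr C B D" and g': "g' \<in> arr C D B"
    and gg: "cmp C B D B g g' = idn C B" "cmp C D B D g' g = idn C D"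
    unfolding is_isomorphism_def by blast
  have "cmp C A D A (cmp C A B D f g) (cmp C D B A g' f') = cmp C A B A f (cmp C B D A g (cmp C D B A g' f'))"
    using obj f f' g g' by (simp add: cmp_assoc)
  also have "cmp C B D A g (cmp C D B A g' f') = f'"
    using obj f f' g g' gg by (simp flip: cmp_assoc)
  finally have 1: "cmp C A D A (cmp C A B D f g) (cmp C D B A g' f') = idn C A" by (simp add: ff)
  have "cmp C D A D (cmp C D B A g' f') (cmp C A B D f g) = cmp C D B D g' (cmp C B A D f' (cmp C A B D f g))"
    using obj f f' g g' by (simp add: cmp_assoc)
  also have "cmp C B A D f' (cmp C A B D f g) = g"
    using obj f f' g g' ff by (simp flip: cmp_assoc)
  finally have 2: "cmp C D A D (cmp C D B A g' f') (cmp C A B D f g) = idn C D" by (simp add: gg)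
  show ?thesis unfolding is_isomorphism_def
    using 1 2 obj f f' g g' by (meson cmp_closed)
qed

lemma isomorphic_refl: "A \<in> obj C \<Longrightarrow> isomorphic C A A"
  unfolding isomorphic_def using isomorphism_idn by blast

lemma isomorphic_sym: "isomorphic C A B \<Longrightarrow> isomorphic C B A"
  unfolding isomorphic_def is_isomorphism_def by blast

lemma isomorphic_trans:
  "\<lbrakk>A \<in> obj C; B \<in> obj C; D \<in> obj C; isomorphic C A B; isomorphic C B D\<rbrakk> \<Longrightarrow> isomorphic C A D"
  unfolding isomorphic_def using isomorphism_cmp by blast

lemma isomorphism_is_mono:
  assumes obj: "A \<in> obj C" "B \<in> obj C" and f: "is_isomorphism C A B f"
  shows "is_mono C A B f"
proof -
  from f obtain f' where f: "f \<in> arr C A B" and f': "f' \<in> arr C B A"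
    and ff: "cmp C A B A f f' = idn C A" unfolding is_isomorphism_def by blast
  have "g = h" if "T \<in> obj C" "g \<in> arr C T A" "h \<in> arr C T A" "cmp C T A B g f = cmp C T A B h f" for T g h
  proof -
    have "cmp C T A A g (cmp C A B A f f') = cmp C T A A h (cmp C A B A f f')"
      using that obj f f' by (simp flip: cmp_assoc)
    then show ?thesis using that obj ff by simp
  qed
  then show ?thesis using f unfolding is_mono_def by blast
qed

lemma mono_cmp:
  assumes obj: "A \<in> obj C" "B \<in> obj C" "D \<in> obj C"
    and f: "is_mono C A B f" and g: "is_mono C B D g"
  shows "is_mono C A D (cmp C A B D f g)"
  using assms unfolding is_mono_def by (auto simp flip: cmp_assoc)

lemma kernel_is_mono:
  assumes obj: "A \<in> obj C" "B \<in> obj C" and f: "f \<in> arr C A B" and k: "is_kernel C A B f K k"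
  shows "is_mono C K A k"
proof -
  have K: "K \<in> obj C" "k \<in> arr C K A" "cmp C K A B k f = zero_arr C K B"
    using k by (auto simp: is_kernel_def)
  have "g = h" if T: "T \<in> obj C" "g \<in> arr C T K" "h \<in> arr C T K" "cmp C T K A g k = cmp C T K A h k" for T g h
  proof -
    have "cmp C T A B (cmp C T K A g k) f = zero_arr C T B"
      using T K obj f by (simp add: cmp_assoc)
    then have "\<exists>!v. v \<in> arr C T K \<and> cmp C T K A g k = cmp C T K A v k"
      using k T K obj unfolding is_kernel_def by (metis cmp_closed)
    then show ?thesis using T(2,3,4) by (metis (no_types))
  qed
  then show ?thesis using K unfolding is_mono_def by blast
qed

lemma kernelD:
  assumes "is_kernel C A B f K k"
  shows "K \<in> obj C" "k \<in> arr C K A" "cmp C K A B k f = zero_arr C K B"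
    "\<And>T v. \<lbrakk>T \<in> obj C; v \<in> arr C T A; cmp C T A B v f = zero_arr C T B\<rbrakk> \<Longrightarrow> \<exists>u\<in>arr C T K. v = cmp C T K A u k"
  using assms unfolding is_kernel_def by (blast dest: ex1_implies_ex)+

text \<open>A monomorphism turns every existing factorization into a unique one, so a kernel is
  verified by a cancellation test and one lift.\<close>

lemma kernelI:
  assumes "K \<in> obj C" "is_mono C K A k" "cmp C K A B k f = zero_arr C K B"
    and "\<And>T v. \<lbrakk>T \<in> obj C; v \<in> arr C T A; cmp C T A B v f = zero_arr C T B\<rbrakk> \<Longrightarrow> \<exists>u\<in>arr C T K. v = cmp C T K A u k"
  shows "is_kernel C A B f K k"
  unfolding is_kernel_def
proof (intro conjI ballI impI)
  fix T v assume v: "T \<in> obj C" "v \<in> arr C T A" "cmp C T A B v f = zero_arr C T B"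
  then obtain u where "u \<in> arr C T K" "v = cmp C T K A u k" using assms(4) by blast
  then show "\<exists>!u. u \<in> arr C T K \<and> v = cmp C T K A u k"
    using assms(2) v(1) unfolding is_mono_def by (metis (no_types))
qed (use assms in \<open>auto simp: is_mono_def\<close>)

text \<open>Serves to replace a kernel object found in the target of an equivalence by an isomorphic
  one in the image of the functor.\<close>

lemma kernel_iso_cong:
  assumes obj: "A \<in> obj C" "B \<in> obj C" "L \<in> obj C" and f: "f \<in> arr C A B" and k: "is_kernel C A B f K k"
    and t: "is_isomorphism C L K t"
  shows "is_kernel C A B f L (cmp C L K A t k)"
proof -
  note K = kernelD[OF k]
  from t obtain t' where t': "t' \<in> arr C K L" "cmp C K L K t' t = idn C K" "t \<in> arr C L K"
    unfolding is_isomorphism_def by blast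
  have mono: "is_mono C L A (cmp C L K A t k)"
    using mono_cmp[OF obj(3) K(1) obj(1) isomorphism_is_mono[OF obj(3) K(1) t] kernel_is_mono[OF obj(1,2) f k]] .
  have ex: "\<exists>u\<in>arr C T L. v = cmp C T L A u (cmp C L K A t k)"
    if v: "T \<in> obj C" "v \<in> arr C T A" "cmp C T A B v f = zero_arr C T B" for T v
  proof -
    obtain w where w: "w \<in> arr C T K" "v = cmp C T K A w k" using K(4) v by blast
    have "cmp C T L A (cmp C T K L w t') (cmp C L K A t k) = cmp C T K A w (cmp C K L A t' (cmp C L K A t k))"
      using w v t' K obj by (simp add: cmp_assoc)
    also have "cmp C K L A t' (cmp C L K A t k) = k"
      using w v t' K obj by (simp flip: cmp_assoc)
    finally have "v = cmp C T L A (cmp C T K L w t') (cmp C L K A t k)" using w by simp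
    then show ?thesis using w v t' K obj by (metis cmp_closed)
  qed
  have "cmp C L A B (cmp C L K A t k) f = zero_arr C L B"
    using K t' obj f by (simp add: cmp_assoc)
  then show ?thesis using obj mono ex by (intro kernelI)
qed

text \<open>As \<open>t\<close> is mono, \<open>f\<close> and \<open>f t\<close> annihilate the same
  \<open>v\<close>. It allows the codomain of a morphism to be moved along an isomorphism.\<close>

lemma kernel_cmp_iso:
  assumes obj: "A \<in> obj C" "B \<in> obj C" "D \<in> obj C" and f: "f \<in> arr C A B" and k: "is_kernel C A B f K k"
    and t: "is_isomorphism C B D t"
  shows "is_kernel C A D (cmp C A B D f t) K k"
proof -
  have m: "is_mono C B D t" using assms isomorphism_is_mono by blast
  then have tt: "t \<in> arr C B D" by (simp add: is_mono_def)
  have "cmp C T A D v (cmp C A B D f t) = zero_arr C T D \<longleftrightarrow> cmp C T A B v f = zero_arr C T B"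
    if "T \<in> obj C" "v \<in> arr C T A" for T v
  proof -
    have "cmp C T A D v (cmp C A B D f t) = cmp C T B D (cmp C T A B v f) t"
      using that obj f tt by (simp add: cmp_assoc)
    moreover have "cmp C T B D (zero_arr C T B) t = zero_arr C T D" using that obj f tt by simp
    ultimately show ?thesis using m that obj f unfolding is_mono_def by (metis cmp_closed zero_closed)
  qed
  then show ?thesis using k unfolding is_kernel_def by auto
qed

end

text \<open>The axioms are self-dual, their left and right halves being exchanged. Facts on
  epimorphisms, cokernels and conormality are obtained from their duals through it.\<close>

lemma preadditive_op: "preadditive_cat C \<Longrightarrow> preadditive_cat (op_cat C)"
  by (simp add: preadditive_cat_def op_cat_def)

lemma op_simps [simp]:
  "obj (op_cat C) = obj C" "homg (op_cat C) A B = homg C B A" "idn (op_cat C) = idn C"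
  "cmp (op_cat C) A B D f g = cmp C D B A g f"
  by (simp_all add: op_cat_def)

lemma preadditive_full_subcat: "\<lbrakk>preadditive_cat C; S \<subseteq> obj C\<rbrakk> \<Longrightarrow> preadditive_cat (full_subcat C S)"
  by (simp add: preadditive_cat_def full_subcat_def subset_iff)

lemma isomorphism_op [simp]: "is_isomorphism (op_cat C) A B f \<longleftrightarrow> is_isomorphism C B A f"
  by (auto simp: is_isomorphism_def op_cat_def)

lemma mono_op [simp]: "is_mono (op_cat C) A B f \<longleftrightarrow> is_epi C B A f"
  by (auto simp: is_mono_def is_epi_def op_cat_def)

lemma kernel_op [simp]: "is_kernel (op_cat C) A B f K k \<longleftrightarrow> is_cokernel C B A f K k"
  by (auto simp: is_kernel_def is_cokernel_def op_cat_def)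

lemma has_kernels_op: "has_kernels (op_cat C) \<longleftrightarrow> has_cokernels C"
  unfolding has_kernels_def has_cokernels_def kernel_op by (auto simp: op_cat_def)

lemma isomorphic_full_subcat [simp]: "isomorphic (full_subcat C S) A B \<longleftrightarrow> isomorphic C A B"
  by (simp add: isomorphic_def is_isomorphism_def full_subcat_def)

section \<open>Fully faithful and essentially surjective functors\<close>

context preadditive_cat
begin

text \<open>If the identity of \<open>Z\<close> is zero, every morphism to or from \<open>Z\<close>
  equals its composite with that identity and vanishes. In this equational form the property passes
  through a functor.\<close>

lemma zero_object_iff: "is_zero_object C Z \<longleftrightarrow> Z \<in> obj C \<and> idn C Z = zero_arr C Z Z"
proof
  assume "is_zero_object C Z"
  then show "Z \<in> obj C \<and> idn C Z = zero_arr C Z Z"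
    unfolding is_zero_object_def by (metis idn_closed zero_closed)
next
  assume Z: "Z \<in> obj C \<and> idn C Z = zero_arr C Z Z"
  have 1: "f = zero_arr C A Z" if "A \<in> obj C" "f \<in> arr C A Z" for A f
    using that Z cmp_zero_right idn_right by metis
  have 2: "f = zero_arr C Z A" if "A \<in> obj C" "f \<in> arr C Z A" for A f
    using that Z cmp_zero_left idn_left by metis
  show "is_zero_object C Z"
    unfolding is_zero_object_def using Z 1 2 zero_closed by metis
qed

lemma epi_cmp:
  assumes obj: "A \<in> obj C" "B \<in> obj C" "D \<in> obj C"
    and f: "is_epi C A B f" and g: "is_epi C B D g"
  shows "is_epi C A D (cmp C A B D f g)"
  using assms unfolding is_epi_def by (auto simp: cmp_assoc)

lemma isomorphism_is_epi:
  assumes obj: "A \<in> obj C" "B \<in> obj C" and f: "is_isomorphism C A B f"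
  shows "is_epi C A B f"
  using preadditive_cat.isomorphism_is_mono[OF preadditive_op[OF preadditive_cat_axioms], of B A f] assms
  by simp

lemma isomorphismE:
  assumes "is_isomorphism C A B f"
  obtains f' where "f \<in> arr C A B" "f' \<in> arr C B A" "cmp C A B A f f' = idn C A" "cmp C B A B f' f = idn C B"
    "is_isomorphism C B A f'"
  using assms unfolding is_isomorphism_def by blast

lemma cmp_cancel_left:
  assumes "A \<in> obj C" "B \<in> obj C" "D \<in> obj C" "f \<in> arr C A B" "f' \<in> arr C B A" "g \<in> arr C B D"
    "cmp C B A B f' f = idn C B"
  shows "cmp C B A D f' (cmp C A B D f g) = g"
  using assms by (simp flip: cmp_assoc)

text \<open>Used when morphisms are conjugated by an isomorphism: the inner pair \<open>f' f\<close>
  disappears.\<close>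

lemma cmp_cancel_mid:
  assumes "A \<in> obj C" "B \<in> obj C" "D \<in> obj C" "E \<in> obj C" "f \<in> arr C A B" "f' \<in> arr C B A" "g \<in> arr C B D"
    "cmp C B A B f' f = idn C B" "h \<in> arr C E B"
  shows "cmp C E A D (cmp C E B A h f') (cmp C A B D f g) = cmp C E B D h g"
  using assms by (simp add: cmp_assoc cmp_cancel_left)

end

definition fully_faithful :: "('o, 'm) acat \<Rightarrow> ('p, 'n) acat \<Rightarrow> ('o, 'm, 'p, 'n) afunctor \<Rightarrow> bool" where
  "fully_faithful C D F \<longleftrightarrow> is_functor C D F \<and>
     (\<forall>A\<in>obj C. \<forall>B\<in>obj C. bij_betw (far F A B) (arr C A B) (arr D (fob F A) (fob F B)))"

definition ess_surj :: "('o, 'm) acat \<Rightarrow> ('p, 'n) acat \<Rightarrow> ('o, 'm, 'p, 'n) afunctor \<Rightarrow> bool" where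
  "ess_surj C D F \<longleftrightarrow> (\<forall>B\<in>obj D. \<exists>A\<in>obj C. isomorphic D (fob F A) B)"

definition op_functor :: "('o, 'm, 'p, 'n) afunctor \<Rightarrow> ('o, 'm, 'p, 'n) afunctor" where
  "op_functor F = \<lparr>fob = fob F, far = (\<lambda>A B. far F B A)\<rparr>"

lemma op_functor_simps [simp]: "fob (op_functor F) = fob F" "far (op_functor F) A B = far F B A"
  by (simp_all add: op_functor_def)

text \<open>Full faithfulness and essential surjectivity take the place of a pair of inverse
  functors: \<open>realization\<close> comes in this form, and the transfers below lift single
  objects and morphisms. That it agrees with \<open>equivalent_cats\<close> is shown in the next
  section.\<close>

locale cat_equivalence = C: preadditive_cat C + D: preadditive_cat D
  for C :: "('o, 'm) acat" and D :: "('p, 'n) acat" +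
  fixes F :: "('o, 'm, 'p, 'n) afunctor"
  assumes ff: "fully_faithful C D F" and es: "ess_surj C D F"
begin

lemma is_func: "is_functor C D F"
  using ff by (simp add: fully_faithful_def)

lemma F_ob [simp]: "A \<in> obj C \<Longrightarrow> fob F A \<in> obj D"
  using is_func by (simp add: is_functor_def)

lemma F_hom: "\<lbrakk>A \<in> obj C; B \<in> obj C\<rbrakk> \<Longrightarrow> far F A B \<in> hom (homg C A B) (homg D (fob F A) (fob F B))"
  using is_func by (simp add: is_functor_def)

lemma F_ar [simp]: "\<lbrakk>A \<in> obj C; B \<in> obj C; f \<in> arr C A B\<rbrakk> \<Longrightarrow> far F A B f \<in> arr D (fob F A) (fob F B)"
  using F_hom unfolding hom_def by blast

lemma F_idn [simp]: "A \<in> obj C \<Longrightarrow> far F A A (idn C A) = idn D (fob F A)"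
  using is_func by (simp add: is_functor_def)

lemma F_cmp: "\<lbrakk>A \<in> obj C; B \<in> obj C; E \<in> obj C; f \<in> arr C A B; g \<in> arr C B E\<rbrakk>
    \<Longrightarrow> far F A E (cmp C A B E f g) = cmp D (fob F A) (fob F B) (fob F E) (far F A B f) (far F B E g)"
  using is_func by (simp add: is_functor_def)

lemma F_zero [simp]: "\<lbrakk>A \<in> obj C; B \<in> obj C\<rbrakk> \<Longrightarrow> far F A B (zero_arr C A B) = zero_arr D (fob F A) (fob F B)"
  using hom_one[OF F_hom C.hom_group D.hom_group] by simp

lemma F_add: "\<lbrakk>A \<in> obj C; B \<in> obj C; f \<in> arr C A B; g \<in> arr C A B\<rbrakk>
    \<Longrightarrow> far F A B (f \<otimes>\<^bsub>homg C A B\<^esub> g) = far F A B f \<otimes>\<^bsub>homg D (fob F A) (fob F B)\<^esub> far F A B g"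
  using hom_mult[OF F_hom] by simp

lemma F_eq_iff: "\<lbrakk>A \<in> obj C; B \<in> obj C; f \<in> arr C A B; g \<in> arr C A B\<rbrakk>
    \<Longrightarrow> far F A B f = far F A B g \<longleftrightarrow> f = g"
  using ff unfolding fully_faithful_def bij_betw_def inj_on_def by blast

lemma F_inj: "\<lbrakk>A \<in> obj C; B \<in> obj C; f \<in> arr C A B; g \<in> arr C A B; far F A B f = far F A B g\<rbrakk> \<Longrightarrow> f = g"
  using F_eq_iff by blast

lemma F_full:
  assumes "A \<in> obj C" "B \<in> obj C" "g \<in> arr D (fob F A) (fob F B)"
  obtains f where "f \<in> arr C A B" "g = far F A B f"
  using assms ff unfolding fully_faithful_def bij_betw_def by blast

lemma F_ess:
  assumes "B \<in> obj D"
  obtains A t t' where "A \<in> obj C" "t \<in> arr D (fob F A) B" "t' \<in> arr D B (fob F A)"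
    "cmp D (fob F A) B (fob F A) t t' = idn D (fob F A)" "cmp D B (fob F A) B t' t = idn D B"
    "is_isomorphism D (fob F A) B t" "is_isomorphism D B (fob F A) t'"
  using assms es unfolding ess_surj_def isomorphic_def by (metis D.isomorphismE)

section \<open>Invariance of categorical properties under an equivalence\<close>

lemma isomorphism_iff:
  assumes "A \<in> obj C" "B \<in> obj C" "f \<in> arr C A B"
  shows "is_isomorphism D (fob F A) (fob F B) (far F A B f) \<longleftrightarrow> is_isomorphism C A B f"
proof
  assume "is_isomorphism D (fob F A) (fob F B) (far F A B f)"
  then obtain g' where g': "g' \<in> arr D (fob F B) (fob F A)" "cmp D (fob F A) (fob F B) (fob F A) (far F A B f) g' = idn D (fob F A)"
      "cmp D (fob F B) (fob F A) (fob F B) g' (far F A B f) = idn D (fob F B)"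
    by (auto simp: is_isomorphism_def)
  obtain g where "g \<in> arr C B A" "g' = far F B A g" using F_full g' assms by metis
  then show "is_isomorphism C A B f"
    unfolding is_isomorphism_def using g' assms
    by (metis C.cmp_closed C.idn_closed F_cmp F_eq_iff F_idn)
next
  assume "is_isomorphism C A B f"
  then show "is_isomorphism D (fob F A) (fob F B) (far F A B f)"
    unfolding is_isomorphism_def using assms by (metis F_ar F_cmp F_idn)
qed

lemma isomorphic_iff:
  assumes "A \<in> obj C" "B \<in> obj C"
  shows "isomorphic D (fob F A) (fob F B) \<longleftrightarrow> isomorphic C A B"
proof
  assume "isomorphic D (fob F A) (fob F B)"
  then obtain g where g: "is_isomorphism D (fob F A) (fob F B) g" by (auto simp: isomorphic_def)
  then obtain f where "f \<in> arr C A B" "g = far F A B f"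
    using F_full assms unfolding is_isomorphism_def by metis
  then show "isomorphic C A B" using g assms isomorphism_iff unfolding isomorphic_def by blast
next
  assume "isomorphic C A B"
  then obtain f where f: "is_isomorphism C A B f" by (auto simp: isomorphic_def)
  then have "f \<in> arr C A B" by (simp add: is_isomorphism_def)
  then show "isomorphic D (fob F A) (fob F B)"
    using f assms isomorphism_iff unfolding isomorphic_def by blast
qed

lemma mono_iff:
  assumes obj: "A \<in> obj C" "B \<in> obj C" and f: "f \<in> arr C A B"
  shows "is_mono D (fob F A) (fob F B) (far F A B f) \<longleftrightarrow> is_mono C A B f"
proof
  assume m: "is_mono D (fob F A) (fob F B) (far F A B f)"
  have "g = h" if T: "T \<in> obj C" "g \<in> arr C T A" "h \<in> arr C T A" "cmp C T A B g f = cmp C T A B h f" for T g h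
  proof -
    have "cmp D (fob F T) (fob F A) (fob F B) (far F T A g) (far F A B f)
      = cmp D (fob F T) (fob F A) (fob F B) (far F T A h) (far F A B f)"
      using T obj f by (simp flip: F_cmp)
    then have "far F T A g = far F T A h" using m T obj unfolding is_mono_def by (metis F_ob F_ar)
    then show ?thesis using T obj F_eq_iff by simp
  qed
  then show "is_mono C A B f" using f unfolding is_mono_def by blast
next
  assume m: "is_mono C A B f"
  have "g = h" if T: "T \<in> obj D" and g: "g \<in> arr D T (fob F A)" and h: "h \<in> arr D T (fob F A)"
    and eq: "cmp D T (fob F A) (fob F B) g (far F A B f) = cmp D T (fob F A) (fob F B) h (far F A B f)" for T g h
  proof -
    \<comment> \<open>A test object \<open>T\<close> of \<open>D\<close> need not be a value of
      \<open>F\<close>. The test morphisms are moved to \<open>fob F T'\<close> along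
      \<open>t\<close>, compared in \<open>C\<close>, and \<open>t\<close> is cancelled by
      \<open>t'\<close>.\<close>
    obtain T' t t' where T': "T' \<in> obj C" and t: "t \<in> arr D (fob F T') T" "t' \<in> arr D T (fob F T')"
      and tt: "cmp D T (fob F T') T t' t = idn D T"
      using F_ess[OF T] by metis
    obtain g' where g': "g' \<in> arr C T' A" "cmp D (fob F T') T (fob F A) t g = far F T' A g'"
      using F_full[of T' A "cmp D (fob F T') T (fob F A) t g"] T t T' g obj by auto
    obtain h' where h': "h' \<in> arr C T' A" "cmp D (fob F T') T (fob F A) t h = far F T' A h'"
      using F_full[of T' A "cmp D (fob F T') T (fob F A) t h"] T t T' h obj by auto
    have "far F T' B (cmp C T' A B g' f) = far F T' B (cmp C T' A B h' f)"
      using g' h' T T' t obj f g h eq by (simp add: F_cmp D.cmp_assoc flip: g'(2) h'(2))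
    then have "cmp C T' A B g' f = cmp C T' A B h' f" using g' h' T' obj f by (simp add: F_eq_iff)
    then have "g' = h'" using m T' g' h' unfolding is_mono_def by blast
    then have "cmp D (fob F T') T (fob F A) t g = cmp D (fob F T') T (fob F A) t h" using g' h' by simp
    then show ?thesis using D.cmp_cancel_left[OF _ T _ t _ tt] T T' t g h tt obj by (metis F_ob)
  qed
  then show "is_mono D (fob F A) (fob F B) (far F A B f)" using f obj unfolding is_mono_def by simp
qed

lemma kernel_iff:
  assumes obj: "A \<in> obj C" "B \<in> obj C" "K \<in> obj C" and f: "f \<in> arr C A B" and k: "k \<in> arr C K A"
  shows "is_kernel D (fob F A) (fob F B) (far F A B f) (fob F K) (far F K A k) \<longleftrightarrow> is_kernel C A B f K k"
proof
  assume ker: "is_kernel D (fob F A) (fob F B) (far F A B f) (fob F K) (far F K A k)"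
  show "is_kernel C A B f K k"
  proof (rule C.kernelI)
    show "is_mono C K A k"
      using D.kernel_is_mono[OF _ _ _ ker] obj f k by (simp add: mono_iff)
    have "far F K B (cmp C K A B k f) = far F K B (zero_arr C K B)"
      using D.kernelD(3)[OF ker] obj f k by (simp add: F_cmp)
    then show "cmp C K A B k f = zero_arr C K B" by (rule F_inj[rotated -1]) (use obj f k in simp_all)
    fix T v assume v: "T \<in> obj C" "v \<in> arr C T A" "cmp C T A B v f = zero_arr C T B"
    then have "cmp D (fob F T) (fob F A) (fob F B) (far F T A v) (far F A B f) = zero_arr D (fob F T) (fob F B)"
      using obj f by (simp flip: F_cmp)
    then obtain w where w: "w \<in> arr D (fob F T) (fob F K)" "far F T A v = cmp D (fob F T) (fob F K) (fob F A) w (far F K A k)"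
      using D.kernelD(4)[OF ker, of "fob F T" "far F T A v"] v obj by auto
    obtain w' where w': "w' \<in> arr C T K" "w = far F T K w'" using F_full w v obj by metis
    then have "v = cmp C T K A w' k" using w v obj k by (simp flip: F_cmp add: F_eq_iff)
    then show "\<exists>u\<in>arr C T K. v = cmp C T K A u k" using w' by blast
  qed (use obj in simp)
next
  assume ker: "is_kernel C A B f K k"
  show "is_kernel D (fob F A) (fob F B) (far F A B f) (fob F K) (far F K A k)"
  proof (rule D.kernelI)
    show "is_mono D (fob F K) (fob F A) (far F K A k)"
      using C.kernel_is_mono[OF _ _ _ ker] obj f k by (simp add: mono_iff)
    show "cmp D (fob F K) (fob F A) (fob F B) (far F K A k) (far F A B f) = zero_arr D (fob F K) (fob F B)"
      using C.kernelD(3)[OF ker] obj f k by (simp flip: F_cmp)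
    fix T v assume T: "T \<in> obj D" and v: "v \<in> arr D T (fob F A)"
      "cmp D T (fob F A) (fob F B) v (far F A B f) = zero_arr D T (fob F B)"
    \<comment> \<open>As for monomorphisms, the test morphism is moved to a value of
      \<open>F\<close>, factored in \<open>C\<close>, and brought back by \<open>t'\<close>.\<close>
    obtain T' t t' where T': "T' \<in> obj C" and t: "t \<in> arr D (fob F T') T" "t' \<in> arr D T (fob F T')"
      and tt: "cmp D T (fob F T') T t' t = idn D T"
      using F_ess[OF T] by metis
    obtain v' where v': "v' \<in> arr C T' A" "cmp D (fob F T') T (fob F A) t v = far F T' A v'"
      using F_full[of T' A "cmp D (fob F T') T (fob F A) t v"] T t T' v obj by auto
    have "far F T' B (cmp C T' A B v' f) = far F T' B (zero_arr C T' B)"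
      using v' v T T' t obj f by (simp add: F_cmp D.cmp_assoc flip: v'(2))
    then have "cmp C T' A B v' f = zero_arr C T' B" by (rule F_inj[rotated -1]) (use v' T' obj f in simp_all)
    then obtain w where w: "w \<in> arr C T' K" "v' = cmp C T' K A w k" using C.kernelD(4)[OF ker] T' v' by blast
    have "v = cmp D T (fob F T') (fob F A) t' (cmp D (fob F T') T (fob F A) t v)"
      using D.cmp_cancel_left[OF _ T _ t _ tt] v obj T' by simp
    also have "\<dots> = cmp D T (fob F K) (fob F A) (cmp D T (fob F T') (fob F K) t' (far F T' K w)) (far F K A k)"
      using v' w T T' t obj k by (simp add: F_cmp D.cmp_assoc)
    finally show "\<exists>u\<in>arr D T (fob F K). v = cmp D T (fob F K) (fob F A) u (far F K A k)"
      using T T' t w obj by (metis D.cmp_closed F_ar F_ob)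
  qed (use obj in simp)
qed

lemma equivalence_op: "cat_equivalence (op_cat C) (op_cat D) (op_functor F)"
proof -
  have "is_functor (op_cat C) (op_cat D) (op_functor F)"
    using is_func by (simp add: is_functor_def)
  moreover have "ess_surj (op_cat C) (op_cat D) (op_functor F)"
    using es C.isomorphic_sym D.isomorphic_sym
    unfolding ess_surj_def isomorphic_def isomorphism_op op_simps op_functor_simps by blast
  ultimately show ?thesis
    using ff unfolding cat_equivalence_def cat_equivalence_axioms_def fully_faithful_def
    by (simp add: C.preadditive_cat_axioms D.preadditive_cat_axioms preadditive_op)
qed

lemma epi_iff:
  assumes "A \<in> obj C" "B \<in> obj C" "f \<in> arr C A B"
  shows "is_epi D (fob F A) (fob F B) (far F A B f) \<longleftrightarrow> is_epi C A B f"
  using cat_equivalence.mono_iff[OF equivalence_op, of B A f] assms by simp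

text \<open>Transfers run from \<open>D\<close> back to \<open>C\<close>: an object found in
  \<open>D\<close> is replaced by an isomorphic value of \<open>F\<close>, after which fullness
  lifts the morphisms. The opposite direction is reached by an equivalence from \<open>D\<close> to
  \<open>C\<close>.\<close>

lemma has_kernels_transfer:
  assumes "has_kernels D" shows "has_kernels C"
  unfolding has_kernels_def
proof (intro ballI)
  fix A B f assume A: "A \<in> obj C" "B \<in> obj C" and f: "f \<in> arr C A B"
  then obtain K' k' where K': "is_kernel D (fob F A) (fob F B) (far F A B f) K' k'"
    using assms unfolding has_kernels_def by (meson F_ar F_ob)
  obtain K t where K: "K \<in> obj C" "is_isomorphism D (fob F K) K' t"
    using F_ess[OF D.kernelD(1)[OF K']] by metis
  have ker: "is_kernel D (fob F A) (fob F B) (far F A B f) (fob F K) (cmp D (fob F K) K' (fob F A) t k')"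
    using D.kernel_iso_cong[OF _ _ _ _ K' K(2)] K A f by simp
  obtain k where k: "k \<in> arr C K A" "cmp D (fob F K) K' (fob F A) t k' = far F K A k"
    using F_full[OF K(1) A(1) D.kernelD(2)[OF ker]] .
  show "\<exists>K k. is_kernel C A B f K k"
    using ker k kernel_iff[OF A K(1) f k(1)] by auto
qed

lemma has_cokernels_transfer:
  assumes "has_cokernels D" shows "has_cokernels C"
  using assms cat_equivalence.has_kernels_transfer[OF equivalence_op] by (simp add: has_kernels_op)

text \<open>Here the object to be replaced is the codomain of the morphism whose kernel is
  \<open>f\<close>, whence \<open>kernel_cmp_iso\<close>. Normality is a plain premise so that the
  lemma also applies to the opposite categories.\<close>

lemma mono_normal_transfer:
  assumes normal: "\<And>A B f. \<lbrakk>A \<in> obj D; B \<in> obj D; is_mono D A B f\<rbrakk> \<Longrightarrow> \<exists>E\<in>obj D. \<exists>g\<in>arr D B E. is_kernel D B E g A f"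
    and A: "A \<in> obj C" "B \<in> obj C" and m: "is_mono C A B f"
  shows "\<exists>E\<in>obj C. \<exists>g\<in>arr C B E. is_kernel C B E g A f"
proof -
  have f: "f \<in> arr C A B" using m by (simp add: is_mono_def)
  then have "is_mono D (fob F A) (fob F B) (far F A B f)" using m A by (simp add: mono_iff)
  then obtain E' g' where E': "E' \<in> obj D" and g': "g' \<in> arr D (fob F B) E'"
      "is_kernel D (fob F B) E' g' (fob F A) (far F A B f)"
    using normal[OF F_ob F_ob] A by blast
  obtain E t where E: "E \<in> obj C" "is_isomorphism D E' (fob F E) t" "t \<in> arr D E' (fob F E)"
    using F_ess[OF E'] by metis
  obtain g where g: "g \<in> arr C B E" "cmp D (fob F B) E' (fob F E) g' t = far F B E g"
    using F_full[of B E "cmp D (fob F B) E' (fob F E) g' t"] A E E' g' by auto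
  have "is_kernel D (fob F B) (fob F E) (far F B E g) (fob F A) (far F A B f)"
    using D.kernel_cmp_iso[OF _ E' _ g' E(2)] A E g by simp
  then show ?thesis using kernel_iff[OF A(2) E(1) A(1) g(1) f] E g by auto
qed

lemma zero_object_transfer:
  assumes "is_zero_object D Z'" shows "\<exists>Z. is_zero_object C Z"
proof -
  have Z': "Z' \<in> obj D" "idn D Z' = zero_arr D Z' Z'" using assms D.zero_object_iff by auto
  obtain Z t t' where Z: "Z \<in> obj C" and t: "t \<in> arr D (fob F Z) Z'" "t' \<in> arr D Z' (fob F Z)"
      "cmp D (fob F Z) Z' (fob F Z) t t' = idn D (fob F Z)"
    using F_ess[OF Z'(1)] by metis
  have "t = zero_arr D (fob F Z) Z'"
    using Z Z' t D.idn_right[of "fob F Z" Z' t] by (metis D.cmp_zero_right F_ob)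
  then have "far F Z Z (idn C Z) = far F Z Z (zero_arr C Z Z)"
    using Z Z' t by simp
  then have "idn C Z = zero_arr C Z Z" using Z F_eq_iff[OF Z Z] C.idn_closed C.zero_closed by blast
  then show ?thesis using Z C.zero_object_iff by blast
qed

text \<open>A biproduct is given by equations, and these survive conjugation by the isomorphism
  between \<open>fob F S\<close> and \<open>S'\<close>.\<close>

lemma biproduct_transfer:
  assumes A: "A \<in> obj C" and B: "B \<in> obj C" and bip: "is_biproduct D (fob F A) (fob F B) S' i' j' p' q'"
  shows "\<exists>S i j p q. is_biproduct C A B S i j p q"
proof -
  from bip have S': "S' \<in> obj D" and maps: "i' \<in> arr D (fob F A) S'" "j' \<in> arr D (fob F B) S'"
      "p' \<in> arr D S' (fob F A)" "q' \<in> arr D S' (fob F B)"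
    and eqs: "cmp D (fob F A) S' (fob F A) i' p' = idn D (fob F A)" "cmp D (fob F B) S' (fob F B) j' q' = idn D (fob F B)"
     "cmp D (fob F A) S' (fob F B) i' q' = zero_arr D (fob F A) (fob F B)"
     "cmp D (fob F B) S' (fob F A) j' p' = zero_arr D (fob F B) (fob F A)"
     "cmp D S' (fob F A) S' p' i' \<otimes>\<^bsub>homg D S' S'\<^esub> cmp D S' (fob F B) S' q' j' = idn D S'"
    by (auto simp: is_biproduct_def)
  obtain S t t' where S: "S \<in> obj C" and t: "t \<in> arr D (fob F S) S'" "t' \<in> arr D S' (fob F S)"
    and tt: "cmp D (fob F S) S' (fob F S) t t' = idn D (fob F S)" "cmp D S' (fob F S) S' t' t = idn D S'"
    using F_ess[OF S'] by metis
  have FF: "fob F A \<in> obj D" "fob F B \<in> obj D" "fob F S \<in> obj D" using A B S by auto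
  obtain i where i: "i \<in> arr C A S" "cmp D (fob F A) S' (fob F S) i' t' = far F A S i"
    using F_full[OF A S D.cmp_closed] FF S' maps t by metis
  obtain j where j: "j \<in> arr C B S" "cmp D (fob F B) S' (fob F S) j' t' = far F B S j"
    using F_full[OF B S D.cmp_closed] FF S' maps t by metis
  obtain p where p: "p \<in> arr C S A" "cmp D (fob F S) S' (fob F A) t p' = far F S A p"
    using F_full[OF S A D.cmp_closed] FF S' maps t by metis
  obtain q where q: "q \<in> arr C S B" "cmp D (fob F S) S' (fob F B) t q' = far F S B q"
    using F_full[OF S B D.cmp_closed] FF S' maps t by metis
  note mid = D.cmp_cancel_mid[OF FF(3) S' _ _ t _ tt(2)]
  have e1: "far F A A (cmp C A S A i p) = far F A A (idn C A)"
    using mid i j p q maps eqs FF A B S S' by (simp add: F_cmp flip: i(2) j(2) p(2) q(2))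
  have e2: "far F B B (cmp C B S B j q) = far F B B (idn C B)"
    using mid i j p q maps eqs FF A B S S' by (simp add: F_cmp flip: i(2) j(2) p(2) q(2))
  have e3: "far F A B (cmp C A S B i q) = far F A B (zero_arr C A B)"
    using mid i j p q maps eqs FF A B S S' by (simp add: F_cmp flip: i(2) j(2) p(2) q(2))
  have e4: "far F B A (cmp C B S A j p) = far F B A (zero_arr C B A)"
    using mid i j p q maps eqs FF A B S S' by (simp add: F_cmp flip: i(2) j(2) p(2) q(2))
  \<comment> \<open>The last equation conjugates a sum of endomorphisms of \<open>S'\<close>, so
    bilinearity must pull \<open>t\<close> and \<open>t'\<close> out of it before they
    cancel.\<close>
  have e5: "far F S S (cmp C S A S p i \<otimes>\<^bsub>homg C S S\<^esub> cmp C S B S q j) = far F S S (idn C S)"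
  proof -
    have "far F S S (cmp C S A S p i \<otimes>\<^bsub>homg C S S\<^esub> cmp C S B S q j)
        = cmp D (fob F S) S' (fob F S) t (cmp D S' S' (fob F S) (cmp D S' (fob F A) S' p' i') t')
          \<otimes>\<^bsub>homg D (fob F S) (fob F S)\<^esub> cmp D (fob F S) S' (fob F S) t (cmp D S' S' (fob F S) (cmp D S' (fob F B) S' q' j') t')"
      using i j p q maps FF A B S S' t by (simp add: F_cmp F_add D.cmp_assoc flip: i(2) j(2) p(2) q(2))
    also have "\<dots> = cmp D (fob F S) S' (fob F S) t (cmp D S' S' (fob F S)
        (cmp D S' (fob F A) S' p' i' \<otimes>\<^bsub>homg D S' S'\<^esub> cmp D S' (fob F B) S' q' j') t')"
      using maps FF S' t by (simp add: D.cmp_add_left D.cmp_add_right)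
    finally show ?thesis using eqs tt t S S' FF by simp
  qed
  have "is_biproduct C A B S i j p q"
    unfolding is_biproduct_def using i(1) j(1) p(1) q(1) A B S
      F_inj[OF _ _ _ _ e1] F_inj[OF _ _ _ _ e2] F_inj[OF _ _ _ _ e3] F_inj[OF _ _ _ _ e4] F_inj[OF _ _ _ _ e5]
    by simp
  then show ?thesis by blast
qed

lemma abelian_transfer:
  assumes "abelian_cat D" shows "abelian_cat C"
proof -
  interpret D: abelian_cat D by fact
  show ?thesis
  proof
    show "\<exists>Z. is_zero_object C Z" using D.ex_zero_object zero_object_transfer by blast
    show "\<exists>S i j p q. is_biproduct C A B S i j p q" if "A \<in> obj C" "B \<in> obj C" for A B
      using D.ex_biproduct that biproduct_transfer by (metis F_ob)
    show "has_kernels C" using D.kernels has_kernels_transfer by blast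
    show "has_cokernels C" using D.cokernels has_cokernels_transfer by blast
    show "\<exists>D\<in>obj C. \<exists>g\<in>arr C B D. is_kernel C B D g A f"
      if "A \<in> obj C" "B \<in> obj C" "is_mono C A B f" for A B f
      using mono_normal_transfer[OF D.mono_normal] that by blast
    show "\<exists>D\<in>obj C. \<exists>g\<in>arr C D A. is_cokernel C D A g B f"
      if "A \<in> obj C" "B \<in> obj C" "is_epi C A B f" for A B f
    proof -
      \<comment> \<open>Conormality is normality in the opposite category, where
        \<open>op_functor\<close> is again an equivalence.\<close>
      have "\<exists>E\<in>obj (op_cat C). \<exists>g\<in>arr (op_cat C) A E. is_kernel (op_cat C) A E g B f"
      proof (rule cat_equivalence.mono_normal_transfer[OF equivalence_op])
        fix A B f assume "A \<in> obj (op_cat D)" "B \<in> obj (op_cat D)" "is_mono (op_cat D) A B f"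
        then show "\<exists>E\<in>obj (op_cat D). \<exists>g\<in>arr (op_cat D) B E. is_kernel (op_cat D) B E g A f"
          using D.epi_conormal[of B A f] by simp
      qed (use that in simp_all)
      then show ?thesis by simp
    qed
  qed
qed

lemma epi_mono_fact_iff:
  assumes "A \<in> obj C" "B \<in> obj C" "I \<in> obj C" "f \<in> arr C A B" "e \<in> arr C A I" "m \<in> arr C I B"
  shows "is_epi_mono_fact D (fob F A) (fob F B) (far F A B f) (fob F I) (far F A I e) (far F I B m)
    \<longleftrightarrow> is_epi_mono_fact C A B f I e m"
  using assms by (simp add: is_epi_mono_fact_def mono_iff epi_iff F_eq_iff flip: F_cmp)

lemma epi_mono_factorizations_transfer:
  assumes "has_epi_mono_factorizations D" shows "has_epi_mono_factorizations C"
  unfolding has_epi_mono_factorizations_def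
proof (intro ballI conjI allI impI)
  fix A B f assume A: "A \<in> obj C" and B: "B \<in> obj C" and f: "f \<in> arr C A B"
  have ff: "far F A B f \<in> arr D (fob F A) (fob F B)" using A B f by simp
  obtain I' e' m' where fac: "is_epi_mono_fact D (fob F A) (fob F B) (far F A B f) I' e' m'"
    using assms A B ff unfolding has_epi_mono_factorizations_def by (meson F_ob)
  then have I': "I' \<in> obj D" "e' \<in> arr D (fob F A) I'" "m' \<in> arr D I' (fob F B)" "is_epi D (fob F A) I' e'"
    "is_mono D I' (fob F B) m'" "far F A B f = cmp D (fob F A) I' (fob F B) e' m'"
    by (auto simp: is_epi_mono_fact_def is_epi_def is_mono_def)
  obtain I t t' where I: "I \<in> obj C" and t: "t \<in> arr D (fob F I) I'" "t' \<in> arr D I' (fob F I)"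
    "cmp D I' (fob F I) I' t' t = idn D I'" "is_isomorphism D (fob F I) I' t" "is_isomorphism D I' (fob F I) t'"
    using F_ess[OF I'(1)] by metis
  have FF: "fob F A \<in> obj D" "fob F B \<in> obj D" "fob F I \<in> obj D" using A B I by auto
  obtain e where e: "e \<in> arr C A I" "cmp D (fob F A) I' (fob F I) e' t' = far F A I e"
    using F_full[OF A I D.cmp_closed] FF I' t by metis
  obtain m where m: "m \<in> arr C I B" "cmp D (fob F I) I' (fob F B) t m' = far F I B m"
    using F_full[OF I B D.cmp_closed] FF I' t by metis
  have "is_epi D (fob F A) (fob F I) (far F A I e)"
    using D.epi_cmp[OF FF(1) I'(1) FF(3) I'(4) D.isomorphism_is_epi[OF I'(1) FF(3) t(5)]] e by simp
  moreover have "is_mono D (fob F I) (fob F B) (far F I B m)"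
    using D.mono_cmp[OF FF(3) I'(1) FF(2) D.isomorphism_is_mono[OF FF(3) I'(1) t(4)] I'(5)] m by simp
  moreover have "far F A B f = cmp D (fob F A) (fob F I) (fob F B) (far F A I e) (far F I B m)"
    using D.cmp_cancel_mid[OF FF(3) I'(1) FF(2) FF(1) t(1,2) _ t(3)] I' by (simp flip: e(2) m(2))
  ultimately have "is_epi_mono_fact D (fob F A) (fob F B) (far F A B f) (fob F I) (far F A I e) (far F I B m)"
    unfolding is_epi_mono_fact_def using FF by simp
  then show "\<exists>I e m. is_epi_mono_fact C A B f I e m"
    using epi_mono_fact_iff A B I f e m by blast
next
  fix A B f I e m I' e' m'
  assume A: "A \<in> obj C" and B: "B \<in> obj C" and f: "f \<in> arr C A B"
    and 1: "is_epi_mono_fact C A B f I e m" and 2: "is_epi_mono_fact C A B f I' e' m'"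
  have I: "I \<in> obj C" "e \<in> arr C A I" "m \<in> arr C I B" and I': "I' \<in> obj C" "e' \<in> arr C A I'" "m' \<in> arr C I' B"
    using 1 2 by (auto simp: is_epi_mono_fact_def is_epi_def is_mono_def)
  \<comment> \<open>\<open>?Q\<close> is \<open>?P\<close> expressed in \<open>D\<close>; full
    faithfulness carries a unique comparison there to a unique one in \<open>C\<close>.\<close>
  let ?P = "\<lambda>t. is_isomorphism C I I' t \<and> cmp C A I I' e t = e' \<and> cmp C I I' B t m' = m"
  let ?Q = "\<lambda>t. is_isomorphism D (fob F I) (fob F I') t \<and> cmp D (fob F A) (fob F I) (fob F I') (far F A I e) t = far F A I' e'
    \<and> cmp D (fob F I) (fob F I') (fob F B) t (far F I' B m') = far F I B m"
  have PQ: "?Q (far F I I' t) \<longleftrightarrow> ?P t" if "t \<in> arr C I I'" for t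
    using that A B I I' by (simp add: isomorphism_iff F_eq_iff flip: F_cmp)
  have "\<exists>!t. ?Q t"
    using assms[unfolded has_epi_mono_factorizations_def, rule_format, OF F_ob[OF A] F_ob[OF B] F_ar[OF A B f]]
      epi_mono_fact_iff[OF A B I(1) f I(2,3)] epi_mono_fact_iff[OF A B I'(1) f I'(2,3)] 1 2 by blast
  then obtain t' where t': "?Q t'" and un: "\<And>t. ?Q t \<Longrightarrow> t = t'" by (auto elim: ex1E)
  have "t' \<in> arr D (fob F I) (fob F I')" using t' by (simp add: is_isomorphism_def)
  then obtain t where t: "t \<in> arr C I I'" "t' = far F I I' t" using F_full I I' by metis
  have "?P t" using PQ t t' by simp
  moreover have "s = t" if "?P s" for s
  proof -
    have s: "s \<in> arr C I I'" using that by (simp add: is_isomorphism_def)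
    then have "far F I I' s = far F I I' t" using un PQ that t by metis
    then show ?thesis using s t I I' by (simp add: F_eq_iff)
  qed
  ultimately show "\<exists>!t. ?P t" by blast
qed

end

section \<open>Equivalences and functor categories\<close>

lemma is_monoD: "\<lbrakk>is_mono C A B f; T \<in> obj C; g \<in> arr C T A; h \<in> arr C T A;
    cmp C T A B g f = cmp C T A B h f\<rbrakk> \<Longrightarrow> g = h"
  by (simp add: is_mono_def)

lemma functor_ar:
  assumes "is_functor C D F" "A \<in> obj C" "B \<in> obj C" "f \<in> arr C A B"
  shows "far F A B f \<in> arr D (fob F A) (fob F B)"
proof -
  have "far F A B \<in> hom (homg C A B) (homg D (fob F A) (fob F B))"
    using assms by (simp add: is_functor_def)
  then show ?thesis using assms(4) unfolding hom_def by blast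
qed

text \<open>Naturality of the family of inverses is automatic (\<open>nat'\<close>), so pointwise
  isomorphisms and one family of squares suffice.\<close>

lemma isomorphic_functor_catI:
  assumes D: "preadditive_cat D" and F: "is_functor C D F" and G: "is_functor C D G"
    and iso: "\<And>A. A \<in> obj C \<Longrightarrow> is_isomorphism D (fob F A) (fob G A) (s A)"
    and nat: "\<And>A B f. \<lbrakk>A \<in> obj C; B \<in> obj C; f \<in> arr C A B\<rbrakk> \<Longrightarrow>
      cmp D (fob F A) (fob F B) (fob G B) (far F A B f) (s B) = cmp D (fob F A) (fob G A) (fob G B) (s A) (far G A B f)"
  shows "isomorphic (functor_cat C D) F G"
proof -
  interpret D: preadditive_cat D by fact
  have ob: "fob F A \<in> obj D" "fob G A \<in> obj D" if "A \<in> obj C" for A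
    using F G that by (auto simp: is_functor_def)
  have ar: "far F A B f \<in> arr D (fob F A) (fob F B)" "far G A B f \<in> arr D (fob G A) (fob G B)"
    if "A \<in> obj C" "B \<in> obj C" "f \<in> arr C A B" for A B f
    using functor_ar[OF F that] functor_ar[OF G that] by auto
  have "\<forall>A\<in>obj C. \<exists>r. r \<in> arr D (fob G A) (fob F A) \<and> cmp D (fob F A) (fob G A) (fob F A) (s A) r = idn D (fob F A)
      \<and> cmp D (fob G A) (fob F A) (fob G A) r (s A) = idn D (fob G A)"
    using iso unfolding is_isomorphism_def by blast
  then obtain r where r: "\<And>A. A \<in> obj C \<Longrightarrow> r A \<in> arr D (fob G A) (fob F A)"
      "\<And>A. A \<in> obj C \<Longrightarrow> cmp D (fob F A) (fob G A) (fob F A) (s A) (r A) = idn D (fob F A)"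
      "\<And>A. A \<in> obj C \<Longrightarrow> cmp D (fob G A) (fob F A) (fob G A) (r A) (s A) = idn D (fob G A)"
    by (metis (no_types, lifting) bchoice)
  have s: "s A \<in> arr D (fob F A) (fob G A)" if "A \<in> obj C" for A
    using iso[OF that] by (simp add: is_isomorphism_def)
  have nat': "cmp D (fob G A) (fob G B) (fob F B) (far G A B f) (r B) = cmp D (fob G A) (fob F A) (fob F B) (r A) (far F A B f)"
    if A: "A \<in> obj C" "B \<in> obj C" "f \<in> arr C A B" for A B f
  proof -
    note [simp] = ob[OF A(1)] ob[OF A(2)] ar[OF A] s[OF A(1)] s[OF A(2)] r(1)[OF A(1)] r(1)[OF A(2)]
    have "cmp D (fob G A) (fob G B) (fob F B) (far G A B f) (r B)
        = cmp D (fob G A) (fob F A) (fob F B) (r A) (cmp D (fob F A) (fob G A) (fob F B) (s A) (cmp D (fob G A) (fob G B) (fob F B) (far G A B f) (r B)))"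
      by (simp add: D.cmp_cancel_left r A)
    also have "cmp D (fob F A) (fob G A) (fob F B) (s A) (cmp D (fob G A) (fob G B) (fob F B) (far G A B f) (r B))
        = cmp D (fob F A) (fob G B) (fob F B) (cmp D (fob F A) (fob G A) (fob G B) (s A) (far G A B f)) (r B)"
      by (simp add: D.cmp_assoc)
    also have "\<dots> = far F A B f"
      unfolding nat[OF A, symmetric] by (simp add: D.cmp_assoc r A)
    finally show ?thesis .
  qed
  have "is_isomorphism (functor_cat C D) F G (\<lambda>A\<in>obj C. s A)"
    unfolding is_isomorphism_def
  proof (intro conjI bexI[of _ "\<lambda>A\<in>obj C. r A"])
    show "(\<lambda>A\<in>obj C. s A) \<in> arr (functor_cat C D) F G" "(\<lambda>A\<in>obj C. r A) \<in> arr (functor_cat C D) G F"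
      using s r(1) nat nat' by (auto simp: functor_cat_def nat_trans_def)
  qed (auto simp: functor_cat_def r cong: restrict_cong)
  then show ?thesis unfolding isomorphic_def by blast
qed

lemma isomorphic_functor_catE:
  assumes "isomorphic (functor_cat C D) F G"
  obtains s where "\<And>A. A \<in> obj C \<Longrightarrow> is_isomorphism D (fob F A) (fob G A) (s A)"
    "\<And>A B f. \<lbrakk>A \<in> obj C; B \<in> obj C; f \<in> arr C A B\<rbrakk> \<Longrightarrow>
      cmp D (fob F A) (fob F B) (fob G B) (far F A B f) (s B) = cmp D (fob F A) (fob G A) (fob G B) (s A) (far G A B f)"
proof -
  from assms obtain s r where s: "s \<in> nat_trans C D F G" and r: "r \<in> nat_trans C D G F"
    and 1: "(\<lambda>A\<in>obj C. cmp D (fob F A) (fob G A) (fob F A) (s A) (r A)) = (\<lambda>A\<in>obj C. idn D (fob F A))"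
    and 2: "(\<lambda>A\<in>obj C. cmp D (fob G A) (fob F A) (fob G A) (r A) (s A)) = (\<lambda>A\<in>obj C. idn D (fob G A))"
    unfolding isomorphic_def is_isomorphism_def functor_cat_def by auto
  show thesis
  proof
    fix A assume A: "A \<in> obj C"
    show "is_isomorphism D (fob F A) (fob G A) (s A)"
      unfolding is_isomorphism_def
      using s r fun_cong[OF 1, of A] fun_cong[OF 2, of A] A
      by (auto simp: nat_trans_def intro!: bexI[of _ "r A"])
  qed (use s in \<open>auto simp: nat_trans_def\<close>)
qed

section \<open>The two descriptions of an equivalence\<close>

lemma equivalent_cats_sym: "equivalent_cats C D \<Longrightarrow> equivalent_cats D C"
  unfolding equivalent_cats_def by blast

text \<open>Let s : GF -> 1 and r : FG -> 1 be the given natural isomorphisms. Naturality of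
  \<open>s\<close> recovers \<open>f\<close> from G(F f), so \<open>F\<close> is faithful, and
  \<open>G\<close> likewise by \<open>r\<close>. Fullness of \<open>F\<close> then rests on
  faithfulness of \<open>G\<close>.\<close>

lemma equivalent_cats_imp_cat_equivalence:
  assumes C: "preadditive_cat C" and D: "preadditive_cat D" and "equivalent_cats C D"
  shows "\<exists>F. cat_equivalence C D F"
proof -
  interpret C: preadditive_cat C by fact
  interpret D: preadditive_cat D by fact
  from assms(3) obtain F G where F: "is_functor C D F" and G: "is_functor D C G"
    and 1: "isomorphic (functor_cat C C) (comp_functor F G) id_functor"
    and 2: "isomorphic (functor_cat D D) (comp_functor G F) id_functor"
    unfolding equivalent_cats_def by blast
  obtain s where s: "\<And>A. A \<in> obj C \<Longrightarrow> is_isomorphism C (fob G (fob F A)) A (s A)"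
    and sn: "\<And>A B f. \<lbrakk>A \<in> obj C; B \<in> obj C; f \<in> arr C A B\<rbrakk> \<Longrightarrow>
      cmp C (fob G (fob F A)) (fob G (fob F B)) B (far G (fob F A) (fob F B) (far F A B f)) (s B) = cmp C (fob G (fob F A)) A B (s A) f"
    by (rule isomorphic_functor_catE[OF 1]) (rule that, simp_all add: comp_functor_def id_functor_def)
  obtain r where r: "\<And>A. A \<in> obj D \<Longrightarrow> is_isomorphism D (fob F (fob G A)) A (r A)"
    and rn: "\<And>A B f. \<lbrakk>A \<in> obj D; B \<in> obj D; f \<in> arr D A B\<rbrakk> \<Longrightarrow>
      cmp D (fob F (fob G A)) (fob F (fob G B)) B (far F (fob G A) (fob G B) (far G A B f)) (r B) = cmp D (fob F (fob G A)) A B (r A) f"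
    by (rule isomorphic_functor_catE[OF 2]) (rule that, simp_all add: comp_functor_def id_functor_def)
  have Fo: "fob F A \<in> obj D" if "A \<in> obj C" for A using F that by (simp add: is_functor_def)
  have Go: "fob G A \<in> obj C" if "A \<in> obj D" for A using G that by (simp add: is_functor_def)
  have Fa: "far F A B f \<in> arr D (fob F A) (fob F B)" if "A \<in> obj C" "B \<in> obj C" "f \<in> arr C A B" for A B f
    using functor_ar[OF F that] .
  have Ga: "far G A B f \<in> arr C (fob G A) (fob G B)" if "A \<in> obj D" "B \<in> obj D" "f \<in> arr D A B" for A B f
    using functor_ar[OF G that] .
  have sa: "s A \<in> arr C (fob G (fob F A)) A" if "A \<in> obj C" for A using s[OF that] by (simp add: is_isomorphism_def)
  have ra: "r A \<in> arr D (fob F (fob G A)) A" if "A \<in> obj D" for A using r[OF that] by (simp add: is_isomorphism_def)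
  have Finj: "f = g" if A: "A \<in> obj C" "B \<in> obj C" "f \<in> arr C A B" "g \<in> arr C A B" and eq: "far F A B f = far F A B g" for A B f g
    using sn[OF A(1,2,3)] sn[OF A(1,2,4)] C.isomorphism_is_epi[OF Go[OF Fo[OF A(1)]] A(1) s[OF A(1)]] A
    unfolding is_epi_def eq by simp
  have Ginj: "f = g" if A: "A \<in> obj D" "B \<in> obj D" "f \<in> arr D A B" "g \<in> arr D A B" and eq: "far G A B f = far G A B g" for A B f g
    using rn[OF A(1,2,3)] rn[OF A(1,2,4)] D.isomorphism_is_epi[OF Fo[OF Go[OF A(1)]] A(1) r[OF A(1)]] A
    unfolding is_epi_def eq by simp
  have Ffull: "\<exists>f\<in>arr C A B. g = far F A B f" if A: "A \<in> obj C" "B \<in> obj C" and g: "g \<in> arr D (fob F A) (fob F B)" for A B g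
  proof -
    obtain t where t: "t \<in> arr C A (fob G (fob F A))" "cmp C (fob G (fob F A)) A (fob G (fob F A)) (s A) t = idn C (fob G (fob F A))"
      using s[OF A(1)] unfolding is_isomorphism_def by blast
    let ?g = "far G (fob F A) (fob F B) g"
    \<comment> \<open>Conjugating G(g) by \<open>s\<close> is forced: naturality then gives G(F f) =
      G(g), and \<open>G\<close> is faithful.\<close>
    define f where "f = cmp C A (fob G (fob F A)) B t (cmp C (fob G (fob F A)) (fob G (fob F B)) B ?g (s B))"
    note [simp] = A Fo[OF A(1)] Fo[OF A(2)] Go[OF Fo[OF A(1)]] Go[OF Fo[OF A(2)]] t(1) sa[OF A(1)] sa[OF A(2)] Ga[OF Fo[OF A(1)] Fo[OF A(2)] g]
    have f: "f \<in> arr C A B" by (simp add: f_def)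
    have "cmp C (fob G (fob F A)) A B (s A) f = cmp C (fob G (fob F A)) (fob G (fob F B)) B ?g (s B)"
      unfolding f_def by (rule C.cmp_cancel_left) (use t in simp_all)
    then have "cmp C (fob G (fob F A)) (fob G (fob F B)) B (far G (fob F A) (fob F B) (far F A B f)) (s B)
        = cmp C (fob G (fob F A)) (fob G (fob F B)) B ?g (s B)"
      using sn[OF A f] by simp
    then have "far G (fob F A) (fob F B) (far F A B f) = ?g"
      using is_monoD[OF C.isomorphism_is_mono[OF Go[OF Fo[OF A(2)]] A(2) s[OF A(2)]]]
        Ga[OF Fo[OF A(1)] Fo[OF A(2)] Fa[OF A f]] Ga[OF Fo[OF A(1)] Fo[OF A(2)] g] Go[OF Fo[OF A(1)]] by blast
    then have "far F A B f = g" using Ginj[OF Fo[OF A(1)] Fo[OF A(2)] Fa[OF A f] g] by simp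
    then show ?thesis using f by blast
  qed
  have "fully_faithful C D F"
    unfolding fully_faithful_def bij_betw_def inj_on_def image_def
    using F Finj Ffull Fa by (intro conjI ballI impI) (blast+)
  moreover have "ess_surj C D F"
    unfolding ess_surj_def isomorphic_def using r Go by blast
  ultimately show ?thesis
    using C D unfolding cat_equivalence_def cat_equivalence_axioms_def by blast
qed

lemma (in cat_equivalence) equivalent_cats: "equivalent_cats C D"
proof -
  \<comment> \<open>Object and isomorphism are chosen as one pair, so that \<open>i\<close> belongs
    to the object picked by \<open>G0\<close>.\<close>
  have "\<forall>B\<in>obj D. \<exists>x. fst x \<in> obj C \<and> is_isomorphism D (fob F (fst x)) B (snd x)"
  proof
    fix B assume "B \<in> obj D"
    then obtain A t where "A \<in> obj C" "is_isomorphism D (fob F A) B t"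
      using es unfolding ess_surj_def isomorphic_def by blast
    then show "\<exists>x. fst x \<in> obj C \<and> is_isomorphism D (fob F (fst x)) B (snd x)"
      by (intro exI[of _ "(A, t)"]) simp
  qed
  then obtain X where X: "\<forall>B\<in>obj D. fst (X B) \<in> obj C \<and> is_isomorphism D (fob F (fst (X B))) B (snd (X B))"
    by (metis (no_types, lifting) bchoice)
  define G0 where "G0 B = fst (X B)" for B
  define i where "i B = snd (X B)" for B
  have G0 [simp]: "G0 B \<in> obj C" and i_iso: "is_isomorphism D (fob F (G0 B)) B (i B)" if "B \<in> obj D" for B
    using X that by (auto simp: G0_def i_def)
  have "\<forall>B\<in>obj D. \<exists>t. t \<in> arr D B (fob F (G0 B)) \<and>
    cmp D (fob F (G0 B)) B (fob F (G0 B)) (i B) t = idn D (fob F (G0 B)) \<and> cmp D B (fob F (G0 B)) B t (i B) = idn D B"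
    using i_iso unfolding is_isomorphism_def by blast
  then obtain j where j [simp]: "\<And>B. B \<in> obj D \<Longrightarrow> j B \<in> arr D B (fob F (G0 B))"
    "\<And>B. B \<in> obj D \<Longrightarrow> cmp D (fob F (G0 B)) B (fob F (G0 B)) (i B) (j B) = idn D (fob F (G0 B))"
    "\<And>B. B \<in> obj D \<Longrightarrow> cmp D B (fob F (G0 B)) B (j B) (i B) = idn D B"
    by (metis (no_types, lifting) bchoice)
  have i [simp]: "i B \<in> arr D (fob F (G0 B)) B" if "B \<in> obj D" for B
    using i_iso[OF that] by (simp add: is_isomorphism_def)
  \<comment> \<open>\<open>h A B f\<close> is \<open>f\<close> conjugated by the chosen
    isomorphisms; \<open>G1\<close> takes its preimage under \<open>F\<close>, and its laws hold
    because they hold for \<open>h\<close> and \<open>F\<close> is faithful.\<close>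
  define h where "h A B f = cmp D (fob F (G0 A)) A (fob F (G0 B)) (i A) (cmp D A B (fob F (G0 B)) f (j B))" for A B f
  have h [simp]: "h A B f \<in> arr D (fob F (G0 A)) (fob F (G0 B))" if "A \<in> obj D" "B \<in> obj D" "f \<in> arr D A B" for A B f
    using that by (simp add: h_def)
  define G1 where "G1 A B f = (SOME g. g \<in> arr C (G0 A) (G0 B) \<and> h A B f = far F (G0 A) (G0 B) g)" for A B f
  have G1': "G1 A B f \<in> arr C (G0 A) (G0 B) \<and> h A B f = far F (G0 A) (G0 B) (G1 A B f)" if "A \<in> obj D" "B \<in> obj D" "f \<in> arr D A B" for A B f
    unfolding G1_def by (rule someI_ex) (use F_full[of "G0 A" "G0 B" "h A B f"] that in auto)
  then have G1 [simp]: "G1 A B f \<in> arr C (G0 A) (G0 B)" "far F (G0 A) (G0 B) (G1 A B f) = h A B f"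
    if "A \<in> obj D" "B \<in> obj D" "f \<in> arr D A B" for A B f using that by auto
  define G where "G = \<lparr>fob = G0, far = G1\<rparr>"
  have h_i: "cmp D (fob F (G0 A)) (fob F (G0 B)) B (h A B f) (i B) = cmp D (fob F (G0 A)) A B (i A) f"
    if "A \<in> obj D" "B \<in> obj D" "f \<in> arr D A B" for A B f
    using that by (simp add: h_def D.cmp_assoc)
  have G_func: "is_functor D C G"
    unfolding is_functor_def G_def afunctor.simps
  proof (intro conjI ballI)
    fix A assume A: "A \<in> obj D"
    show "G0 A \<in> obj C" using A by simp
    show "G1 A A (idn D A) = idn C (G0 A)"
      by (rule F_inj[of "G0 A" "G0 A"]) (use A in \<open>simp_all add: h_def\<close>)
    fix B assume B: "B \<in> obj D"
    show "G1 A B \<in> hom (homg D A B) (homg C (G0 A) (G0 B))"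
    proof (rule homI)
      fix f g assume fg: "f \<in> arr D A B" "g \<in> arr D A B"
      show "G1 A B (f \<otimes>\<^bsub>homg D A B\<^esub> g) = G1 A B f \<otimes>\<^bsub>homg C (G0 A) (G0 B)\<^esub> G1 A B g"
        by (rule F_inj[of "G0 A" "G0 B"]) (use A B fg in \<open>simp_all add: h_def F_add D.cmp_add_left D.cmp_add_right\<close>)
    qed (use A B in simp)
    fix E f g assume E: "E \<in> obj D" and f: "f \<in> arr D A B" and g: "g \<in> arr D B E"
    show "G1 A E (cmp D A B E f g) = cmp C (G0 A) (G0 B) (G0 E) (G1 A B f) (G1 B E g)"
    proof (rule F_inj[of "G0 A" "G0 E"])
      have "cmp D (fob F (G0 A)) (fob F (G0 B)) (fob F (G0 E)) (h A B f) (h B E g)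
        = cmp D (fob F (G0 A)) B (fob F (G0 E)) (cmp D (fob F (G0 A)) (fob F (G0 B)) B (h A B f) (i B)) (cmp D B E (fob F (G0 E)) g (j E))"
        using A B E f g by (simp add: h_def[of B E] D.cmp_assoc)
      also have "\<dots> = h A E (cmp D A B E f g)"
        unfolding h_i[OF A B f] using A B E f g by (simp add: h_def D.cmp_assoc)
      finally show "far F (G0 A) (G0 E) (G1 A E (cmp D A B E f g)) = far F (G0 A) (G0 E) (cmp C (G0 A) (G0 B) (G0 E) (G1 A B f) (G1 B E g))"
        using A B E f g by (simp add: F_cmp)
    qed (use A B E f g in simp_all)
  qed
  \<comment> \<open>The isomorphism from GF to the identity is the preimage under \<open>F\<close>
    of \<open>i\<close> at \<open>fob F A\<close>, so its naturality follows from that of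
    \<open>i\<close>.\<close>
  have "\<forall>A\<in>obj C. \<exists>s. s \<in> arr C (G0 (fob F A)) A \<and> i (fob F A) = far F (G0 (fob F A)) A s"
    by (metis F_full F_ob G0 i)
  then obtain s where s: "\<And>A. A \<in> obj C \<Longrightarrow> s A \<in> arr C (G0 (fob F A)) A"
    "\<And>A. A \<in> obj C \<Longrightarrow> far F (G0 (fob F A)) A (s A) = i (fob F A)"
    by (metis (no_types, lifting) bchoice)
  have id: "is_functor C C id_functor" "is_functor D D id_functor"
    by (simp_all add: is_functor_def id_functor_def hom_def)
  have comp1: "is_functor C C (comp_functor F G)"
    using is_func G_func unfolding is_functor_def comp_functor_def hom_def by (auto simp: Pi_iff)
  have comp2: "is_functor D D (comp_functor G F)"
    using is_func G_func unfolding is_functor_def comp_functor_def hom_def by (auto simp: Pi_iff)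
  have "isomorphic (functor_cat C C) (comp_functor F G) id_functor"
  proof (rule isomorphic_functor_catI[OF C.preadditive_cat_axioms comp1 id(1), of s])
    fix A assume A: "A \<in> obj C"
    then show "is_isomorphism C (fob (comp_functor F G) A) (fob id_functor A) (s A)"
      using s[OF A] i_iso[of "fob F A"] isomorphism_iff[of "G0 (fob F A)" A "s A"]
      by (simp add: comp_functor_def id_functor_def G_def)
    fix B f assume B: "B \<in> obj C" "f \<in> arr C A B"
    have "cmp C (G0 (fob F A)) (G0 (fob F B)) B (G1 (fob F A) (fob F B) (far F A B f)) (s B) = cmp C (G0 (fob F A)) A B (s A) f"
      by (rule F_inj[of "G0 (fob F A)" B]) (use A B s in \<open>simp_all add: F_cmp h_i\<close>)
    then show "cmp C (fob (comp_functor F G) A) (fob (comp_functor F G) B) (fob id_functor B) (far (comp_functor F G) A B f) (s B)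
      = cmp C (fob (comp_functor F G) A) (fob id_functor A) (fob id_functor B) (s A) (far id_functor A B f)"
      by (simp add: comp_functor_def id_functor_def G_def)
  qed
  moreover have "isomorphic (functor_cat D D) (comp_functor G F) id_functor"
    by (rule isomorphic_functor_catI[OF D.preadditive_cat_axioms comp2 id(2), of i])
      (use i_iso h_i in \<open>simp_all add: comp_functor_def id_functor_def G_def\<close>)
  ultimately show ?thesis
    unfolding equivalent_cats_def using is_func G_func by blast
qed

section \<open>Functor categories and the category of abelian groups\<close>

lemma preadditive_functor_cat:
  assumes "preadditive_cat D" shows "preadditive_cat (functor_cat C D)"
proof -
  interpret D: preadditive_cat D by fact
  let ?M = "functor_cat C D"
  have ob: "fob F A \<in> obj D" if "F \<in> obj ?M" "A \<in> obj C" for F A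
    using that by (auto simp: functor_cat_def is_functor_def)
  have ar: "far F A B f \<in> arr D (fob F A) (fob F B)"
    if "F \<in> obj ?M" "A \<in> obj C" "B \<in> obj C" "f \<in> arr C A B" for F A B f
    using that functor_ar by (fastforce simp: functor_cat_def)
  have cp: "s A \<in> arr D (fob F A) (fob G A)" if "s \<in> arr ?M F G" "A \<in> obj C" for s F G A
    using that by (auto simp: functor_cat_def nat_trans_def)
  have nt: "cmp D (fob F A) (fob F B) (fob G B) (far F A B f) (s B) = cmp D (fob F A) (fob G A) (fob G B) (s A) (far G A B f)"
    if "s \<in> arr ?M F G" "A \<in> obj C" "B \<in> obj C" "f \<in> arr C A B" for s F G A B f
    using that by (simp add: functor_cat_def nat_trans_def)
  have ntI: "s \<in> arr ?M F G" if "s \<in> extensional (obj C)" "\<And>A. A \<in> obj C \<Longrightarrow> s A \<in> arr D (fob F A) (fob G A)"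
    "\<And>A B f. \<lbrakk>A \<in> obj C; B \<in> obj C; f \<in> arr C A B\<rbrakk> \<Longrightarrow>
      cmp D (fob F A) (fob F B) (fob G B) (far F A B f) (s B) = cmp D (fob F A) (fob G A) (fob G B) (s A) (far G A B f)" for s F G
    using that by (simp add: functor_cat_def nat_trans_def PiE_def)
  have ext: "s \<in> extensional (obj C)" if "s \<in> arr ?M F G" for s F G
    using that by (simp add: functor_cat_def nat_trans_def PiE_def)
  \<comment> \<open>Families are extensional on \<open>obj C\<close>, so pointwise equality suffices
    and each axiom reduces to the same axiom in \<open>D\<close>.\<close>
  have eqI: "s = t" if "s \<in> arr ?M F G" "t \<in> arr ?M F G" "\<And>A. A \<in> obj C \<Longrightarrow> s A = t A" for s t F G
    using extensionalityI[OF ext ext] that by metis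
  have mult: "s \<otimes>\<^bsub>homg ?M F G\<^esub> t = (\<lambda>A\<in>obj C. s A \<otimes>\<^bsub>homg D (fob F A) (fob G A)\<^esub> t A)" for s t F G
    by (simp add: functor_cat_def)
  have one: "zero_arr ?M F G = (\<lambda>A\<in>obj C. zero_arr D (fob F A) (fob G A))" for F G
    by (simp add: functor_cat_def)
  have cmpc: "cmp ?M F G H s t = (\<lambda>A\<in>obj C. cmp D (fob F A) (fob G A) (fob H A) (s A) (t A))" for F G H s t
    by (simp add: functor_cat_def)
  have idnc: "idn ?M F = (\<lambda>A\<in>obj C. idn D (fob F A))" for F by (simp add: functor_cat_def)
  note cl = ob ar cp
  have add: "s \<otimes>\<^bsub>homg ?M F G\<^esub> t \<in> arr ?M F G" if "F \<in> obj ?M" "G \<in> obj ?M" "s \<in> arr ?M F G" "t \<in> arr ?M F G" for s t F G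
    by (rule ntI) (use that in \<open>simp_all add: mult cl D.cmp_add_left D.cmp_add_right nt\<close>)
  have zero: "zero_arr ?M F G \<in> arr ?M F G" if "F \<in> obj ?M" "G \<in> obj ?M" for F G
    by (rule ntI) (use that in \<open>simp_all add: one cl\<close>)
  have neg: "(\<lambda>A\<in>obj C. inv\<^bsub>homg D (fob F A) (fob G A)\<^esub> s A) \<in> arr ?M F G" if "F \<in> obj ?M" "G \<in> obj ?M" "s \<in> arr ?M F G" for F G s
    by (rule ntI) (use that in \<open>simp_all add: one cl D.cmp_neg_left D.cmp_neg_right nt\<close>)
  have cmp: "cmp ?M F G H s t \<in> arr ?M F H"
    if "F \<in> obj ?M" "G \<in> obj ?M" "H \<in> obj ?M" "s \<in> arr ?M F G" "t \<in> arr ?M G H" for s t F G H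
  proof (rule ntI)
    fix A B f assume A: "A \<in> obj C" "B \<in> obj C" "f \<in> arr C A B"
    note [simp] = ob[OF that(1)] ob[OF that(2)] ob[OF that(3)] ar[OF that(1)] ar[OF that(2)] ar[OF that(3)] cp[OF that(4)] cp[OF that(5)]
    have "cmp D (fob F A) (fob F B) (fob H B) (far F A B f) (cmp D (fob F B) (fob G B) (fob H B) (s B) (t B))
       = cmp D (fob F A) (fob G B) (fob H B) (cmp D (fob F A) (fob F B) (fob G B) (far F A B f) (s B)) (t B)"
      using A by (simp add: D.cmp_assoc)
    also have "\<dots> = cmp D (fob F A) (fob G A) (fob H B) (s A) (cmp D (fob G A) (fob G B) (fob H B) (far G A B f) (t B))"
      unfolding nt[OF that(4) A] using A by (simp add: D.cmp_assoc)
    also have "\<dots> = cmp D (fob F A) (fob H A) (fob H B) (cmp D (fob F A) (fob G A) (fob H A) (s A) (t A)) (far H A B f)"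
      unfolding nt[OF that(5) A] using A by (simp add: D.cmp_assoc)
    finally show "cmp D (fob F A) (fob F B) (fob H B) (far F A B f) (cmp ?M F G H s t B)
      = cmp D (fob F A) (fob H A) (fob H B) (cmp ?M F G H s t A) (far H A B f)"
      using A by (simp add: cmpc)
  qed (use that in \<open>simp_all add: cmpc cl\<close>)
  have idn: "idn ?M F \<in> arr ?M F F" if "F \<in> obj ?M" for F
    by (rule ntI) (use that in \<open>simp_all add: idnc cl\<close>)
  show ?thesis
  proof (rule preadditive_cat.intro)
    fix F G assume FG: "F \<in> obj ?M" "G \<in> obj ?M"
    have G: "comm_group (homg D (fob F A) (fob G A))" if "A \<in> obj C" for A
      using D.hom_comm_group ob FG that by blast
    note G' = G[THEN comm_group.axioms(2)]
    show "comm_group (homg ?M F G)"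
    proof (rule comm_groupI)
      fix s t assume s: "s \<in> arr ?M F G" and t: "t \<in> arr ?M F G"
      show "s \<otimes>\<^bsub>homg ?M F G\<^esub> t \<otimes>\<^bsub>homg ?M F G\<^esub> r = s \<otimes>\<^bsub>homg ?M F G\<^esub> (t \<otimes>\<^bsub>homg ?M F G\<^esub> r)"
        if r: "r \<in> arr ?M F G" for r
        unfolding mult using G' s t r cp by (intro restrict_ext) (simp add: group.is_monoid monoid.m_assoc)
      show "s \<otimes>\<^bsub>homg ?M F G\<^esub> t = t \<otimes>\<^bsub>homg ?M F G\<^esub> s"
        unfolding mult using G s t cp by (intro restrict_ext) (simp add: comm_group_def comm_monoid.m_comm)
    next
      fix s assume s: "s \<in> arr ?M F G"
      show "zero_arr ?M F G \<otimes>\<^bsub>homg ?M F G\<^esub> s = s"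
        by (rule eqI[OF add[OF FG zero[OF FG] s] s]) (use G' s cp in \<open>simp add: mult one group.is_monoid monoid.l_one\<close>)
      have "(\<lambda>A\<in>obj C. inv\<^bsub>homg D (fob F A) (fob G A)\<^esub> s A) \<otimes>\<^bsub>homg ?M F G\<^esub> s = zero_arr ?M F G"
        by (rule eqI[OF add[OF FG neg[OF FG s] s] zero[OF FG]]) (use G' s cp in \<open>simp add: mult one group.l_inv\<close>)
      then show "\<exists>t\<in>arr ?M F G. t \<otimes>\<^bsub>homg ?M F G\<^esub> s = zero_arr ?M F G"
        using neg[OF FG s] by blast
    qed (rule add[OF FG] zero[OF FG]; assumption)+
    fix f assume f: "f \<in> arr ?M F G"
    show "cmp ?M F F G (idn ?M F) f = f"
      by (rule eqI[OF cmp[OF FG(1) FG idn[OF FG(1)] f] f]) (use FG f in \<open>simp add: cmpc idnc cl\<close>)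
    show "cmp ?M F G G f (idn ?M G) = f"
      by (rule eqI[OF cmp[OF FG FG(2) f idn[OF FG(2)]] f]) (use FG f in \<open>simp add: cmpc idnc cl\<close>)
    fix H g assume H: "H \<in> obj ?M" and g: "g \<in> arr ?M G H"
    show "cmp ?M F G H f g \<in> arr ?M F H" using cmp FG H f g by blast
    show "cmp ?M F G H (f \<otimes>\<^bsub>homg ?M F G\<^esub> f') g = cmp ?M F G H f g \<otimes>\<^bsub>homg ?M F H\<^esub> cmp ?M F G H f' g"
      if "f' \<in> arr ?M F G" for f'
      unfolding mult cmpc using FG H f that g by (intro restrict_ext) (simp add: D.cmp_add_left cl)
    show "cmp ?M F G H f (g \<otimes>\<^bsub>homg ?M G H\<^esub> g') = cmp ?M F G H f g \<otimes>\<^bsub>homg ?M F H\<^esub> cmp ?M F G H f g'"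
      if "g' \<in> arr ?M G H" for g'
      unfolding mult cmpc using FG H f that g by (intro restrict_ext) (simp add: D.cmp_add_right cl)
    fix K h assume K: "K \<in> obj ?M" and h: "h \<in> arr ?M H K"
    show "cmp ?M F H K (cmp ?M F G H f g) h = cmp ?M F G K f (cmp ?M G H K g h)"
      unfolding cmpc using FG H K f g h by (intro restrict_ext) (simp add: D.cmp_assoc cl)
  qed (use idn in blast)
qed

text \<open>Commutativity of the target makes pointwise sums and inverses of homomorphisms again
  homomorphisms.\<close>

lemma preadditive_Ab_cat: "preadditive_cat (Ab_cat :: ('g monoid, 'g \<Rightarrow> 'g) acat)"
proof -
  let ?M = "Ab_cat :: ('g monoid, 'g \<Rightarrow> 'g) acat"
  have ob: "group G" "comm_group G" if "G \<in> obj ?M" for G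
    using that by (auto simp: Ab_cat_def comm_group.axioms(2))
  have ar: "f \<in> arr ?M G H \<longleftrightarrow> f \<in> hom G H \<and> f \<in> extensional (carrier G)" for f G H
    by (simp add: Ab_cat_def)
  have cl1: "f x \<in> carrier H" if "f \<in> arr ?M G H" "x \<in> carrier G" for f G H x
    using that by (auto simp: ar hom_def)
  have cl2: "f (x \<otimes>\<^bsub>G\<^esub> y) = f x \<otimes>\<^bsub>H\<^esub> f y"
    if "f \<in> arr ?M G H" "x \<in> carrier G" "y \<in> carrier G" for f G H x y
    using that by (auto simp: ar hom_def)
  note cl = cl1 cl2
  have eqI: "f = g" if "f \<in> arr ?M G H" "g \<in> arr ?M G H" "\<And>x. x \<in> carrier G \<Longrightarrow> f x = g x" for f g G H
    using extensionalityI that ar by metis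
  have mult: "s \<otimes>\<^bsub>homg ?M F G\<^esub> t = (\<lambda>x\<in>carrier F. s x \<otimes>\<^bsub>G\<^esub> t x)" for s t F G
    by (simp add: Ab_cat_def)
  have one: "zero_arr ?M F G = (\<lambda>x\<in>carrier F. \<one>\<^bsub>G\<^esub>)" for F G
    by (simp add: Ab_cat_def)
  have cmpc: "cmp ?M F G H s t = (\<lambda>x\<in>carrier F. t (s x))" for F G H s t
    by (simp add: Ab_cat_def compose_def)
  have idnc: "idn ?M F = (\<lambda>x\<in>carrier F. x)" for F by (simp add: Ab_cat_def)
  have mc: "x \<otimes>\<^bsub>G\<^esub> y \<in> carrier G" if "G \<in> obj ?M" "x \<in> carrier G" "y \<in> carrier G" for G x y
    using ob(1)[OF that(1)] that by (simp add: group.is_monoid monoid.m_closed)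
  have add: "s \<otimes>\<^bsub>homg ?M F G\<^esub> t \<in> arr ?M F G" if "F \<in> obj ?M" "G \<in> obj ?M" "s \<in> arr ?M F G" "t \<in> arr ?M F G" for s t F G
  proof -
    interpret G: comm_group G using ob that by blast
    show ?thesis
      unfolding ar
    proof (intro conjI homI)
      fix x y assume x: "x \<in> carrier F" "y \<in> carrier F"
      then show "(s \<otimes>\<^bsub>homg ?M F G\<^esub> t) (x \<otimes>\<^bsub>F\<^esub> y) = (s \<otimes>\<^bsub>homg ?M F G\<^esub> t) x \<otimes>\<^bsub>G\<^esub> (s \<otimes>\<^bsub>homg ?M F G\<^esub> t) y"
        using that by (simp add: mult mc cl[OF that(3)] cl[OF that(4)] G.m_ac)
    qed (use that in \<open>simp_all add: mult cl\<close>)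
  qed
  have zero: "zero_arr ?M F G \<in> arr ?M F G" if "F \<in> obj ?M" "G \<in> obj ?M" for F G
  proof -
    interpret G: comm_group G using ob that by blast
    show ?thesis unfolding ar by (auto intro!: homI simp: one mc[OF that(1)])
  qed
  have neg: "(\<lambda>x\<in>carrier F. inv\<^bsub>G\<^esub> s x) \<in> arr ?M F G" if "F \<in> obj ?M" "G \<in> obj ?M" "s \<in> arr ?M F G" for F G s
  proof -
    interpret G: comm_group G using ob that by blast
    show ?thesis unfolding ar by (auto intro!: homI simp: mc[OF that(1)] cl[OF that(3)] G.inv_mult)
  qed
  have cmp: "cmp ?M F G H s t \<in> arr ?M F H"
    if "F \<in> obj ?M" "G \<in> obj ?M" "H \<in> obj ?M" "s \<in> arr ?M F G" "t \<in> arr ?M G H" for s t F G H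
    unfolding ar by (auto intro!: homI simp: cmpc mc[OF that(1)] cl[OF that(4)] cl[OF that(5)])
  have idn: "idn ?M F \<in> arr ?M F F" if "F \<in> obj ?M" for F
    unfolding ar by (auto intro!: homI simp: idnc mc[OF that(1)])
  show ?thesis
  proof (rule preadditive_cat.intro)
    fix F G assume FG: "F \<in> obj ?M" "G \<in> obj ?M"
    interpret G: comm_group G using ob FG by blast
    show "comm_group (homg ?M F G)"
    proof (rule comm_groupI)
      fix s t assume s: "s \<in> arr ?M F G" and t: "t \<in> arr ?M F G"
      show "s \<otimes>\<^bsub>homg ?M F G\<^esub> t \<otimes>\<^bsub>homg ?M F G\<^esub> r = s \<otimes>\<^bsub>homg ?M F G\<^esub> (t \<otimes>\<^bsub>homg ?M F G\<^esub> r)"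
        if r: "r \<in> arr ?M F G" for r
        unfolding mult using s t r cl by (intro restrict_ext) (simp add: G.m_assoc)
      show "s \<otimes>\<^bsub>homg ?M F G\<^esub> t = t \<otimes>\<^bsub>homg ?M F G\<^esub> s"
        unfolding mult using s t cl by (intro restrict_ext) (simp add: G.m_comm)
    next
      fix s assume s: "s \<in> arr ?M F G"
      show "zero_arr ?M F G \<otimes>\<^bsub>homg ?M F G\<^esub> s = s"
        by (rule eqI[OF add[OF FG zero[OF FG] s] s]) (use s cl in \<open>simp add: mult one\<close>)
      have "(\<lambda>x\<in>carrier F. inv\<^bsub>G\<^esub> s x) \<otimes>\<^bsub>homg ?M F G\<^esub> s = zero_arr ?M F G"
        by (rule eqI[OF add[OF FG neg[OF FG s] s] zero[OF FG]]) (use s cl in \<open>simp add: mult one\<close>)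
      then show "\<exists>t\<in>arr ?M F G. t \<otimes>\<^bsub>homg ?M F G\<^esub> s = zero_arr ?M F G"
        using neg[OF FG s] by blast
    qed (rule add[OF FG] zero[OF FG]; assumption)+
    fix f assume f: "f \<in> arr ?M F G"
    show "cmp ?M F F G (idn ?M F) f = f"
      by (rule eqI[OF cmp[OF FG(1) FG idn[OF FG(1)] f] f]) (simp add: cmpc idnc)
    show "cmp ?M F G G f (idn ?M G) = f"
      by (rule eqI[OF cmp[OF FG FG(2) f idn[OF FG(2)]] f]) (use f cl in \<open>simp add: cmpc idnc\<close>)
    fix H g assume H: "H \<in> obj ?M" and g: "g \<in> arr ?M G H"
    show "cmp ?M F G H f g \<in> arr ?M F H" using cmp FG H f g by blast
    show "cmp ?M F G H (f \<otimes>\<^bsub>homg ?M F G\<^esub> f') g = cmp ?M F G H f g \<otimes>\<^bsub>homg ?M F H\<^esub> cmp ?M F G H f' g"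
      if "f' \<in> arr ?M F G" for f'
      unfolding mult cmpc using f that g by (intro restrict_ext) (simp add: cl)
    show "cmp ?M F G H f (g \<otimes>\<^bsub>homg ?M G H\<^esub> g') = cmp ?M F G H f g \<otimes>\<^bsub>homg ?M F H\<^esub> cmp ?M F G H f g'"
      if "g' \<in> arr ?M G H" for g'
      unfolding mult cmpc using f that g by (intro restrict_ext) (simp add: cl)
    fix K h assume K: "K \<in> obj ?M" and h: "h \<in> arr ?M H K"
    show "cmp ?M F H K (cmp ?M F G H f g) h = cmp ?M F G K f (cmp ?M G H K g h)"
      unfolding cmpc using f by (intro restrict_ext) (simp add: cl)
  qed (use idn in blast)
qed

lemma preadditive_Mod_cat: "preadditive_cat (Mod_cat P)"
  unfolding Mod_cat_def by (rule preadditive_functor_cat[OF preadditive_Ab_cat])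

section \<open>Syzygies and the quotient category\<close>

lemma is_epiD: "\<lbrakk>is_epi C A B f; T \<in> obj C; g \<in> arr C B T; h \<in> arr C B T;
    cmp C A B T f g = cmp C A B T f h\<rbrakk> \<Longrightarrow> g = h"
  by (simp add: is_epi_def)

context preadditive_cat
begin

lemma cokernelI:
  assumes "K \<in> obj C" "is_epi C B K k" "cmp C A B K f k = zero_arr C A K"
    and "\<And>T v. \<lbrakk>T \<in> obj C; v \<in> arr C B T; cmp C A B T f v = zero_arr C A T\<rbrakk> \<Longrightarrow> \<exists>u\<in>arr C K T. v = cmp C B K T k u"
  shows "is_cokernel C A B f K k"
  using preadditive_cat.kernelI[OF preadditive_op[OF preadditive_cat_axioms], of K B k A f] assms by simp

end

lemma comm_group_sub:
  assumes "comm_group G" "subgroup H G" shows "comm_group (G\<lparr>carrier := H\<rparr>)"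
proof -
  interpret G: comm_group G by fact
  show ?thesis
    by (rule group.group_comm_groupI[OF G.subgroup_imp_group[OF assms(2)]])
      (use subgroup.mem_carrier[OF assms(2)] in \<open>simp add: G.m_comm\<close>)
qed

lemma (in group) rcos_eq_iff:
  assumes "subgroup H G" "a \<in> carrier G" "b \<in> carrier G"
  shows "H #> a = H #> b \<longleftrightarrow> a \<otimes> inv b \<in> H"
proof
  assume "H #> a = H #> b"
  then have "a \<in> H #> b" using rcos_self assms by metis
  then obtain h where "h \<in> H" "a = h \<otimes> b" unfolding r_coset_def by blast
  then show "a \<otimes> inv b \<in> H" using assms subgroup.mem_carrier by (fastforce simp: m_assoc)
next
  assume "a \<otimes> inv b \<in> H"
  moreover have "a = (a \<otimes> inv b) \<otimes> b" using assms by (simp add: m_assoc)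
  ultimately have "a \<in> H #> b" unfolding r_coset_def by blast
  then show "H #> a = H #> b" using repr_independence assms by metis
qed

text \<open>
  \<open>cls C X T a\<close> is the coset of \<open>a\<close> modulo the syzygies of \<open>X\<close> with source \<open>T\<close>. Since the ideal is
  given by the syzygies of the target, the class of \<open>a : X \<rightarrow> Y\<close> in the quotient category is
  \<open>cls C Y (csA X) a\<close>.
\<close>

definition cls :: "('o, 'm) acat \<Rightarrow> ('o, 'm) cospan \<Rightarrow> 'o \<Rightarrow> 'm \<Rightarrow> 'm set" where
  "cls C X T a = syz C X T #>\<^bsub>homg C T (csA X)\<^esub> a"

context preadditive_cat
begin

section \<open>Syzygies as a subfunctor, and their cosets\<close>

lemma cospanD:
  assumes "is_cospan C X"
  shows "csA X \<in> obj C" "csO X \<in> obj C" "csR X \<in> obj C"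
    "gam X \<in> arr C (csA X) (csO X)" "rho X \<in> arr C (csR X) (csO X)"
  using assms by (auto simp: is_cospan_def)

lemma syz_arr: "s \<in> syz C X T \<Longrightarrow> s \<in> arr C T (csA X)"
  by (simp add: syz_def)

lemma syz_subgroup:
  assumes X: "is_cospan C X" and T: "T \<in> obj C"
  shows "subgroup (syz C X T) (homg C T (csA X))"
proof -
  note [simp] = cospanD[OF X] T
  interpret G: comm_group "homg C T (csA X)" by (simp add: hom_comm_group)
  show ?thesis
  proof (rule G.subgroupI)
    have "zero_arr C T (csA X) \<in> syz C X T"
      unfolding syz_def by (auto intro!: bexI[of _ "zero_arr C T (csR X)"])
    then show "syz C X T \<noteq> {}" by blast
    fix s assume s: "s \<in> syz C X T"
    then obtain w where w: "w \<in> arr C T (csR X)" "s \<in> arr C T (csA X)"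
      "cmp C T (csA X) (csO X) s (gam X) = cmp C T (csR X) (csO X) w (rho X)"
      by (auto simp: syz_def)
    show "inv\<^bsub>homg C T (csA X)\<^esub> s \<in> syz C X T"
      unfolding syz_def using w by (auto intro!: bexI[of _ "inv\<^bsub>homg C T (csR X)\<^esub> w"] simp: cmp_neg_left)
    fix s' assume s': "s' \<in> syz C X T"
    then obtain w' where w': "w' \<in> arr C T (csR X)" "s' \<in> arr C T (csA X)"
      "cmp C T (csA X) (csO X) s' (gam X) = cmp C T (csR X) (csO X) w' (rho X)"
      by (auto simp: syz_def)
    show "s \<otimes>\<^bsub>homg C T (csA X)\<^esub> s' \<in> syz C X T"
      unfolding syz_def using w w'
      by (auto intro!: bexI[of _ "w \<otimes>\<^bsub>homg C T (csR X)\<^esub> w'"] simp: cmp_add_left)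
  qed (simp add: subsetI syz_arr)
qed

lemma syz_zero: "\<lbrakk>is_cospan C X; T \<in> obj C\<rbrakk> \<Longrightarrow> zero_arr C T (csA X) \<in> syz C X T"
  using subgroup.one_closed[OF syz_subgroup] by metis

lemma syz_add: "\<lbrakk>is_cospan C X; T \<in> obj C; s \<in> syz C X T; t \<in> syz C X T\<rbrakk> \<Longrightarrow> s \<otimes>\<^bsub>homg C T (csA X)\<^esub> t \<in> syz C X T"
  using subgroup.m_closed[OF syz_subgroup] by metis

lemma syz_neg: "\<lbrakk>is_cospan C X; T \<in> obj C; s \<in> syz C X T\<rbrakk> \<Longrightarrow> inv\<^bsub>homg C T (csA X)\<^esub> s \<in> syz C X T"
  using subgroup.m_inv_closed[OF syz_subgroup] by metis

text \<open>The witness is precomposed as well. With \<open>syz_subgroup\<close> this makes the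
  syzygies a subfunctor of (-,A).\<close>

lemma syz_cmp:
  assumes X: "is_cospan C X" and T: "T \<in> obj C" "T' \<in> obj C" and s: "s \<in> syz C X T" and f: "f \<in> arr C T' T"
  shows "cmp C T' T (csA X) f s \<in> syz C X T'"
proof -
  note [simp] = cospanD[OF X] T
  obtain w where w: "w \<in> arr C T (csR X)" "s \<in> arr C T (csA X)"
    "cmp C T (csA X) (csO X) s (gam X) = cmp C T (csR X) (csO X) w (rho X)"
    using s by (auto simp: syz_def)
  show ?thesis
    unfolding syz_def using w f by (auto intro!: bexI[of _ "cmp C T' T (csR X) f w"] simp: cmp_assoc)
qed

lemma cls_eq_iff:
  assumes "is_cospan C X" "T \<in> obj C" "a \<in> arr C T (csA X)" "b \<in> arr C T (csA X)"
  shows "cls C X T a = cls C X T b \<longleftrightarrow> a \<otimes>\<^bsub>homg C T (csA X)\<^esub> inv\<^bsub>homg C T (csA X)\<^esub> b \<in> syz C X T"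
  unfolding cls_def
  by (rule group.rcos_eq_iff) (use assms hom_group cospanD syz_subgroup in auto)

lemma cls_zero_iff:
  assumes "is_cospan C X" "T \<in> obj C" "a \<in> arr C T (csA X)"
  shows "cls C X T a = cls C X T (zero_arr C T (csA X)) \<longleftrightarrow> a \<in> syz C X T"
proof -
  interpret G: comm_group "homg C T (csA X)" using assms by (simp add: hom_comm_group cospanD)
  show ?thesis using assms by (simp add: cls_eq_iff)
qed

lemma syz_cong:
  assumes "is_cospan C X" "T \<in> obj C" "a \<in> arr C T (csA X)" "b \<in> arr C T (csA X)" "cls C X T a = cls C X T b"
  shows "a \<in> syz C X T \<longleftrightarrow> b \<in> syz C X T"
  using assms cls_zero_iff by metis

text \<open>Precomposition respects cosets since the syzygies form a subfunctor.\<close>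

lemma cls_cmp_left:
  assumes X: "is_cospan C X" and T: "T \<in> obj C" "T' \<in> obj C" and a: "a \<in> arr C T (csA X)" "b \<in> arr C T (csA X)"
    and f: "f \<in> arr C T' T" and eq: "cls C X T a = cls C X T b"
  shows "cls C X T' (cmp C T' T (csA X) f a) = cls C X T' (cmp C T' T (csA X) f b)"
proof -
  note [simp] = cospanD[OF X] T a f
  have "a \<otimes>\<^bsub>homg C T (csA X)\<^esub> inv\<^bsub>homg C T (csA X)\<^esub> b \<in> syz C X T" using eq X by (simp add: cls_eq_iff)
  then have "cmp C T' T (csA X) f (a \<otimes>\<^bsub>homg C T (csA X)\<^esub> inv\<^bsub>homg C T (csA X)\<^esub> b) \<in> syz C X T'"
    by (intro syz_cmp) (use X in simp_all)
  then show ?thesis using X by (simp add: cls_eq_iff cmp_add_right cmp_neg_right)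
qed

section \<open>The category Aux(P) and its ideal\<close>

lemma Aux_simps [simp]:
  "obj (Aux C) = {X. is_cospan C X}"
  "cmp (Aux C) X Y Z = cmp C (csA X) (csA Y) (csA Z)"
  "idn (Aux C) X = idn C (csA X)"
  "mult (homg (Aux C) X Y) = mult (homg C (csA X) (csA Y))"
  "zero_arr (Aux C) X Y = zero_arr C (csA X) (csA Y)"
  by (simp_all add: Aux_def)

lemma Aux_arr: "a \<in> arr (Aux C) X Y \<longleftrightarrow> a \<in> arr C (csA X) (csA Y) \<and>
    (\<forall>T\<in>obj C. \<forall>s\<in>syz C X T. cmp C T (csA X) (csA Y) s a \<in> syz C Y T)"
  by (simp add: Aux_def)

lemma Aux_arrD: "a \<in> arr (Aux C) X Y \<Longrightarrow> a \<in> arr C (csA X) (csA Y)"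
  by (simp add: Aux_arr)

lemma Aux_arr_syz: "\<lbrakk>a \<in> arr (Aux C) X Y; T \<in> obj C; s \<in> syz C X T\<rbrakk> \<Longrightarrow> cmp C T (csA X) (csA Y) s a \<in> syz C Y T"
  by (simp add: Aux_arr)

lemma Aux_idn: "is_cospan C X \<Longrightarrow> idn C (csA X) \<in> arr (Aux C) X X"
  by (auto simp: Aux_arr cospanD syz_arr)

lemma Aux_cmp:
  assumes "is_cospan C X" "is_cospan C Y" "is_cospan C Z" "a \<in> arr (Aux C) X Y" "b \<in> arr (Aux C) Y Z"
  shows "cmp C (csA X) (csA Y) (csA Z) a b \<in> arr (Aux C) X Z"
  using assms by (auto simp: Aux_arr cospanD syz_arr simp flip: cmp_assoc)

text \<open>Postcomposition respects cosets because a morphism of \<open>Aux\<close> carries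
  syzygies to syzygies.\<close>

lemma cls_cmp_right:
  assumes X: "is_cospan C X" and Y: "is_cospan C Y" and T: "T \<in> obj C"
    and a: "a \<in> arr C T (csA X)" "b \<in> arr C T (csA X)"
    and m: "m \<in> arr (Aux C) X Y" and eq: "cls C X T a = cls C X T b"
  shows "cls C Y T (cmp C T (csA X) (csA Y) a m) = cls C Y T (cmp C T (csA X) (csA Y) b m)"
proof -
  note [simp] = cospanD[OF X] cospanD[OF Y] T a Aux_arrD[OF m]
  have "a \<otimes>\<^bsub>homg C T (csA X)\<^esub> inv\<^bsub>homg C T (csA X)\<^esub> b \<in> syz C X T" using eq X by (simp add: cls_eq_iff)
  then have "cmp C T (csA X) (csA Y) (a \<otimes>\<^bsub>homg C T (csA X)\<^esub> inv\<^bsub>homg C T (csA X)\<^esub> b) m \<in> syz C Y T"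
    by (rule Aux_arr_syz[OF m T])
  then show ?thesis using Y by (simp add: cls_eq_iff cmp_add_left cmp_neg_left)
qed

text \<open>The witness asked for by the ideal is a syzygy witness, and a syzygy of \<open>Y\<close>
  meets the condition of \<open>Aux\<close> by itself, as its precomposites are syzygies. Hence
  \<open>X\<close> enters only through \<open>csA X\<close>.\<close>

lemma Aux_ideal_eq:
  assumes X: "is_cospan C X" and Y: "is_cospan C Y"
  shows "Aux_ideal C X Y = syz C Y (csA X)"
proof -
  have "a \<in> arr (Aux C) X Y" if a: "a \<in> syz C Y (csA X)" for a
    unfolding Aux_arr using syz_cmp[OF Y _ _ a] syz_arr[OF a] syz_arr cospanD[OF X] by blast
  moreover have "Aux_ideal C X Y = {a \<in> arr (Aux C) X Y. a \<in> syz C Y (csA X)}"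
    unfolding Aux_ideal_def syz_def using Aux_arrD by blast
  ultimately show ?thesis by blast
qed

lemma Aux_subgroup:
  assumes X: "is_cospan C X" and Y: "is_cospan C Y"
  shows "subgroup (arr (Aux C) X Y) (homg C (csA X) (csA Y))"
proof -
  note [simp] = cospanD[OF X] cospanD[OF Y]
  interpret G: comm_group "homg C (csA X) (csA Y)" by (simp add: hom_comm_group)
  show ?thesis
  proof (rule G.subgroupI)
    have "zero_arr C (csA X) (csA Y) \<in> arr (Aux C) X Y" by (simp add: Aux_arr syz_arr syz_zero Y)
    then show "arr (Aux C) X Y \<noteq> {}" by blast
  qed (auto simp: Aux_arr syz_arr cmp_add_left cmp_add_right cmp_neg_right syz_add syz_neg Y)
qed

lemma homg_Aux: "homg (Aux C) X Y = (homg C (csA X) (csA Y))\<lparr>carrier := arr (Aux C) X Y\<rparr>"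
  by (simp add: Aux_def)

lemma Aux_hom_comm_group: "\<lbrakk>is_cospan C X; is_cospan C Y\<rbrakk> \<Longrightarrow> comm_group (homg (Aux C) X Y)"
  by (subst homg_Aux) (intro comm_group_sub hom_comm_group Aux_subgroup cospanD)

lemma Aux_add: "\<lbrakk>is_cospan C X; is_cospan C Y; a \<in> arr (Aux C) X Y; b \<in> arr (Aux C) X Y\<rbrakk> \<Longrightarrow>
   a \<otimes>\<^bsub>homg C (csA X) (csA Y)\<^esub> b \<in> arr (Aux C) X Y"
  using subgroup.m_closed[OF Aux_subgroup] by metis

lemma ideal_subgroup:
  assumes X: "is_cospan C X" and Y: "is_cospan C Y"
  shows "subgroup (syz C Y (csA X)) (homg (Aux C) X Y)"
proof -
  have "syz C Y (csA X) \<subseteq> arr (Aux C) X Y"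
    using Aux_ideal_eq[OF X Y] by (auto simp: Aux_ideal_def)
  then show ?thesis
    by (subst homg_Aux)
      (rule group.subgroup_incl[OF hom_group syz_subgroup[OF Y] Aux_subgroup[OF X Y]]; simp add: cospanD[OF X] cospanD[OF Y])
qed

section \<open>Computation in Q(P) by representatives\<close>

lemma Q_obj [simp]: "obj (Q_cat C) = {X. is_cospan C X}"
  by (simp add: Q_cat_def quotient_cat_def)

lemma r_coset_Aux: "H #>\<^bsub>homg (Aux C) X Y\<^esub> a = H #>\<^bsub>homg C (csA X) (csA Y)\<^esub> a"
  by (simp add: r_coset_def)

lemma Q_arr_eq:
  assumes "is_cospan C X" "is_cospan C Y"
  shows "arr (Q_cat C) X Y = cls C Y (csA X) ` arr (Aux C) X Y"
  using assms by (simp add: Q_cat_def quotient_cat_def carrier_FactGroup Aux_ideal_eq r_coset_Aux cls_def)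

lemma Q_arrE:
  assumes "is_cospan C X" "is_cospan C Y" "V \<in> arr (Q_cat C) X Y"
  obtains a where "a \<in> arr (Aux C) X Y" "V = cls C Y (csA X) a"
  using assms by (auto simp: Q_arr_eq)

lemma cls_in_Q: "\<lbrakk>is_cospan C X; is_cospan C Y; a \<in> arr (Aux C) X Y\<rbrakk> \<Longrightarrow> cls C Y (csA X) a \<in> arr (Q_cat C) X Y"
  by (simp add: Q_arr_eq)

lemma cls_mem:
  assumes X: "is_cospan C X" and T: "T \<in> obj C" and a: "a \<in> arr C T (csA X)" and b: "b \<in> cls C X T a"
  shows "b \<in> arr C T (csA X)" "cls C X T b = cls C X T a"
proof -
  note [simp] = cospanD[OF X] T a
  interpret G: comm_group "homg C T (csA X)" by (simp add: hom_comm_group)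
  show "b \<in> arr C T (csA X)" "cls C X T b = cls C X T a"
    using b G.repr_independence[of b "syz C X T" a] syz_subgroup[OF X T] G.r_coset_subset_G[of "syz C X T" a]
      subgroup.subset[OF syz_subgroup[OF X T]]
    by (auto simp: cls_def)
qed

lemma cls_self:
  assumes X: "is_cospan C X" and T: "T \<in> obj C" and a: "a \<in> arr C T (csA X)"
  shows "a \<in> cls C X T a"
  unfolding cls_def using group.rcos_self[OF hom_group[OF T cospanD(1)[OF X]] a syz_subgroup[OF X T]] .

lemma cls_mem_Aux:
  assumes X: "is_cospan C X" and Y: "is_cospan C Y" and a: "a \<in> arr (Aux C) X Y" and b: "b \<in> cls C Y (csA X) a"
  shows "b \<in> arr (Aux C) X Y"
  using subgroup.subset[OF ideal_subgroup[OF X Y]] monoid.r_coset_subset_G[OF comm_monoid.axioms(1)[OF comm_group.axioms(1)[OF Aux_hom_comm_group[OF X Y]]] _ a] b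
  unfolding cls_def r_coset_Aux by blast

text \<open>By the two congruences, all classes in the union that defines the composite coincide, so
  any representatives may be used.\<close>

lemma Q_cmp:
  assumes X: "is_cospan C X" and Y: "is_cospan C Y" and Z: "is_cospan C Z"
    and a: "a \<in> arr (Aux C) X Y" and b: "b \<in> arr (Aux C) Y Z"
  shows "cmp (Q_cat C) X Y Z (cls C Y (csA X) a) (cls C Z (csA Y) b) = cls C Z (csA X) (cmp C (csA X) (csA Y) (csA Z) a b)"
proof -
  note [simp] = cospanD[OF X] cospanD[OF Y] cospanD[OF Z] Aux_arrD[OF a] Aux_arrD[OF b]
  have "cls C Z (csA X) (cmp C (csA X) (csA Y) (csA Z) f g) = cls C Z (csA X) (cmp C (csA X) (csA Y) (csA Z) a b)"
    if f: "f \<in> cls C Y (csA X) a" and g: "g \<in> cls C Z (csA Y) b" for f g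
  proof -
    note f' = cls_mem[OF Y _ _ f] and g' = cls_mem[OF Z _ _ g]
    have "cls C Z (csA X) (cmp C (csA X) (csA Y) (csA Z) f g) = cls C Z (csA X) (cmp C (csA X) (csA Y) (csA Z) f b)"
      by (rule cls_cmp_left) (use Z f' g' in simp_all)
    also have "\<dots> = cls C Z (csA X) (cmp C (csA X) (csA Y) (csA Z) a b)"
      by (rule cls_cmp_right[OF Y Z _ _ _ b]) (use f' in simp_all)
    finally show ?thesis .
  qed
  then have "cmp (Q_cat C) X Y Z (cls C Y (csA X) a) (cls C Z (csA Y) b)
    = (\<Union>f\<in>cls C Y (csA X) a. \<Union>g\<in>cls C Z (csA Y) b. cls C Z (csA X) (cmp C (csA X) (csA Y) (csA Z) a b))"
    by (simp add: Q_cat_def quotient_cat_def Aux_ideal_eq X Z r_coset_Aux flip: cls_def)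
  \<comment> \<open>Both cosets are nonempty, so the union of the constant family is its
    value.\<close>
  then show ?thesis
    using cls_self[OF Y _ Aux_arrD[OF a]] cls_self[OF Z _ Aux_arrD[OF b]] by auto
qed

lemma Q_idn: "is_cospan C X \<Longrightarrow> idn (Q_cat C) X = cls C X (csA X) (idn C (csA X))"
  by (simp add: Q_cat_def quotient_cat_def Aux_ideal_eq r_coset_Aux cls_def)

lemma Q_zero:
  assumes "is_cospan C X" "is_cospan C Y"
  shows "zero_arr (Q_cat C) X Y = cls C Y (csA X) (zero_arr C (csA X) (csA Y))"
proof -
  interpret G: comm_group "homg C (csA X) (csA Y)" using assms by (simp add: hom_comm_group cospanD)
  show ?thesis
    using assms G.coset_mult_one[of "syz C Y (csA X)"] subgroup.subset[OF syz_subgroup[OF assms(2)]]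
    by (simp add: Q_cat_def quotient_cat_def Aux_ideal_eq cls_def cospanD)
qed

lemma Q_add:
  assumes X: "is_cospan C X" and Y: "is_cospan C Y" and a: "a \<in> arr (Aux C) X Y" and b: "b \<in> arr (Aux C) X Y"
  shows "cls C Y (csA X) a \<otimes>\<^bsub>homg (Q_cat C) X Y\<^esub> cls C Y (csA X) b = cls C Y (csA X) (a \<otimes>\<^bsub>homg C (csA X) (csA Y)\<^esub> b)"
proof -
  interpret G: comm_group "homg (Aux C) X Y" by (rule Aux_hom_comm_group[OF X Y])
  have "syz C Y (csA X) \<lhd> homg (Aux C) X Y"
    by (rule G.subgroup_imp_normal[OF ideal_subgroup[OF X Y]])
  from normal.rcos_sum[OF this a b] show ?thesis
    using X Y by (simp add: Q_cat_def quotient_cat_def Aux_ideal_eq cls_def r_coset_Aux)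
qed

lemma preadditive_Q: "preadditive_cat (Q_cat C)"
proof (rule preadditive_cat.intro)
  fix X Y assume "X \<in> obj (Q_cat C)" "Y \<in> obj (Q_cat C)"
  then have X: "is_cospan C X" and Y: "is_cospan C Y" by auto
  note [simp] = X Y cospanD[OF X] cospanD[OF Y]
  interpret G: comm_group "homg (Aux C) X Y" by (rule Aux_hom_comm_group[OF X Y])
  show "comm_group (homg (Q_cat C) X Y)"
    using G.abelian_FactGroup[OF ideal_subgroup[OF X Y]]
    by (simp add: Q_cat_def quotient_cat_def Aux_ideal_eq)
  show "idn (Q_cat C) X \<in> arr (Q_cat C) X X" by (simp add: Q_idn cls_in_Q Aux_idn)
  fix V assume V: "V \<in> arr (Q_cat C) X Y"
  then obtain a where a: "a \<in> arr (Aux C) X Y" "V = cls C Y (csA X) a" by (auto elim: Q_arrE[OF X Y])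
  note [simp] = a Aux_arrD[OF a(1)]
  show "cmp (Q_cat C) X X Y (idn (Q_cat C) X) V = V" by (simp add: Q_idn Q_cmp Aux_idn)
  show "cmp (Q_cat C) X Y Y V (idn (Q_cat C) Y) = V" by (simp add: Q_idn Q_cmp Aux_idn)
  fix Z assume "Z \<in> obj (Q_cat C)"
  then have Z [simp]: "is_cospan C Z" by simp
  note [simp] = cospanD[OF Z]
  fix W assume "W \<in> arr (Q_cat C) Y Z"
  then obtain b where b: "b \<in> arr (Aux C) Y Z" "W = cls C Z (csA Y) b" by (auto elim: Q_arrE[OF Y Z])
  note [simp] = b Aux_arrD[OF b(1)]
  show "cmp (Q_cat C) X Y Z V W \<in> arr (Q_cat C) X Z" by (simp add: Q_cmp cls_in_Q Aux_cmp)
  show "cmp (Q_cat C) X Y Z (V \<otimes>\<^bsub>homg (Q_cat C) X Y\<^esub> V') W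
      = cmp (Q_cat C) X Y Z V W \<otimes>\<^bsub>homg (Q_cat C) X Z\<^esub> cmp (Q_cat C) X Y Z V' W"
    if V': "V' \<in> arr (Q_cat C) X Y" for V'
  proof -
    obtain a' where a': "a' \<in> arr (Aux C) X Y" "V' = cls C Y (csA X) a'" using V' by (auto elim: Q_arrE[OF X Y])
    note [simp] = a' Aux_arrD[OF a'(1)]
    show ?thesis by (simp add: Q_cmp Q_add Aux_cmp Aux_add cmp_add_left)
  qed
  show "cmp (Q_cat C) X Y Z V (W \<otimes>\<^bsub>homg (Q_cat C) Y Z\<^esub> W')
      = cmp (Q_cat C) X Y Z V W \<otimes>\<^bsub>homg (Q_cat C) X Z\<^esub> cmp (Q_cat C) X Y Z V W'"
    if W': "W' \<in> arr (Q_cat C) Y Z" for W'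
  proof -
    obtain b' where b': "b' \<in> arr (Aux C) Y Z" "W' = cls C Z (csA Y) b'" using W' by (auto elim: Q_arrE[OF Y Z])
    note [simp] = b' Aux_arrD[OF b'(1)]
    show ?thesis by (simp add: Q_cmp Q_add Aux_cmp Aux_add cmp_add_right)
  qed
  fix E U assume "E \<in> obj (Q_cat C)" and U: "U \<in> arr (Q_cat C) Z E"
  then have E [simp]: "is_cospan C E" by simp
  note [simp] = cospanD[OF E]
  obtain c where c: "c \<in> arr (Aux C) Z E" "U = cls C E (csA Z) c" using U by (auto elim: Q_arrE[OF Z E])
  note [simp] = c Aux_arrD[OF c(1)]
  show "cmp (Q_cat C) X Z E (cmp (Q_cat C) X Y Z V W) U = cmp (Q_cat C) X Y E V (cmp (Q_cat C) Y Z E W U)"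
    by (simp add: Q_cmp Aux_cmp cmp_assoc)
qed

end

section \<open>Cospans with prescribed syzygies\<close>

lemma full_subcat_simps [simp]:
  "obj (full_subcat C S) = S" "homg (full_subcat C S) = homg C" "cmp (full_subcat C S) = cmp C"
  "idn (full_subcat C S) = idn C"
  by (simp_all add: full_subcat_def)

lemma full_subcat_obj [simp]: "full_subcat C (obj C) = C"
  by (simp add: full_subcat_def)

lemma (in preadditive_cat) biproductD:
  assumes "is_biproduct C A B S i j p q"
  shows "S \<in> obj C" "i \<in> arr C A S" "j \<in> arr C B S" "p \<in> arr C S A" "q \<in> arr C S B"
    "cmp C A S A i p = idn C A" "cmp C B S B j q = idn C B"
    "cmp C A S B i q = zero_arr C A B" "cmp C B S A j p = zero_arr C B A"
    "cmp C S A S p i \<otimes>\<^bsub>homg C S S\<^esub> cmp C S B S q j = idn C S"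
  using assms by (simp_all add: is_biproduct_def)

lemma (in preadditive_cat) add_zero_right [simp]:
  "\<lbrakk>A \<in> obj C; B \<in> obj C; f \<in> arr C A B\<rbrakk> \<Longrightarrow> f \<otimes>\<^bsub>homg C A B\<^esub> zero_arr C A B = f"
  "\<lbrakk>A \<in> obj C; B \<in> obj C; f \<in> arr C A B\<rbrakk> \<Longrightarrow> zero_arr C A B \<otimes>\<^bsub>homg C A B\<^esub> f = f"
  using hom_group by (simp_all add: group.is_monoid monoid.r_one monoid.l_one)

definition presenting_cospans :: "('o, 'm) acat \<Rightarrow> ('o, 'm) cospan set" where
  "presenting_cospans C = {X. is_cospan C X \<and> csO X = csA X \<and> gam X = idn C (csA X)}"

text \<open>The converse of the condition that defines \<open>Aux\<close>. For a morphism
  \<open>m\<close> of \<open>Aux\<close> it says that the induced map between the quotients of the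
  representable functors by the syzygies is injective at every object.\<close>

definition pw_mono :: "('o, 'm) acat \<Rightarrow> ('o, 'm) cospan \<Rightarrow> ('o, 'm) cospan \<Rightarrow> 'm \<Rightarrow> bool" where
  "pw_mono C X Y m \<longleftrightarrow> (\<forall>T\<in>obj C. \<forall>t\<in>arr C T (csA X).
     cmp C T (csA X) (csA Y) t m \<in> syz C Y T \<longrightarrow> t \<in> syz C X T)"

context additive_cat
begin

section \<open>Biproducts and sums of images\<close>

lemma biproduct_pair:
  assumes b: "is_biproduct C A B S i j p q" and obj: "A \<in> obj C" "B \<in> obj C" "T \<in> obj C"
    and x: "x \<in> arr C T A" and y: "y \<in> arr C T B"
  obtains w where "w \<in> arr C T S" "cmp C T S A w p = x" "cmp C T S B w q = y"
proof
  note [simp] = biproductD[OF b] obj x y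
  let ?w = "cmp C T A S x i \<otimes>\<^bsub>homg C T S\<^esub> cmp C T B S y j"
  show "?w \<in> arr C T S" by simp
  show "cmp C T S A ?w p = x" by (simp add: cmp_add_left cmp_assoc)
  show "cmp C T S B ?w q = y" by (simp add: cmp_add_left cmp_assoc)
qed

lemma biproduct_eqI:
  assumes b: "is_biproduct C A B S i j p q" and obj: "A \<in> obj C" "B \<in> obj C" "T \<in> obj C"
    and w: "w \<in> arr C T S" "v \<in> arr C T S" "cmp C T S A w p = cmp C T S A v p" "cmp C T S B w q = cmp C T S B v q"
  shows "w = v"
proof -
  note b = biproductD[OF b] and [simp] = obj w(1,2)
  note [simp] = b(1-5)
  have *: "u = cmp C T A S (cmp C T S A u p) i \<otimes>\<^bsub>homg C T S\<^esub> cmp C T B S (cmp C T S B u q) j" if "u \<in> arr C T S" for u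
  proof -
    have "u = cmp C T S S u (cmp C S A S p i \<otimes>\<^bsub>homg C S S\<^esub> cmp C S B S q j)" using that by (simp add: b)
    then show ?thesis using that by (simp add: cmp_add_right cmp_assoc)
  qed
  show ?thesis using *[OF w(1)] *[OF w(2)] w(3,4) by simp
qed

text \<open>Maps into the biproduct of the two sources are pairs, so the sum of two images of
  representable functors is again the image of one. Several generators can thus be collected in a
  single \<open>rho\<close> or a single weak kernel.\<close>

lemma sum_image:
  assumes obj: "A \<in> obj C" "B \<in> obj C" "D \<in> obj C" and f: "f \<in> arr C A D" and g: "g \<in> arr C B D"
  obtains S h where "S \<in> obj C" "h \<in> arr C S D"
    "\<And>T t. T \<in> obj C \<Longrightarrow> (\<exists>w\<in>arr C T S. t = cmp C T S D w h) \<longleftrightarrow>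
      (\<exists>x\<in>arr C T A. \<exists>y\<in>arr C T B. t = cmp C T A D x f \<otimes>\<^bsub>homg C T D\<^esub> cmp C T B D y g)"
proof -
  obtain S i j p q where b: "is_biproduct C A B S i j p q" using ex_biproduct obj by blast
  note [simp] = biproductD[OF b] obj f g
  let ?h = "cmp C S A D p f \<otimes>\<^bsub>homg C S D\<^esub> cmp C S B D q g"
  have h: "cmp C T S D w ?h = cmp C T A D (cmp C T S A w p) f \<otimes>\<^bsub>homg C T D\<^esub> cmp C T B D (cmp C T S B w q) g"
    if "T \<in> obj C" "w \<in> arr C T S" for T w
    using that by (simp add: cmp_add_right cmp_assoc)
  show thesis
  proof
    show "S \<in> obj C" "?h \<in> arr C S D" by simp_all
    fix T t assume T: "T \<in> obj C"
    show "(\<exists>w\<in>arr C T S. t = cmp C T S D w ?h) \<longleftrightarrow>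
      (\<exists>x\<in>arr C T A. \<exists>y\<in>arr C T B. t = cmp C T A D x f \<otimes>\<^bsub>homg C T D\<^esub> cmp C T B D y g)" (is "?l \<longleftrightarrow> ?r")
    proof
      assume ?l
      then obtain w where "w \<in> arr C T S" "t = cmp C T S D w ?h" by blast
      then show ?r using h[OF T] T by (intro bexI[of _ "cmp C T S A w p"] bexI[of _ "cmp C T S B w q"]) auto
    next
      assume ?r
      then obtain x y where xy: "x \<in> arr C T A" "y \<in> arr C T B" "t = cmp C T A D x f \<otimes>\<^bsub>homg C T D\<^esub> cmp C T B D y g" by blast
      obtain w where "w \<in> arr C T S" "cmp C T S A w p = x" "cmp C T S B w q = y"
        by (rule biproduct_pair[OF b obj(1,2) T xy(1,2)])
      then show ?l using h[OF T] xy by auto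
    qed
  qed
qed

text \<open>Each of the following cospans is determined up to isomorphism by its first object and its syzygies.\<close>

lemma coker_cospan:
  assumes X: "is_cospan C X" and A: "A \<in> obj C" and a: "a \<in> arr C A (csA X)"
  obtains Y where "is_cospan C Y" "csA Y = csA X" "csO Y = csO X" "gam Y = gam X"
    "\<And>T s. \<lbrakk>T \<in> obj C; s \<in> arr C T (csA X)\<rbrakk> \<Longrightarrow>
      s \<in> syz C Y T \<longleftrightarrow> (\<exists>w\<in>arr C T A. cls C X T s = cls C X T (cmp C T A (csA X) w a))"
    "\<And>T. T \<in> obj C \<Longrightarrow> syz C X T \<subseteq> syz C Y T"
proof -
  note [simp] = cospanD[OF X] A a
  \<comment> \<open>The new \<open>rho\<close> starts at the biproduct of \<open>csR X\<close> and
    \<open>A\<close> and has components \<open>rho X\<close> and \<open>a gamma\<close>: a witness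
    for \<open>s\<close> then amounts to some \<open>w\<close> for which \<open>s - w a\<close> is a
    syzygy of \<open>X\<close>.\<close>
  obtain S h where S: "S \<in> obj C" and h: "h \<in> arr C S (csO X)"
    and im: "\<And>T t. T \<in> obj C \<Longrightarrow> (\<exists>w\<in>arr C T S. t = cmp C T S (csO X) w h) \<longleftrightarrow>
      (\<exists>x\<in>arr C T (csR X). \<exists>y\<in>arr C T A. t = cmp C T (csR X) (csO X) x (rho X)
         \<otimes>\<^bsub>homg C T (csO X)\<^esub> cmp C T A (csO X) y (cmp C A (csA X) (csO X) a (gam X)))"
    by (rule sum_image[of "csR X" A "csO X" "rho X" "cmp C A (csA X) (csO X) a (gam X)"]) auto
  define Y where "Y = X\<lparr>csR := S, rho := h\<rparr>"
  have Ys: "csA Y = csA X" "csO Y = csO X" "gam Y = gam X" "csR Y = S" "rho Y = h" by (simp_all add: Y_def)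
  have syzY: "s \<in> syz C Y T \<longleftrightarrow> (\<exists>w\<in>arr C T A. cls C X T s = cls C X T (cmp C T A (csA X) w a))"
    if T: "T \<in> obj C" and s: "s \<in> arr C T (csA X)" for T s
  proof -
    interpret G: comm_group "homg C T (csO X)" using T by (simp add: hom_comm_group)
    have "(cls C X T s = cls C X T (cmp C T A (csA X) w a)) \<longleftrightarrow>
      (\<exists>x\<in>arr C T (csR X). cmp C T (csA X) (csO X) s (gam X) = cmp C T (csR X) (csO X) x (rho X)
         \<otimes>\<^bsub>homg C T (csO X)\<^esub> cmp C T A (csO X) w (cmp C A (csA X) (csO X) a (gam X)))"
      if w: "w \<in> arr C T A" for w
      using w s T X
      by (auto simp: cls_eq_iff syz_def cmp_add_left cmp_neg_left cmp_assoc G.inv_solve_right' G.inv_solve_right)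
    then show ?thesis
      unfolding syz_def using im[OF T] s by (auto simp: Ys)
  qed
  have "s \<in> syz C Y T" if T: "T \<in> obj C" and s: "s \<in> syz C X T" for T s
  proof -
    have "cls C X T s = cls C X T (cmp C T A (csA X) (zero_arr C T A) a)"
      using cls_zero_iff[OF X T syz_arr[OF s]] s T by simp
    then show ?thesis using syzY[OF T syz_arr[OF s]] zero_closed[OF T A] by blast
  qed
  moreover have "is_cospan C Y" using S h Ys X by (auto simp: is_cospan_def)
  ultimately show thesis using that[of Y] Ys syzY by blast
qed

text \<open>Precomposing \<open>gam X\<close> with \<open>k\<close> leaves the witnesses untouched.
  That this takes no weak pullback is why Q(P) has images for every additive P.\<close>

lemma pull_cospan:
  assumes X: "is_cospan C X" and K: "K \<in> obj C" and k: "k \<in> arr C K (csA X)"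
  obtains Y where "is_cospan C Y" "csA Y = K"
    "\<And>T s. \<lbrakk>T \<in> obj C; s \<in> arr C T K\<rbrakk> \<Longrightarrow> s \<in> syz C Y T \<longleftrightarrow> cmp C T K (csA X) s k \<in> syz C X T"
proof -
  note [simp] = cospanD[OF X] K k
  define Y where "Y = X\<lparr>csA := K, gam := cmp C K (csA X) (csO X) k (gam X)\<rparr>"
  show thesis
  proof (rule that[of Y])
    show "is_cospan C Y" using X by (simp add: is_cospan_def Y_def)
    show "s \<in> syz C Y T \<longleftrightarrow> cmp C T K (csA X) s k \<in> syz C X T" if "T \<in> obj C" "s \<in> arr C T K" for T s
      using that by (auto simp: syz_def Y_def cmp_assoc)
  qed (simp add: Y_def)
qed

text \<open>With \<open>gam\<close> paired into the biproduct of the two middle objects and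
  \<open>rho\<close> diagonal between biproducts, a witness is a pair of witnesses.\<close>

lemma inter_cospan:
  assumes X: "is_cospan C X" and Y: "is_cospan C Y" and eq: "csA Y = csA X"
  obtains Z where "is_cospan C Z" "csA Z = csA X"
    "\<And>T. T \<in> obj C \<Longrightarrow> syz C Z T = syz C X T \<inter> syz C Y T"
proof -
  note [simp] = cospanD[OF X] cospanD[OF Y, unfolded eq]
  obtain S i j p q where b: "is_biproduct C (csO X) (csO Y) S i j p q" using ex_biproduct cospanD[OF X] cospanD[OF Y] by blast
  obtain S' i' j' p' q' where b': "is_biproduct C (csR X) (csR Y) S' i' j' p' q'" using ex_biproduct cospanD[OF X] cospanD[OF Y] by blast
  note [simp] = biproductD(1-5)[OF b] biproductD(1-5)[OF b']
  obtain g where g: "g \<in> arr C (csA X) S" "cmp C (csA X) S (csO X) g p = gam X" "cmp C (csA X) S (csO Y) g q = gam Y"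
    by (rule biproduct_pair[OF b, of "csA X" "gam X" "gam Y"]) simp_all
  obtain r where r: "r \<in> arr C S' S" "cmp C S' S (csO X) r p = cmp C S' (csR X) (csO X) p' (rho X)"
      "cmp C S' S (csO Y) r q = cmp C S' (csR Y) (csO Y) q' (rho Y)"
    by (rule biproduct_pair[OF b, of S' "cmp C S' (csR X) (csO X) p' (rho X)" "cmp C S' (csR Y) (csO Y) q' (rho Y)"]) simp_all
  define Z where "Z = \<lparr>csA = csA X, csO = S, csR = S', gam = g, rho = r\<rparr>"
  have Zs: "csA Z = csA X" "csO Z = S" "csR Z = S'" "gam Z = g" "rho Z = r" by (simp_all add: Z_def)
  have "s \<in> syz C Z T \<longleftrightarrow> s \<in> syz C X T \<and> s \<in> syz C Y T" if T: "T \<in> obj C" for T s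
  proof (cases "s \<in> arr C T (csA X)")
    case s: True
    have *: "cmp C T (csA X) S s g = cmp C T S' S w r \<longleftrightarrow>
      cmp C T (csA X) (csO X) s (gam X) = cmp C T (csR X) (csO X) (cmp C T S' (csR X) w p') (rho X) \<and>
      cmp C T (csA X) (csO Y) s (gam Y) = cmp C T (csR Y) (csO Y) (cmp C T S' (csR Y) w q') (rho Y)" (is "_ \<longleftrightarrow> ?R")
      if w: "w \<in> arr C T S'" for w
    proof -
      have "cmp C T (csA X) S s g = cmp C T S' S w r \<longleftrightarrow>
        cmp C T S (csO X) (cmp C T (csA X) S s g) p = cmp C T S (csO X) (cmp C T S' S w r) p \<and>
        cmp C T S (csO Y) (cmp C T (csA X) S s g) q = cmp C T S (csO Y) (cmp C T S' S w r) q"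
        using biproduct_eqI[OF b, of T "cmp C T (csA X) S s g" "cmp C T S' S w r"] T w s g r by auto
      also have "\<dots> \<longleftrightarrow> ?R" using T w s g r by (simp add: cmp_assoc)
      finally show ?thesis .
    qed
    show ?thesis
    proof
      assume "s \<in> syz C Z T"
      then obtain w where w: "w \<in> arr C T S'" "cmp C T (csA X) S s g = cmp C T S' S w r" by (auto simp: syz_def Zs)
      then show "s \<in> syz C X T \<and> s \<in> syz C Y T"
        using *[OF w(1)] s T by (auto simp: syz_def eq)
    next
      assume "s \<in> syz C X T \<and> s \<in> syz C Y T"
      then obtain x y where x: "x \<in> arr C T (csR X)" "cmp C T (csA X) (csO X) s (gam X) = cmp C T (csR X) (csO X) x (rho X)"
        and y: "y \<in> arr C T (csR Y)" "cmp C T (csA X) (csO Y) s (gam Y) = cmp C T (csR Y) (csO Y) y (rho Y)"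
        by (auto simp: syz_def eq)
      obtain w where w: "w \<in> arr C T S'" "cmp C T S' (csR X) w p' = x" "cmp C T S' (csR Y) w q' = y"
        by (rule biproduct_pair[OF b', of T x y]) (use T x y in simp_all)
      then show "s \<in> syz C Z T" using *[OF w(1)] x y s by (auto simp: syz_def Zs)
    qed
  qed (auto simp: syz_def Zs eq)
  moreover have "is_cospan C Z" using g r by (simp add: is_cospan_def Zs)
  ultimately show thesis using Zs by (intro that[of Z]) auto
qed

lemma syz_presenting:
  assumes "X \<in> presenting_cospans C" "T \<in> obj C"
  shows "syz C X T = (\<lambda>w. cmp C T (csR X) (csA X) w (rho X)) ` arr C T (csR X)"
proof -
  from assms(1) have X: "is_cospan C X" "csO X = csA X" "gam X = idn C (csA X)"
    by (auto simp: presenting_cospans_def)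
  note [simp] = cospanD[OF X(1)]
  show ?thesis
    using assms(2) X cospanD(5)[OF X(1)] by (auto simp: syz_def image_def)
qed

section \<open>Presenting and free cospans\<close>

lemma presenting_cospan:
  assumes "A \<in> obj C" "B \<in> obj C" "a \<in> arr C B A"
  shows "\<lparr>csA = A, csO = A, csR = B, gam = idn C A, rho = a\<rparr> \<in> presenting_cospans C"
  using assms by (simp add: presenting_cospans_def is_cospan_def)

text \<open>With a zero object as source of \<open>rho\<close>, only zero is a syzygy. The cospan
  stands for the representable functor of \<open>A\<close>, and morphisms out of such cospans serve
  as tests in Q(P).\<close>

lemma free_cospan:
  assumes "A \<in> obj C"
  obtains X where "X \<in> presenting_cospans C" "csA X = A" "\<And>T. T \<in> obj C \<Longrightarrow> syz C X T = {zero_arr C T A}"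
proof -
  obtain Z where Z: "is_zero_object C Z" using ex_zero_object by blast
  then have Zo [simp]: "Z \<in> obj C" by (simp add: is_zero_object_def)
  let ?X = "\<lparr>csA = A, csO = A, csR = Z, gam = idn C A, rho = zero_arr C Z A\<rparr>"
  have X: "?X \<in> presenting_cospans C" by (rule presenting_cospan) (use assms in simp_all)
  have "syz C ?X T = {zero_arr C T A}" if "T \<in> obj C" for T
    using syz_presenting[OF X that] assms that by (auto simp: image_def intro: exI[of _ "zero_arr C T Z"])
  then show thesis using X by (intro that[of ?X]) auto
qed

lemma presenting_cospansD: "X \<in> presenting_cospans C \<Longrightarrow> is_cospan C X"
  by (simp add: presenting_cospans_def)

lemma free_cospan_Aux_arr:
  assumes "X \<in> presenting_cospans C" "\<And>T. T \<in> obj C \<Longrightarrow> syz C X T = {zero_arr C T (csA X)}" "is_cospan C Y"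
  shows "arr (Aux C) X Y = arr C (csA X) (csA Y)"
  using assms cospanD[OF assms(3)] cospanD[OF presenting_cospansD[OF assms(1)]] by (auto simp: Aux_arr syz_zero)

section \<open>Monomorphisms and epimorphisms of Q(P)\<close>

lemma pw_mono_cls:
  assumes X: "is_cospan C X" and Y: "is_cospan C Y" and m: "m \<in> arr C (csA X) (csA Y)" "pw_mono C X Y m"
    and T: "T \<in> obj C" "a \<in> arr C T (csA X)" "b \<in> arr C T (csA X)"
    and eq: "cls C Y T (cmp C T (csA X) (csA Y) a m) = cls C Y T (cmp C T (csA X) (csA Y) b m)"
  shows "cls C X T a = cls C X T b"
proof -
  note [simp] = cospanD[OF X] cospanD[OF Y] m(1) T
  have "cmp C T (csA X) (csA Y) (a \<otimes>\<^bsub>homg C T (csA X)\<^esub> inv\<^bsub>homg C T (csA X)\<^esub> b) m \<in> syz C Y T"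
    using eq Y by (simp add: cls_eq_iff cmp_add_left cmp_neg_left)
  then show ?thesis using m(2) X unfolding pw_mono_def by (simp add: cls_eq_iff)
qed

lemma Q_eq_zero_iff:
  assumes "is_cospan C X" "is_cospan C Y" "a \<in> arr C (csA X) (csA Y)"
  shows "cls C Y (csA X) a = zero_arr (Q_cat C) X Y \<longleftrightarrow> a \<in> syz C Y (csA X)"
  using assms by (simp add: Q_zero cls_zero_iff cospanD)

text \<open>Comparing \<open>t\<close> with zero out of the free cospan on \<open>T\<close> tests
  injectivity at \<open>T\<close>. Any full subcategory that contains these test objects is allowed,
  which covers the finitely presented functors too.\<close>

lemma Q_mono_imp_pw_mono:
  assumes S: "presenting_cospans C \<subseteq> S" and X: "is_cospan C X" and Y: "is_cospan C Y" and a: "a \<in> arr (Aux C) X Y"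
    and m: "is_mono (full_subcat (Q_cat C) S) X Y (cls C Y (csA X) a)"
  shows "pw_mono C X Y a"
proof -
  note [simp] = X Y cospanD[OF X] cospanD[OF Y] a Aux_arrD[OF a]
  show "pw_mono C X Y a"
    unfolding pw_mono_def
  proof (intro ballI impI)
    fix T t assume T: "T \<in> obj C" and t: "t \<in> arr C T (csA X)" and 0: "cmp C T (csA X) (csA Y) t a \<in> syz C Y T"
    obtain F where F: "F \<in> presenting_cospans C" "csA F = T" "\<And>T. T \<in> obj C \<Longrightarrow> syz C F T = {zero_arr C T (csA F)}"
      using free_cospan[OF T] by metis
    have FF: "is_cospan C F" "F \<in> S" using F S by (auto simp: presenting_cospansD)
    have tt: "t \<in> arr (Aux C) F X" "zero_arr C T (csA X) \<in> arr (Aux C) F X"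
      using free_cospan_Aux_arr[OF F(1,3) X] t T F(2) by auto
    have "cmp (Q_cat C) F X Y (cls C X T t) (cls C Y (csA X) a) = cmp (Q_cat C) F X Y (cls C X T (zero_arr C T (csA X))) (cls C Y (csA X) a)"
      using Q_cmp[OF FF(1) X Y tt(1) a] Q_cmp[OF FF(1) X Y tt(2) a] 0 T t F(2) by (simp add: cls_zero_iff)
    from is_monoD[OF m, of F, simplified, OF FF(2) _ _ this] have "cls C X T t = cls C X T (zero_arr C T (csA X))"
      using cls_in_Q[OF FF(1) X tt(1)] cls_in_Q[OF FF(1) X tt(2)] FF F(2) by simp
    then show "t \<in> syz C X T" using T t by (simp add: cls_zero_iff)
  qed
qed

lemma Q_mono_iff:
  assumes X: "is_cospan C X" and Y: "is_cospan C Y" and a: "a \<in> arr (Aux C) X Y"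
  shows "is_mono (Q_cat C) X Y (cls C Y (csA X) a) \<longleftrightarrow> pw_mono C X Y a"
proof
  assume "is_mono (Q_cat C) X Y (cls C Y (csA X) a)"
  then show "pw_mono C X Y a"
    using Q_mono_imp_pw_mono[OF _ X Y a, of "obj (Q_cat C)"] presenting_cospansD
    by (simp del: Q_obj) (auto simp: full_subcat_def subset_iff)
next
  assume m: "pw_mono C X Y a"
  note [simp] = X Y cospanD[OF X] cospanD[OF Y] a Aux_arrD[OF a]
  show "is_mono (Q_cat C) X Y (cls C Y (csA X) a)"
    unfolding is_mono_def
  proof (intro conjI ballI impI)
    fix T g h assume "T \<in> obj (Q_cat C)" and g: "g \<in> arr (Q_cat C) T X" and h: "h \<in> arr (Q_cat C) T X"
      and eq: "cmp (Q_cat C) T X Y g (cls C Y (csA X) a) = cmp (Q_cat C) T X Y h (cls C Y (csA X) a)"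
    then have T: "is_cospan C T" by simp
    obtain g' where g': "g' \<in> arr (Aux C) T X" "g = cls C X (csA T) g'" using Q_arrE[OF T X g] .
    obtain h' where h': "h' \<in> arr (Aux C) T X" "h = cls C X (csA T) h'" using Q_arrE[OF T X h] .
    show "g = h"
      unfolding g'(2) h'(2)
      by (rule pw_mono_cls[OF X Y _ m]) (use eq g' h' T in \<open>simp_all add: Q_cmp cospanD Aux_arrD\<close>)
  qed (simp add: cls_in_Q)
qed

text \<open>An epimorphism of the quotient category splits in \<open>C\<close> modulo syzygies, as its cokernel vanishes.\<close>

lemma Q_epi_imp_split:
  assumes X: "is_cospan C X" and Y: "is_cospan C Y" and a: "a \<in> arr (Aux C) X Y"
    and e: "is_epi (full_subcat (Q_cat C) S) X Y (cls C Y (csA X) a)"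
    and S: "\<And>K. \<lbrakk>is_cospan C K; csA K = csA Y; csO K = csO Y; gam K = gam Y\<rbrakk> \<Longrightarrow> K \<in> S"
  shows "\<exists>z\<in>arr C (csA Y) (csA X). cls C Y (csA Y) (idn C (csA Y)) = cls C Y (csA Y) (cmp C (csA Y) (csA X) (csA Y) z a)"
proof -
  note [simp] = X Y cospanD[OF X] cospanD[OF Y] a Aux_arrD[OF a]
  \<comment> \<open>The cokernel cospan of \<open>a\<close> differs from \<open>Y\<close> in its
    relation part only, so it lies in \<open>S\<close>. Into it, the identity and zero agree after
    \<open>a\<close>, hence agree, and the identity of \<open>csA Y\<close> becomes a syzygy of
    \<open>K\<close>.\<close>
  obtain K where K: "is_cospan C K" "csA K = csA Y" and K': "csO K = csO Y" "gam K = gam Y" and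
    syzK: "\<And>T s. \<lbrakk>T \<in> obj C; s \<in> arr C T (csA Y)\<rbrakk> \<Longrightarrow>
      s \<in> syz C K T \<longleftrightarrow> (\<exists>w\<in>arr C T (csA X). cls C Y T s = cls C Y T (cmp C T (csA X) (csA Y) w a))"
    and YK: "\<And>T. T \<in> obj C \<Longrightarrow> syz C Y T \<subseteq> syz C K T"
    by (rule coker_cospan[OF Y cospanD(1)[OF X] Aux_arrD[OF a]]) blast
  have KS: "K \<in> S" using S K K' by blast
  have id: "idn C (csA Y) \<in> arr (Aux C) Y K" using YK by (auto simp: Aux_arr K syz_arr)
  have z: "zero_arr C (csA Y) (csA K) \<in> arr (Aux C) Y K" by (auto simp: Aux_arr K syz_arr syz_zero[OF K(1), unfolded K])
  have "a \<in> syz C K (csA X)"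
    using syzK[of "csA X" a] bexI[of _ "idn C (csA X)"] by simp
  then have "cmp (Q_cat C) X Y K (cls C Y (csA X) a) (cls C K (csA Y) (idn C (csA Y)))
     = cmp (Q_cat C) X Y K (cls C Y (csA X) a) (cls C K (csA Y) (zero_arr C (csA Y) (csA K)))"
    using Q_cmp[OF X Y K(1) a id] Q_cmp[OF X Y K(1) a z] K by (simp add: cls_zero_iff[OF K(1), unfolded K(2)])
  then have "cls C K (csA Y) (idn C (csA Y)) = cls C K (csA Y) (zero_arr C (csA Y) (csA K))"
    using is_epiD[OF e, of K] cls_in_Q[OF Y K(1) id] cls_in_Q[OF Y K(1) z] KS by simp
  then have "idn C (csA Y) \<in> syz C K (csA Y)" by (simp add: K cls_zero_iff[OF K(1), unfolded K(2)])
  then show "\<exists>z\<in>arr C (csA Y) (csA X). cls C Y (csA Y) (idn C (csA Y)) = cls C Y (csA Y) (cmp C (csA Y) (csA X) (csA Y) z a)"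
    using syzK by simp
qed

lemma Q_epi_iff:
  assumes X: "is_cospan C X" and Y: "is_cospan C Y" and a: "a \<in> arr (Aux C) X Y"
  shows "is_epi (Q_cat C) X Y (cls C Y (csA X) a) \<longleftrightarrow>
    (\<exists>z\<in>arr C (csA Y) (csA X). cls C Y (csA Y) (idn C (csA Y)) = cls C Y (csA Y) (cmp C (csA Y) (csA X) (csA Y) z a))"
proof
  assume "is_epi (Q_cat C) X Y (cls C Y (csA X) a)"
  then show "\<exists>z\<in>arr C (csA Y) (csA X). cls C Y (csA Y) (idn C (csA Y)) = cls C Y (csA Y) (cmp C (csA Y) (csA X) (csA Y) z a)"
    by (intro Q_epi_imp_split[OF X Y a, of "obj (Q_cat C)"]) (simp_all del: Q_obj, simp)
next
  note [simp] = X Y cospanD[OF X] cospanD[OF Y] a Aux_arrD[OF a]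
  assume "\<exists>z\<in>arr C (csA Y) (csA X). cls C Y (csA Y) (idn C (csA Y)) = cls C Y (csA Y) (cmp C (csA Y) (csA X) (csA Y) z a)"
  then obtain z where z: "z \<in> arr C (csA Y) (csA X)" "cls C Y (csA Y) (idn C (csA Y)) = cls C Y (csA Y) (cmp C (csA Y) (csA X) (csA Y) z a)"
    by blast
  show "is_epi (Q_cat C) X Y (cls C Y (csA X) a)"
    unfolding is_epi_def
  proof (intro conjI ballI impI)
    fix T g h assume "T \<in> obj (Q_cat C)" and g: "g \<in> arr (Q_cat C) Y T" and h: "h \<in> arr (Q_cat C) Y T"
      and eq: "cmp (Q_cat C) X Y T (cls C Y (csA X) a) g = cmp (Q_cat C) X Y T (cls C Y (csA X) a) h"
    then have T: "is_cospan C T" by simp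
    obtain g' where g': "g' \<in> arr (Aux C) Y T" "g = cls C T (csA Y) g'" using Q_arrE[OF Y T g] .
    obtain h' where h': "h' \<in> arr (Aux C) Y T" "h = cls C T (csA Y) h'" using Q_arrE[OF Y T h] .
    note [simp] = T cospanD[OF T] Aux_arrD[OF g'(1)] Aux_arrD[OF h'(1)] z(1) g'(1) h'(1)
    \<comment> \<open>Modulo syzygies of \<open>T\<close>, \<open>f\<close> equals
      \<open>z (a f)\<close> and is thus determined by \<open>a f\<close>.\<close>
    have key: "cls C T (csA Y) f = cls C T (csA Y) (cmp C (csA Y) (csA X) (csA T) z (cmp C (csA X) (csA Y) (csA T) a f))"
      if f: "f \<in> arr (Aux C) Y T" for f
      using cls_cmp_right[OF Y T _ _ _ f z(2)] Aux_arrD[OF f] by (simp add: cmp_assoc)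
    have "cls C T (csA Y) (cmp C (csA Y) (csA X) (csA T) z (cmp C (csA X) (csA Y) (csA T) a g'))
       = cls C T (csA Y) (cmp C (csA Y) (csA X) (csA T) z (cmp C (csA X) (csA Y) (csA T) a h'))"
      by (rule cls_cmp_left) (use eq in \<open>simp_all add: g'(2) h'(2) Q_cmp\<close>)
    then show "g = h" using key[OF g'(1)] key[OF h'(1)] by (simp add: g'(2) h'(2))
  qed (simp add: cls_in_Q)
qed

end

section \<open>Structure of the quotient category\<close>

text \<open>Essential uniqueness is not formal, as an epimorphism need not be orthogonal to
  monomorphisms. It is reduced to a diagonal filler, taken in both directions; cancelling the
  epimorphisms shows the two fillers to be inverse.\<close>

lemma (in preadditive_cat) has_epi_mono_factorizationsI:
  assumes ex: "\<And>A B f. \<lbrakk>A \<in> obj C; B \<in> obj C; f \<in> arr C A B\<rbrakk> \<Longrightarrow> \<exists>I e m. is_epi_mono_fact C A B f I e m"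
    and fill: "\<And>A B I J e m e' m'. \<lbrakk>A \<in> obj C; B \<in> obj C; I \<in> obj C; J \<in> obj C; is_epi C A I e; is_mono C I B m;
      is_epi C A J e'; is_mono C J B m'; cmp C A I B e m = cmp C A J B e' m'\<rbrakk>
      \<Longrightarrow> \<exists>t\<in>arr C I J. cmp C A I J e t = e' \<and> cmp C I J B t m' = m"
  shows "has_epi_mono_factorizations C"
  unfolding has_epi_mono_factorizations_def
proof (intro ballI conjI allI impI)
  fix A B f I e m J e' m'
  assume obj: "A \<in> obj C" "B \<in> obj C" and f: "f \<in> arr C A B"
    and 1: "is_epi_mono_fact C A B f I e m" and 2: "is_epi_mono_fact C A B f J e' m'"
  have I: "I \<in> obj C" "is_epi C A I e" "is_mono C I B m" and J: "J \<in> obj C" "is_epi C A J e'" "is_mono C J B m'"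
    and eq: "cmp C A I B e m = cmp C A J B e' m'"
    using 1 2 by (auto simp: is_epi_mono_fact_def)
  have ar: "e \<in> arr C A I" "e' \<in> arr C A J" using I J by (auto simp: is_epi_def)
  obtain t where t: "t \<in> arr C I J" "cmp C A I J e t = e'" "cmp C I J B t m' = m"
    using fill[OF obj I(1) J(1) I(2,3) J(2,3) eq] by blast
  obtain s where s: "s \<in> arr C J I" "cmp C A J I e' s = e" "cmp C J I B s m = m'"
    using fill[OF obj J(1) I(1) J(2,3) I(2,3) eq[symmetric]] by blast
  have "cmp C I J I t s = idn C I"
    using is_epiD[OF I(2), of I "cmp C I J I t s" "idn C I"] cmp_assoc[OF obj(1) I(1) J(1) I(1) ar(1) t(1) s(1)]
      I(1) J(1) obj(1) ar t(1,2) s(1,2) by simp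
  moreover have "cmp C J I J s t = idn C J"
    using is_epiD[OF J(2), of J "cmp C J I J s t" "idn C J"] cmp_assoc[OF obj(1) J(1) I(1) J(1) ar(2) s(1) t(1)]
      I(1) J(1) obj(1) ar t(1,2) s(1,2) by simp
  ultimately have "is_isomorphism C I J t" using t s by (auto simp: is_isomorphism_def)
  moreover have "t' = t" if "is_isomorphism C I J t' \<and> cmp C A I J e t' = e' \<and> cmp C I J B t' m' = m" for t'
    by (rule is_epiD[OF I(2) J(1)]) (use that t in \<open>auto simp: is_isomorphism_def\<close>)
  ultimately show "\<exists>!t. is_isomorphism C I J t \<and> cmp C A I J e t = e' \<and> cmp C I J B t m' = m"
    using t by blast
qed (rule ex)

context additive_cat
begin

lemma syz_of_cls_eq:
  "\<lbrakk>is_cospan C X; T \<in> obj C; cls C X T a = cls C X T b; b \<in> syz C X T; a \<in> arr C T (csA X)\<rbrakk> \<Longrightarrow> a \<in> syz C X T"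
  using syz_cong syz_arr by blast

text \<open>The identity of the common first object is a morphism of \<open>Aux\<close> both ways.
  Thus an object of Q(P) is determined by its first object and its syzygies.\<close>

lemma Q_isomorphic_cong:
  assumes X: "is_cospan C X" and Y: "is_cospan C Y" and eq: "csA Y = csA X"
    and syz: "\<And>T. T \<in> obj C \<Longrightarrow> syz C Y T = syz C X T"
  shows "isomorphic (Q_cat C) X Y"
proof -
  note [simp] = X Y cospanD[OF X] eq
  have a: "idn C (csA X) \<in> arr (Aux C) X Y" "idn C (csA X) \<in> arr (Aux C) Y X"
    by (auto simp: Aux_arr syz syz_arr)
  have "cls C Y T = cls C X T" if "T \<in> obj C" for T using that by (auto simp: cls_def syz)
  then show ?thesis
    unfolding isomorphic_def is_isomorphism_def
    using Q_cmp[OF X Y X a] Q_cmp[OF Y X Y a(2,1)] cls_in_Q[OF X Y a(1)] cls_in_Q[OF Y X a(2)]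
    by (auto simp: Q_idn intro!: exI[of _ "cls C Y (csA X) (idn C (csA X))"] bexI[of _ "cls C X (csA X) (idn C (csA X))"])
qed

lemma Q_zero_object: "\<exists>Z. is_zero_object (Q_cat C) Z"
proof -
  obtain Z where Z: "Z \<in> obj C" "idn C Z = zero_arr C Z Z" using ex_zero_object zero_object_iff by blast
  obtain X where X: "X \<in> presenting_cospans C" "csA X = Z" using free_cospan[OF Z(1)] by metis
  then have "is_cospan C X" by (simp add: presenting_cospansD)
  then have "is_zero_object (Q_cat C) X"
    using preadditive_cat.zero_object_iff[OF preadditive_Q, of X] X Z by (simp add: Q_idn Q_zero)
  then show ?thesis by blast
qed

lemma Q_biproduct:
  assumes X: "is_cospan C X" and Y: "is_cospan C Y"
  shows "\<exists>Z i j p q. is_biproduct (Q_cat C) X Y Z i j p q"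
proof -
  note [simp] = X Y cospanD[OF X] cospanD[OF Y]
  obtain S i j p q where b: "is_biproduct C (csA X) (csA Y) S i j p q"
    using ex_biproduct cospanD[OF X] cospanD[OF Y] by blast
  note [simp] = biproductD[OF b]
  \<comment> \<open>On the biproduct, the syzygies shall be the morphisms with both components
    syzygies: pull back along \<open>p\<close> and \<open>q\<close>, then intersect.\<close>
  obtain X' where X': "is_cospan C X'" "csA X' = S"
    "\<And>T s. \<lbrakk>T \<in> obj C; s \<in> arr C T S\<rbrakk> \<Longrightarrow> s \<in> syz C X' T \<longleftrightarrow> cmp C T S (csA X) s p \<in> syz C X T"
    by (rule pull_cospan[OF X, of S p]) auto
  obtain Y' where Y': "is_cospan C Y'" "csA Y' = S"
    "\<And>T s. \<lbrakk>T \<in> obj C; s \<in> arr C T S\<rbrakk> \<Longrightarrow> s \<in> syz C Y' T \<longleftrightarrow> cmp C T S (csA Y) s q \<in> syz C Y T"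
    by (rule pull_cospan[OF Y, of S q]) auto
  obtain Z where Z: "is_cospan C Z" "csA Z = S" "\<And>T. T \<in> obj C \<Longrightarrow> syz C Z T = syz C X' T \<inter> syz C Y' T"
    by (rule inter_cospan[OF X'(1) Y'(1)]) (auto simp: X' Y')
  have syzZ: "s \<in> syz C Z T \<longleftrightarrow> cmp C T S (csA X) s p \<in> syz C X T \<and> cmp C T S (csA Y) s q \<in> syz C Y T"
    if "T \<in> obj C" "s \<in> arr C T S" for T s
    using that Z(3) X'(3) Y'(3) by blast
  have i: "i \<in> arr (Aux C) X Z"
    by (auto simp: Aux_arr Z(2) syzZ syz_arr cmp_assoc syz_zero)
  have j: "j \<in> arr (Aux C) Y Z"
    by (auto simp: Aux_arr Z(2) syzZ syz_arr cmp_assoc syz_zero)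
  have p: "p \<in> arr (Aux C) Z X"
    using syzZ syz_arr[where X = Z] by (auto simp: Aux_arr Z(2))
  have q: "q \<in> arr (Aux C) Z Y"
    using syzZ syz_arr[where X = Z] by (auto simp: Aux_arr Z(2))
  note Q_cmp' = Q_cmp[OF Z(1) X Z(1) p i] Q_cmp[OF Z(1) Y Z(1) q j] Q_cmp[OF X Z(1) X i p] Q_cmp[OF X Z(1) Y i q]
    Q_cmp[OF Y Z(1) X j p] Q_cmp[OF Y Z(1) Y j q]
  have "is_biproduct (Q_cat C) X Y Z (cls C Z (csA X) i) (cls C Z (csA Y) j) (cls C X S p) (cls C Y S q)"
    unfolding is_biproduct_def
    using Q_cmp' cls_in_Q[OF X Z(1) i] cls_in_Q[OF Y Z(1) j] cls_in_Q[OF Z(1) X p] cls_in_Q[OF Z(1) Y q] Z(1)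
      Q_add[OF Z(1) Z(1) Aux_cmp[OF Z(1) X Z(1) p i] Aux_cmp[OF Z(1) Y Z(1) q j]]
    by (simp add: Z(2) Q_idn Q_zero)
  then show ?thesis by blast
qed

lemma additive_Q: "additive_cat (Q_cat C)"
  using preadditive_Q Q_zero_object Q_biproduct
  by (simp add: additive_cat_def additive_cat_axioms_def)

text \<open>The first object stays and the image of \<open>a\<close> is added to the syzygies. A
  morphism that annihilates \<open>a\<close> in the quotient carries the added syzygies to syzygies,
  so it is its own factorization through \<open>K\<close>.\<close>

lemma Q_cokernel:
  assumes X: "is_cospan C X" and Y: "is_cospan C Y" and a: "a \<in> arr (Aux C) X Y"
  obtains K where "is_cospan C K" "csA K = csA Y" "idn C (csA Y) \<in> arr (Aux C) Y K"
    "is_cokernel (Q_cat C) X Y (cls C Y (csA X) a) K (cls C K (csA Y) (idn C (csA Y)))"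
    "\<And>T s. \<lbrakk>T \<in> obj C; s \<in> arr C T (csA Y)\<rbrakk> \<Longrightarrow>
      s \<in> syz C K T \<longleftrightarrow> (\<exists>w\<in>arr C T (csA X). cls C Y T s = cls C Y T (cmp C T (csA X) (csA Y) w a))"
proof -
  note [simp] = X Y cospanD[OF X] cospanD[OF Y] a Aux_arrD[OF a]
  obtain K where K: "is_cospan C K" "csA K = csA Y" and
    syzK: "\<And>T s. \<lbrakk>T \<in> obj C; s \<in> arr C T (csA Y)\<rbrakk> \<Longrightarrow>
      s \<in> syz C K T \<longleftrightarrow> (\<exists>w\<in>arr C T (csA X). cls C Y T s = cls C Y T (cmp C T (csA X) (csA Y) w a))"
    and YK: "\<And>T. T \<in> obj C \<Longrightarrow> syz C Y T \<subseteq> syz C K T"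
    by (rule coker_cospan[OF Y cospanD(1)[OF X] Aux_arrD[OF a]]) blast
  have id: "idn C (csA Y) \<in> arr (Aux C) Y K" using YK by (auto simp: Aux_arr K syz_arr)
  have aK: "a \<in> syz C K (csA X)"
    using syzK[of "csA X" a] bexI[of _ "idn C (csA X)"] by simp
  have "is_cokernel (Q_cat C) X Y (cls C Y (csA X) a) K (cls C K (csA Y) (idn C (csA Y)))"
  proof (rule preadditive_cat.cokernelI[OF preadditive_Q])
    show "is_epi (Q_cat C) Y K (cls C K (csA Y) (idn C (csA Y)))"
      unfolding Q_epi_iff[OF Y K(1) id] by (auto simp: K(2) intro!: bexI[of _ "idn C (csA Y)"])
    show "cmp (Q_cat C) X Y K (cls C Y (csA X) a) (cls C K (csA Y) (idn C (csA Y))) = zero_arr (Q_cat C) X K"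
      using Q_cmp[OF X Y K(1) a id] aK by (simp add: K Q_eq_zero_iff)
    fix T V assume "T \<in> obj (Q_cat C)" and V: "V \<in> arr (Q_cat C) Y T"
      "cmp (Q_cat C) X Y T (cls C Y (csA X) a) V = zero_arr (Q_cat C) X T"
    then have T: "is_cospan C T" by simp
    obtain v where v: "v \<in> arr (Aux C) Y T" "V = cls C T (csA Y) v" using Q_arrE[OF Y T V(1)] .
    note [simp] = T cospanD[OF T] v(1) Aux_arrD[OF v(1)]
    have av: "cmp C (csA X) (csA Y) (csA T) a v \<in> syz C T (csA X)"
      using V(2) by (simp add: v(2) Q_cmp Q_eq_zero_iff)
    have vK: "v \<in> arr (Aux C) K T"
      unfolding Aux_arr
    proof (intro conjI ballI)
      fix U s assume U: "U \<in> obj C" and s: "s \<in> syz C K U"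
      have s': "s \<in> arr C U (csA Y)" using syz_arr[OF s] K by simp
      obtain w where w: "w \<in> arr C U (csA X)" "cls C Y U s = cls C Y U (cmp C U (csA X) (csA Y) w a)"
        using syzK[OF U s'] s by blast
      have "cls C T U (cmp C U (csA Y) (csA T) s v) = cls C T U (cmp C U (csA X) (csA T) w (cmp C (csA X) (csA Y) (csA T) a v))"
        using cls_cmp_right[OF Y T U s' _ v(1) w(2)] U w by (simp add: cmp_assoc)
      moreover have "cmp C U (csA X) (csA T) w (cmp C (csA X) (csA Y) (csA T) a v) \<in> syz C T U"
        by (rule syz_cmp[OF T _ U av w(1)]) simp
      ultimately show "cmp C U (csA K) (csA T) s v \<in> syz C T U"
        using syz_of_cls_eq[OF T U] U s' w by (simp add: K)
    qed (simp add: K)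
    then show "\<exists>W\<in>arr (Q_cat C) K T. V = cmp (Q_cat C) Y K T (cls C K (csA Y) (idn C (csA Y))) W"
      using cls_in_Q[OF K(1) T vK] Q_cmp[OF Y K(1) T id vK] by (auto simp: K v(2))
  qed (simp add: K)
  then show thesis using that K id syzK by blast
qed

lemma Q_has_cokernels: "has_cokernels (Q_cat C)"
  unfolding has_cokernels_def
proof (intro ballI)
  fix X Y f assume "X \<in> obj (Q_cat C)" "Y \<in> obj (Q_cat C)" and f: "f \<in> arr (Q_cat C) X Y"
  then have X: "is_cospan C X" and Y: "is_cospan C Y" by auto
  obtain a where a: "a \<in> arr (Aux C) X Y" "f = cls C Y (csA X) a" using Q_arrE[OF X Y f] .
  show "\<exists>K k. is_cokernel (Q_cat C) X Y f K k"
    by (rule Q_cokernel[OF X Y a(1)]) (auto simp: a(2))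
qed

text \<open>A monomorphism is the kernel of its cokernel: if \<open>v\<close> vanishes in
  \<open>K\<close>, then \<open>v = w m\<close> modulo syzygies, and injectivity of \<open>m\<close>
  forces \<open>w\<close>, so far a mere morphism of \<open>C\<close>, to respect syzygies.\<close>

lemma Q_mono_normal:
  assumes X: "is_cospan C X" and Y: "is_cospan C Y" and mono: "is_mono (Q_cat C) X Y M"
  shows "\<exists>K\<in>obj (Q_cat C). \<exists>g\<in>arr (Q_cat C) Y K. is_kernel (Q_cat C) Y K g X M"
proof -
  have "M \<in> arr (Q_cat C) X Y" using mono by (simp add: is_mono_def)
  then obtain m where m: "m \<in> arr (Aux C) X Y" "M = cls C Y (csA X) m" using Q_arrE[OF X Y] by blast
  note [simp] = X Y cospanD[OF X] cospanD[OF Y] m(1) Aux_arrD[OF m(1)]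
  have pw: "pw_mono C X Y m" using mono by (simp add: m(2) Q_mono_iff)
  obtain K where K: "is_cospan C K" "csA K = csA Y" and id: "idn C (csA Y) \<in> arr (Aux C) Y K"
    and syzK: "\<And>T s. \<lbrakk>T \<in> obj C; s \<in> arr C T (csA Y)\<rbrakk> \<Longrightarrow>
      s \<in> syz C K T \<longleftrightarrow> (\<exists>w\<in>arr C T (csA X). cls C Y T s = cls C Y T (cmp C T (csA X) (csA Y) w m))"
    by (rule Q_cokernel[OF X Y m(1)]) blast
  have mK: "m \<in> syz C K (csA X)"
    using syzK[of "csA X" m] bexI[of _ "idn C (csA X)"] by simp
  have "is_kernel (Q_cat C) Y K (cls C K (csA Y) (idn C (csA Y))) X M"
  proof (rule preadditive_cat.kernelI[OF preadditive_Q])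
    show "cmp (Q_cat C) X Y K M (cls C K (csA Y) (idn C (csA Y))) = zero_arr (Q_cat C) X K"
      using Q_cmp[OF X Y K(1) m(1) id] mK by (simp add: m(2) K Q_eq_zero_iff)
    fix T V assume "T \<in> obj (Q_cat C)" and V: "V \<in> arr (Q_cat C) T Y"
      "cmp (Q_cat C) T Y K V (cls C K (csA Y) (idn C (csA Y))) = zero_arr (Q_cat C) T K"
    then have T: "is_cospan C T" by simp
    obtain v where v: "v \<in> arr (Aux C) T Y" "V = cls C Y (csA T) v" using Q_arrE[OF T Y V(1)] .
    note [simp] = T cospanD[OF T] v(1) Aux_arrD[OF v(1)]
    have "v \<in> syz C K (csA T)"
      using V(2) Q_cmp[OF T Y K(1) v(1) id] by (simp add: v(2) Q_eq_zero_iff K)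
    then obtain w where w: "w \<in> arr C (csA T) (csA X)" "cls C Y (csA T) v = cls C Y (csA T) (cmp C (csA T) (csA X) (csA Y) w m)"
      using syzK by auto
    have "w \<in> arr (Aux C) T X"
      unfolding Aux_arr
    proof (intro conjI ballI)
      fix U s assume U: "U \<in> obj C" and s: "s \<in> syz C T U"
      note s' = syz_arr[OF s]
      have "cls C Y U (cmp C U (csA T) (csA Y) s v) = cls C Y U (cmp C U (csA T) (csA Y) s (cmp C (csA T) (csA X) (csA Y) w m))"
        by (rule cls_cmp_left) (use U s' w in simp_all)
      moreover have "cmp C U (csA T) (csA Y) s v \<in> syz C Y U" using Aux_arr_syz[OF v(1) U s] .
      ultimately have "cmp C U (csA T) (csA Y) s (cmp C (csA T) (csA X) (csA Y) w m) \<in> syz C Y U"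
        by (rule syz_of_cls_eq[OF Y U sym]) (use U s' w(1) in simp)
      then show "cmp C U (csA T) (csA X) s w \<in> syz C X U"
        using pw U s' w unfolding pw_mono_def by (simp add: cmp_assoc)
    qed (rule w)
    then show "\<exists>W\<in>arr (Q_cat C) T X. V = cmp (Q_cat C) T X Y W M"
      using w cls_in_Q[OF T X] Q_cmp[OF T X Y _ m(1)] by (auto simp: v(2) m(2) intro!: bexI[of _ "cls C X (csA T) w"])
  qed (use mono in simp_all)
  then show ?thesis using cls_in_Q[OF Y K(1) id] K(1) by auto
qed

lemma Q_has_epi_mono_factorizations: "has_epi_mono_factorizations (Q_cat C)"
proof (rule preadditive_cat.has_epi_mono_factorizationsI[OF preadditive_Q])
  fix X Y f assume "X \<in> obj (Q_cat C)" "Y \<in> obj (Q_cat C)" and f: "f \<in> arr (Q_cat C) X Y"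
  then have X: "is_cospan C X" and Y: "is_cospan C Y" by auto
  obtain a where a: "a \<in> arr (Aux C) X Y" "f = cls C Y (csA X) a" using Q_arrE[OF X Y f] .
  note [simp] = X Y cospanD[OF X] cospanD[OF Y] a(1) Aux_arrD[OF a(1)]
  \<comment> \<open>The image keeps the first object of \<open>X\<close> and takes as syzygies all
    \<open>s\<close> with \<open>s a\<close> a syzygy of \<open>Y\<close>. The identity maps
    \<open>X\<close> onto it and \<open>a\<close> embeds it in \<open>Y\<close>.\<close>
  obtain I where I: "is_cospan C I" "csA I = csA X"
    and syzI: "\<And>T s. \<lbrakk>T \<in> obj C; s \<in> arr C T (csA X)\<rbrakk> \<Longrightarrow> s \<in> syz C I T \<longleftrightarrow> cmp C T (csA X) (csA Y) s a \<in> syz C Y T"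
    by (rule pull_cospan[OF Y cospanD(1)[OF X] Aux_arrD[OF a(1)]]) blast
  have e: "idn C (csA X) \<in> arr (Aux C) X I"
    using syzI a(1) by (auto simp: Aux_arr I(2) syz_arr)
  have m: "a \<in> arr (Aux C) I Y" using syzI syz_arr[where X = I] by (auto simp: Aux_arr I(2))
  have "is_epi (Q_cat C) X I (cls C I (csA X) (idn C (csA X)))"
    unfolding Q_epi_iff[OF X I(1) e] by (auto simp: I(2) intro!: bexI[of _ "idn C (csA X)"])
  moreover have "is_mono (Q_cat C) I Y (cls C Y (csA X) a)"
    using Q_mono_iff[OF I(1) Y m] syzI by (auto simp: I(2) pw_mono_def)
  moreover have "f = cmp (Q_cat C) X I Y (cls C I (csA X) (idn C (csA X))) (cls C Y (csA X) a)"
    using Q_cmp[OF X I(1) Y e m] by (simp add: I(2) a(2))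
  ultimately show "\<exists>I e m. is_epi_mono_fact (Q_cat C) X Y f I e m"
    unfolding is_epi_mono_fact_def using I(1) by auto
next
  fix X Y I J E M E' M'
  assume "X \<in> obj (Q_cat C)" "Y \<in> obj (Q_cat C)" "I \<in> obj (Q_cat C)" "J \<in> obj (Q_cat C)"
    and E: "is_epi (Q_cat C) X I E" and M: "is_mono (Q_cat C) I Y M"
    and E': "is_epi (Q_cat C) X J E'" and M': "is_mono (Q_cat C) J Y M'"
    and eq: "cmp (Q_cat C) X I Y E M = cmp (Q_cat C) X J Y E' M'"
  then have X: "is_cospan C X" and Y: "is_cospan C Y" and I: "is_cospan C I" and J: "is_cospan C J" by auto
  obtain e where e: "e \<in> arr (Aux C) X I" "E = cls C I (csA X) e" using Q_arrE[OF X I] E by (auto simp: is_epi_def)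
  obtain e' where e': "e' \<in> arr (Aux C) X J" "E' = cls C J (csA X) e'" using Q_arrE[OF X J] E' by (auto simp: is_epi_def)
  obtain m where m: "m \<in> arr (Aux C) I Y" "M = cls C Y (csA I) m" using Q_arrE[OF I Y] M by (auto simp: is_mono_def)
  obtain m' where m': "m' \<in> arr (Aux C) J Y" "M' = cls C Y (csA J) m'" using Q_arrE[OF J Y] M' by (auto simp: is_mono_def)
  note [simp] = X Y I J cospanD[OF X] cospanD[OF Y] cospanD[OF I] cospanD[OF J]
    e(1) Aux_arrD[OF e(1)] e'(1) Aux_arrD[OF e'(1)] m(1) Aux_arrD[OF m(1)] m'(1) Aux_arrD[OF m'(1)]
  obtain z where z [simp]: "z \<in> arr C (csA I) (csA X)"
    and ze: "cls C I (csA I) (idn C (csA I)) = cls C I (csA I) (cmp C (csA I) (csA X) (csA I) z e)"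
    using E Q_epi_iff[OF X I e(1)] by (auto simp: e(2))
  have pw: "pw_mono C J Y m'" using M' Q_mono_iff[OF J Y m'(1)] by (simp add: m'(2))
  have em: "cls C Y (csA X) (cmp C (csA X) (csA I) (csA Y) e m) = cls C Y (csA X) (cmp C (csA X) (csA J) (csA Y) e' m')"
    using eq by (simp add: e(2) m(2) e'(2) m'(2) Q_cmp)
  \<comment> \<open>The filler goes back along the splitting \<open>z\<close> of \<open>e\<close>
    and on by \<open>e'\<close>. As \<open>m'\<close> is injective, both that \<open>?t\<close>
    respects syzygies and that \<open>e ?t = e'\<close> can be checked after composing with
    \<open>m'\<close>.\<close>
  let ?t = "cmp C (csA I) (csA X) (csA J) z e'"
  have tm: "cls C Y (csA I) (cmp C (csA I) (csA J) (csA Y) ?t m') = cls C Y (csA I) m"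
  proof -
    have "cls C Y (csA I) (cmp C (csA I) (csA J) (csA Y) ?t m')
      = cls C Y (csA I) (cmp C (csA I) (csA X) (csA Y) z (cmp C (csA X) (csA J) (csA Y) e' m'))"
      by (simp add: cmp_assoc)
    also have "\<dots> = cls C Y (csA I) (cmp C (csA I) (csA X) (csA Y) z (cmp C (csA X) (csA I) (csA Y) e m))"
      by (rule cls_cmp_left) (use em in simp_all)
    also have "\<dots> = cls C Y (csA I) m"
      using cls_cmp_right[OF I Y _ _ _ m(1) ze] by (simp add: cmp_assoc)
    finally show ?thesis .
  qed
  have t: "?t \<in> arr (Aux C) I J"
    unfolding Aux_arr
  proof (intro conjI ballI)
    fix U s assume U: "U \<in> obj C" and s: "s \<in> syz C I U"
    note s' = syz_arr[OF s]
    have "cls C Y U (cmp C U (csA I) (csA Y) s (cmp C (csA I) (csA J) (csA Y) ?t m')) = cls C Y U (cmp C U (csA I) (csA Y) s m)"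
      by (rule cls_cmp_left) (use U s' tm in simp_all)
    then have "cmp C U (csA I) (csA Y) s (cmp C (csA I) (csA J) (csA Y) ?t m') \<in> syz C Y U"
      using syz_of_cls_eq[OF Y U _ Aux_arr_syz[OF m(1) U s]] U s' by simp
    then have "cmp C U (csA J) (csA Y) (cmp C U (csA I) (csA J) s ?t) m' \<in> syz C Y U"
      using U s' by (simp add: cmp_assoc)
    then show "cmp C U (csA I) (csA J) s ?t \<in> syz C J U"
      using pw U s' unfolding pw_mono_def by simp
  qed simp
  have "cls C J (csA X) (cmp C (csA X) (csA I) (csA J) e ?t) = cls C J (csA X) e'"
  proof (rule pw_mono_cls[OF J Y _ pw])
    have "cls C Y (csA X) (cmp C (csA X) (csA I) (csA Y) e (cmp C (csA I) (csA J) (csA Y) ?t m')) = cls C Y (csA X) (cmp C (csA X) (csA I) (csA Y) e m)"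
      by (rule cls_cmp_left) (use tm in simp_all)
    then show "cls C Y (csA X) (cmp C (csA X) (csA J) (csA Y) (cmp C (csA X) (csA I) (csA J) e ?t) m')
      = cls C Y (csA X) (cmp C (csA X) (csA J) (csA Y) e' m')"
      using em by (simp add: cmp_assoc)
  qed simp_all
  then show "\<exists>t\<in>arr (Q_cat C) I J. cmp (Q_cat C) X I J E t = E' \<and> cmp (Q_cat C) I J Y t M' = M"
    using t tm cls_in_Q[OF I J t] Q_cmp[OF X I J e(1) t] Q_cmp[OF I J Y t m'(1)]
    by (intro bexI[of _ "cls C J (csA I) ?t"]) (simp_all add: e(2) e'(2) m(2) m'(2))
qed

end

section \<open>Weak kernels\<close>

context additive_cat
begin

section \<open>From weak kernels to an abelian Q(P)\<close>

lemma presenting_rho: "X \<in> presenting_cospans C \<Longrightarrow> rho X \<in> arr C (csR X) (csA X)"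
  by (auto simp: presenting_cospans_def is_cospan_def)

lemma weak_kernelD:
  assumes "is_weak_kernel C A B f K k"
  shows "K \<in> obj C" "k \<in> arr C K A" "cmp C K A B k f = zero_arr C K B"
    "\<And>T t. \<lbrakk>T \<in> obj C; t \<in> arr C T A; cmp C T A B t f = zero_arr C T B\<rbrakk> \<Longrightarrow> \<exists>u\<in>arr C T K. t = cmp C T K A u k"
  using assms unfolding is_weak_kernel_def by auto

text \<open>Pairs (t, w) with \<open>t a gamma = w rho\<close> are the morphisms annihilated by a
  difference map on the biproduct of \<open>A\<close> and \<open>csR Y\<close>. Its weak kernel,
  projected to \<open>A\<close>, generates the subfunctor of syzygies pulled back along
  \<open>a\<close>. Every use of weak kernels as an assumption passes through here.\<close>

lemma weak_pullback:
  assumes wk: "has_weak_kernels C" and Y: "is_cospan C Y" and A: "A \<in> obj C" and a: "a \<in> arr C A (csA Y)"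
  obtains K k where "K \<in> obj C" "k \<in> arr C K A"
    "\<And>T t. \<lbrakk>T \<in> obj C; t \<in> arr C T A\<rbrakk> \<Longrightarrow> cmp C T A (csA Y) t a \<in> syz C Y T \<longleftrightarrow> (\<exists>w\<in>arr C T K. t = cmp C T K A w k)"
proof -
  note [simp] = cospanD[OF Y] A a
  obtain S i j p q where b: "is_biproduct C A (csR Y) S i j p q" using ex_biproduct A cospanD(3)[OF Y] by blast
  note [simp] = biproductD(1-5)[OF b]
  let ?l = "cmp C A (csA Y) (csO Y) a (gam Y)"
  let ?h = "cmp C S A (csO Y) p ?l \<otimes>\<^bsub>homg C S (csO Y)\<^esub> inv\<^bsub>homg C S (csO Y)\<^esub> cmp C S (csR Y) (csO Y) q (rho Y)"
  have h: "cmp C T S (csO Y) v ?h = zero_arr C T (csO Y) \<longleftrightarrow>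
      cmp C T A (csO Y) (cmp C T S A v p) ?l = cmp C T (csR Y) (csO Y) (cmp C T S (csR Y) v q) (rho Y)"
    if "T \<in> obj C" "v \<in> arr C T S" for T v
  proof -
    interpret G: comm_group "homg C T (csO Y)" using that by (simp add: hom_comm_group)
    show ?thesis using that by (simp add: cmp_add_right cmp_neg_right cmp_assoc G.inv_solve_right')
  qed
  obtain K k where wk: "is_weak_kernel C S (csO Y) ?h K k"
  proof -
    have "?h \<in> arr C S (csO Y)" by simp
    then show thesis using wk that unfolding has_weak_kernels_def by (metis biproductD(1)[OF b] cospanD(2)[OF Y])
  qed
  note [simp] = weak_kernelD(1,2)[OF wk]
  have kh: "cmp C K A (csO Y) (cmp C K S A k p) ?l = cmp C K (csR Y) (csO Y) (cmp C K S (csR Y) k q) (rho Y)"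
    using h[of K k] weak_kernelD(3)[OF wk] by simp
  show thesis
  proof (rule that[of K "cmp C K S A k p"])
    fix T t assume T: "T \<in> obj C" and t: "t \<in> arr C T A"
    show "cmp C T A (csA Y) t a \<in> syz C Y T \<longleftrightarrow> (\<exists>w\<in>arr C T K. t = cmp C T K A w (cmp C K S A k p))"
    proof
      assume "cmp C T A (csA Y) t a \<in> syz C Y T"
      then obtain w where w: "w \<in> arr C T (csR Y)" "cmp C T A (csO Y) t ?l = cmp C T (csR Y) (csO Y) w (rho Y)"
        using T t by (auto simp: syz_def cmp_assoc)
      obtain v where v: "v \<in> arr C T S" "cmp C T S A v p = t" "cmp C T S (csR Y) v q = w"
        by (rule biproduct_pair[OF b _ _ T t w(1)]) simp_all
      then have "cmp C T S (csO Y) v ?h = zero_arr C T (csO Y)" using h[OF T] w by simp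
      then obtain u where "u \<in> arr C T K" "v = cmp C T K S u k" using weak_kernelD(4)[OF wk T v(1)] by blast
      then show "\<exists>w\<in>arr C T K. t = cmp C T K A w (cmp C K S A k p)"
        using T v by (auto simp: cmp_assoc intro!: bexI[of _ u])
    next
      assume "\<exists>w\<in>arr C T K. t = cmp C T K A w (cmp C K S A k p)"
      then obtain w where w: "w \<in> arr C T K" "t = cmp C T K A w (cmp C K S A k p)" by blast
      have "cmp C T A (csO Y) t ?l = cmp C T K (csO Y) w (cmp C K A (csO Y) (cmp C K S A k p) ?l)"
        using w T by (simp add: cmp_assoc)
      also have "\<dots> = cmp C T (csR Y) (csO Y) (cmp C T K (csR Y) w (cmp C K S (csR Y) k q)) (rho Y)"
        unfolding kh using w T by (simp add: cmp_assoc)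
      finally show "cmp C T A (csA Y) t a \<in> syz C Y T"
        unfolding syz_def using T t w(1) by (auto simp: cmp_assoc intro!: bexI[of _ "cmp C T K (csR Y) w (cmp C K S (csR Y) k q)"])
    qed
  qed simp_all
qed

text \<open>The weak pullback supplies lifts without uniqueness. Giving its source the syzygies
  pulled back along \<open>k\<close> makes \<open>k\<close> injective, so two lifts agree modulo
  syzygies.\<close>

lemma Q_kernel:
  assumes wk: "has_weak_kernels C" and X: "is_cospan C X" and Y: "is_cospan C Y" and a: "a \<in> arr (Aux C) X Y"
  obtains Z k where "is_cospan C Z" "k \<in> arr (Aux C) Z X" "is_kernel (Q_cat C) X Y (cls C Y (csA X) a) Z (cls C X (csA Z) k)"
    "\<And>T t. \<lbrakk>T \<in> obj C; t \<in> arr C T (csA X)\<rbrakk> \<Longrightarrow>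
      cmp C T (csA X) (csA Y) t a \<in> syz C Y T \<longleftrightarrow> (\<exists>w\<in>arr C T (csA Z). t = cmp C T (csA Z) (csA X) w k)"
proof -
  note [simp] = X Y cospanD[OF X] cospanD[OF Y] a Aux_arrD[OF a]
  obtain K k where K: "K \<in> obj C" "k \<in> arr C K (csA X)"
    and kY: "\<And>T t. \<lbrakk>T \<in> obj C; t \<in> arr C T (csA X)\<rbrakk> \<Longrightarrow>
      cmp C T (csA X) (csA Y) t a \<in> syz C Y T \<longleftrightarrow> (\<exists>w\<in>arr C T K. t = cmp C T K (csA X) w k)"
    by (rule weak_pullback[OF wk Y cospanD(1)[OF X] Aux_arrD[OF a]]) blast
  obtain Z where Z: "is_cospan C Z" "csA Z = K"
    and syzZ: "\<And>T s. \<lbrakk>T \<in> obj C; s \<in> arr C T K\<rbrakk> \<Longrightarrow> s \<in> syz C Z T \<longleftrightarrow> cmp C T K (csA X) s k \<in> syz C X T"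
    by (rule pull_cospan[OF X K]) blast
  note [simp] = K Z
  have k: "k \<in> arr (Aux C) Z X" using syzZ syz_arr[where X = Z] by (auto simp: Aux_arr)
  have "is_kernel (Q_cat C) X Y (cls C Y (csA X) a) Z (cls C X (csA Z) k)"
  proof (rule preadditive_cat.kernelI[OF preadditive_Q])
    show "is_mono (Q_cat C) Z X (cls C X (csA Z) k)"
      unfolding Q_mono_iff[OF Z(1) X k] using syzZ by (simp add: pw_mono_def)
    have "cmp C K (csA X) (csA Y) k a \<in> syz C Y K"
      using kY[of K k] by (auto intro!: bexI[of _ "idn C K"])
    then show "cmp (Q_cat C) Z X Y (cls C X (csA Z) k) (cls C Y (csA X) a) = zero_arr (Q_cat C) Z Y"
      by (simp add: Q_cmp[OF Z(1) X Y k a, simplified] Q_eq_zero_iff[OF Z(1), simplified])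
    fix T V assume "T \<in> obj (Q_cat C)" and V: "V \<in> arr (Q_cat C) T X"
      "cmp (Q_cat C) T X Y V (cls C Y (csA X) a) = zero_arr (Q_cat C) T Y"
    then have T: "is_cospan C T" by simp
    obtain v where v: "v \<in> arr (Aux C) T X" "V = cls C X (csA T) v" using Q_arrE[OF T X V(1)] .
    note [simp] = T cospanD[OF T] v(1) Aux_arrD[OF v(1)]
    have "cmp C (csA T) (csA X) (csA Y) v a \<in> syz C Y (csA T)"
      using V(2) by (simp add: v(2) Q_cmp Q_eq_zero_iff)
    then obtain w where w: "w \<in> arr C (csA T) K" "v = cmp C (csA T) K (csA X) w k"
      using kY by auto
    have "w \<in> arr (Aux C) T Z"
      unfolding Aux_arr
    proof (intro conjI ballI)
      fix U s assume U: "U \<in> obj C" and s: "s \<in> syz C T U"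
      have "cmp C U (csA T) (csA X) s v \<in> syz C X U" using Aux_arr_syz[OF v(1) U s] .
      then show "cmp C U (csA T) (csA Z) s w \<in> syz C Z U"
        using syzZ U syz_arr[OF s] w by (simp add: cmp_assoc)
    qed (use w in simp)
    then show "\<exists>W\<in>arr (Q_cat C) T Z. V = cmp (Q_cat C) T Z X W (cls C X (csA Z) k)"
      using w cls_in_Q[OF T Z(1)] Q_cmp[OF T Z(1) X _ k] by (auto simp: v(2) intro!: bexI[of _ "cls C Z (csA T) w"])
  qed simp
  then show thesis using that[OF Z(1) k] kY by simp
qed

lemma Q_has_kernels:
  assumes "has_weak_kernels C" shows "has_kernels (Q_cat C)"
  unfolding has_kernels_def
proof (intro ballI)
  fix X Y f assume "X \<in> obj (Q_cat C)" "Y \<in> obj (Q_cat C)" and f: "f \<in> arr (Q_cat C) X Y"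
  then have X: "is_cospan C X" and Y: "is_cospan C Y" by auto
  obtain a where a: "a \<in> arr (Aux C) X Y" "f = cls C Y (csA X) a" using Q_arrE[OF X Y f] .
  show "\<exists>K k. is_kernel (Q_cat C) X Y f K k"
    by (rule Q_kernel[OF assms X Y a(1)]) (auto simp: a(2))
qed

text \<open>An epimorphism is the cokernel of its kernel: a \<open>v\<close> that annihilates the
  kernel factors through \<open>e\<close> by \<open>z v\<close>, where \<open>z\<close> splits
  \<open>e\<close> modulo syzygies.\<close>

lemma Q_epi_conormal:
  assumes wk: "has_weak_kernels C" and X: "is_cospan C X" and Y: "is_cospan C Y" and epi: "is_epi (Q_cat C) X Y E"
  shows "\<exists>K\<in>obj (Q_cat C). \<exists>g\<in>arr (Q_cat C) K X. is_cokernel (Q_cat C) K X g Y E"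
proof -
  have "E \<in> arr (Q_cat C) X Y" using epi by (simp add: is_epi_def)
  then obtain e where e: "e \<in> arr (Aux C) X Y" "E = cls C Y (csA X) e" using Q_arrE[OF X Y] by blast
  note [simp] = X Y cospanD[OF X] cospanD[OF Y] e(1) Aux_arrD[OF e(1)]
  obtain z where z [simp]: "z \<in> arr C (csA Y) (csA X)"
    and ze: "cls C Y (csA Y) (idn C (csA Y)) = cls C Y (csA Y) (cmp C (csA Y) (csA X) (csA Y) z e)"
    using epi Q_epi_iff[OF X Y e(1)] by (auto simp: e(2))
  obtain Z k where Z: "is_cospan C Z" and k: "k \<in> arr (Aux C) Z X"
    and ker: "is_kernel (Q_cat C) X Y (cls C Y (csA X) e) Z (cls C X (csA Z) k)"
    and kZ: "\<And>T t. \<lbrakk>T \<in> obj C; t \<in> arr C T (csA X)\<rbrakk> \<Longrightarrow>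
      cmp C T (csA X) (csA Y) t e \<in> syz C Y T \<longleftrightarrow> (\<exists>w\<in>arr C T (csA Z). t = cmp C T (csA Z) (csA X) w k)"
    by (rule Q_kernel[OF wk X Y e(1)]) blast
  note [simp] = Z cospanD[OF Z] k Aux_arrD[OF k]
  have "is_cokernel (Q_cat C) Z X (cls C X (csA Z) k) Y E"
  proof (rule preadditive_cat.cokernelI[OF preadditive_Q])
    show "cmp (Q_cat C) Z X Y (cls C X (csA Z) k) E = zero_arr (Q_cat C) Z Y"
      using preadditive_cat.kernelD(3)[OF preadditive_Q ker] e(2) by simp
    fix T V assume "T \<in> obj (Q_cat C)" and V: "V \<in> arr (Q_cat C) X T"
      "cmp (Q_cat C) Z X T (cls C X (csA Z) k) V = zero_arr (Q_cat C) Z T"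
    then have T: "is_cospan C T" by simp
    obtain v where v: "v \<in> arr (Aux C) X T" "V = cls C T (csA X) v" using Q_arrE[OF X T V(1)] .
    note [simp] = T cospanD[OF T] v(1) Aux_arrD[OF v(1)]
    have kv: "cmp C (csA Z) (csA X) (csA T) k v \<in> syz C T (csA Z)"
      using V(2) by (simp add: v(2) Q_cmp Q_eq_zero_iff)
    \<comment> \<open>What \<open>e\<close> sends into the syzygies of \<open>Y\<close> factors
      through \<open>k\<close>, hence \<open>v\<close> sends it into the syzygies of
      \<open>T\<close>. Both the syzygy condition on \<open>z v\<close> and the equation
      \<open>v = e z v\<close> are instances of this.\<close>
    have kills: "cmp C U (csA X) (csA T) t v \<in> syz C T U"
      if U: "U \<in> obj C" and t: "t \<in> arr C U (csA X)" "cmp C U (csA X) (csA Y) t e \<in> syz C Y U" for U t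
    proof -
      obtain w where w: "w \<in> arr C U (csA Z)" "t = cmp C U (csA Z) (csA X) w k" using kZ[OF U t(1)] t(2) by blast
      show ?thesis using syz_cmp[OF T _ U kv w(1)] w U by (simp add: cmp_assoc)
    qed
    let ?w = "cmp C (csA Y) (csA X) (csA T) z v"
    have w: "?w \<in> arr (Aux C) Y T"
      unfolding Aux_arr
    proof (intro conjI ballI)
      fix U s assume U: "U \<in> obj C" and s: "s \<in> syz C Y U"
      note s' = syz_arr[OF s]
      have "cls C Y U (cmp C U (csA Y) (csA Y) s (idn C (csA Y))) = cls C Y U (cmp C U (csA Y) (csA Y) s (cmp C (csA Y) (csA X) (csA Y) z e))"
        by (rule cls_cmp_left) (use U s' ze in simp_all)
      then have "cls C Y U (cmp C U (csA X) (csA Y) (cmp C U (csA Y) (csA X) s z) e) = cls C Y U s"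
        using U s' by (simp add: cmp_assoc)
      from syz_of_cls_eq[OF Y U this s] have "cmp C U (csA X) (csA Y) (cmp C U (csA Y) (csA X) s z) e \<in> syz C Y U"
        using U s' by simp
      from kills[OF U _ this] show "cmp C U (csA Y) (csA T) s ?w \<in> syz C T U"
        using U s' by (simp add: cmp_assoc)
    qed simp
    have "cls C T (csA X) v = cls C T (csA X) (cmp C (csA X) (csA Y) (csA T) e ?w)"
    proof -
      let ?ez = "cmp C (csA X) (csA Y) (csA X) e z"
      \<comment> \<open>\<open>1 - e z\<close> is sent by \<open>e\<close> into the syzygies of
        \<open>Y\<close>, because \<open>e = e z e\<close> modulo them.\<close>
      let ?d = "idn C (csA X) \<otimes>\<^bsub>homg C (csA X) (csA X)\<^esub> inv\<^bsub>homg C (csA X) (csA X)\<^esub> ?ez"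
      have "cls C Y (csA X) (cmp C (csA X) (csA Y) (csA Y) e (idn C (csA Y))) = cls C Y (csA X) (cmp C (csA X) (csA Y) (csA Y) e (cmp C (csA Y) (csA X) (csA Y) z e))"
        by (rule cls_cmp_left) (use ze in simp_all)
      then have "cmp C (csA X) (csA X) (csA Y) ?d e \<in> syz C Y (csA X)"
        by (simp add: cmp_add_left cmp_neg_left cls_eq_iff cmp_assoc)
      from kills[OF _ _ this] show ?thesis
        by (simp add: cmp_add_left cmp_neg_left cls_eq_iff cmp_assoc)
    qed
    then show "\<exists>W\<in>arr (Q_cat C) Y T. V = cmp (Q_cat C) X Y T E W"
      using cls_in_Q[OF Y T w] Q_cmp[OF X Y T e(1) w] by (auto simp: v(2) e(2) intro!: bexI[of _ "cls C T (csA Y) ?w"])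
  qed (use epi in simp_all)
  then show ?thesis
    using cls_in_Q[OF Z X k] Z by (intro bexI[of _ Z] bexI[of _ "cls C X (csA Z) k"]) simp_all
qed

lemma abelian_Q:
  assumes "has_weak_kernels C" shows "abelian_cat (Q_cat C)"
  using additive_Q Q_has_kernels[OF assms] Q_has_cokernels Q_mono_normal Q_epi_conormal[OF assms]
  by (simp add: abelian_cat_def abelian_cat_axioms_def)

text \<open>The weak pullback along the identity is a single generator of the syzygies, and this
  generator serves as the new \<open>rho\<close>.\<close>

lemma Q_isomorphic_presenting:
  assumes wk: "has_weak_kernels C" and X: "is_cospan C X"
  shows "\<exists>Y\<in>presenting_cospans C. isomorphic (Q_cat C) X Y"
proof -
  note [simp] = X cospanD[OF X]
  obtain K k where K: "K \<in> obj C" "k \<in> arr C K (csA X)"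
    and kX: "\<And>T t. \<lbrakk>T \<in> obj C; t \<in> arr C T (csA X)\<rbrakk> \<Longrightarrow>
      cmp C T (csA X) (csA X) t (idn C (csA X)) \<in> syz C X T \<longleftrightarrow> (\<exists>w\<in>arr C T K. t = cmp C T K (csA X) w k)"
    by (rule weak_pullback[OF wk X, of "csA X" "idn C (csA X)"]) auto
  let ?Y = "\<lparr>csA = csA X, csO = csA X, csR = K, gam = idn C (csA X), rho = k\<rparr>"
  have Y: "?Y \<in> presenting_cospans C" by (rule presenting_cospan) (use K in simp_all)
  have "syz C ?Y T = syz C X T" if T: "T \<in> obj C" for T
    unfolding syz_presenting[OF Y T] using kX[OF T] syz_arr[of _ X T] T K by (auto simp: image_def)
  then have "isomorphic (Q_cat C) X ?Y"
    using Y presenting_cospansD by (intro Q_isomorphic_cong) auto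
  then show ?thesis using Y by blast
qed

text \<open>The weak kernel is the sum of \<open>\<rho> \<cdot> \<psi>\<close> and \<open>1 - \<phi> \<cdot> \<psi>\<close>.\<close>

lemma weak_kernel_of_presentation:
  assumes obj: "A \<in> obj C" "B \<in> obj C" "D \<in> obj C" "R \<in> obj C"
    and f: "f \<in> arr C A B" and phi: "\<phi> \<in> arr C A D" and psi: "\<psi> \<in> arr C D A" and r: "r \<in> arr C R D"
    and 1: "cmp C R D B r (cmp C D A B \<psi> f) = zero_arr C R B"
    and 2: "cmp C A D B \<phi> (cmp C D A B \<psi> f) = f"
    and 3: "\<And>T t. \<lbrakk>T \<in> obj C; t \<in> arr C T A; cmp C T A B t f = zero_arr C T B\<rbrakk> \<Longrightarrow> \<exists>w\<in>arr C T R. cmp C T A D t \<phi> = cmp C T R D w r"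
  shows "\<exists>K k. is_weak_kernel C A B f K k"
proof -
  note [simp] = obj f phi psi r
  let ?g = "idn C A \<otimes>\<^bsub>homg C A A\<^esub> inv\<^bsub>homg C A A\<^esub> cmp C A D A \<phi> \<psi>"
  obtain S h where S: "S \<in> obj C" "h \<in> arr C S A" and im: "\<And>T t. T \<in> obj C \<Longrightarrow> (\<exists>w\<in>arr C T S. t = cmp C T S A w h) \<longleftrightarrow>
      (\<exists>x\<in>arr C T R. \<exists>y\<in>arr C T A. t = cmp C T R A x (cmp C R D A r \<psi>) \<otimes>\<^bsub>homg C T A\<^esub> cmp C T A A y ?g)"
    by (rule sum_image[of R A A "cmp C R D A r \<psi>" ?g]) auto
  interpret GA: comm_group "homg C A B" by (simp add: hom_comm_group)
  have gf: "cmp C A A B ?g f = zero_arr C A B"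
    by (simp add: cmp_add_left cmp_neg_left cmp_assoc 2)
  have "is_weak_kernel C A B f S h"
    unfolding is_weak_kernel_def
  proof (intro conjI ballI impI)
    have "\<exists>w\<in>arr C S S. h = cmp C S S A w h" using S by (intro bexI[of _ "idn C S"]) auto
    then obtain x y where xy: "x \<in> arr C S R" "y \<in> arr C S A"
        "h = cmp C S R A x (cmp C R D A r \<psi>) \<otimes>\<^bsub>homg C S A\<^esub> cmp C S A A y ?g"
      using im[OF S(1), of h] by blast
    have "cmp C S A B h f = cmp C S R B x (cmp C R D B r (cmp C D A B \<psi> f)) \<otimes>\<^bsub>homg C S B\<^esub> cmp C S A B y (cmp C A A B ?g f)"
      using xy(1,2) S(1) by (subst xy(3)) (simp add: cmp_add_left cmp_assoc)
    then show "cmp C S A B h f = zero_arr C S B" using xy S by (simp add: 1 gf)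
    fix T t assume T: "T \<in> obj C" and t: "t \<in> arr C T A" "cmp C T A B t f = zero_arr C T B"
    obtain w where w: "w \<in> arr C T R" "cmp C T A D t \<phi> = cmp C T R D w r" using 3[OF T t] by blast
    interpret GT: comm_group "homg C T A" using T by (simp add: hom_comm_group)
    \<comment> \<open>Schanuel's splitting:
      \<open>t = t \<phi> \<psi> + t (1 - \<phi> \<psi>)\<close>, where \<open>t \<phi>\<close> lies
      in the image of \<open>r\<close>.\<close>
    have "cmp C T R A w (cmp C R D A r \<psi>) = cmp C T D A (cmp C T R D w r) \<psi>" using T w(1) by (simp add: cmp_assoc)
    also have "\<dots> = cmp C T A A t (cmp C A D A \<phi> \<psi>)" unfolding w(2)[symmetric] using T t by (simp add: cmp_assoc)
    finally have "t = cmp C T R A w (cmp C R D A r \<psi>) \<otimes>\<^bsub>homg C T A\<^esub> cmp C T A A t ?g"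
      using T t by (simp add: cmp_add_right cmp_neg_right GT.m_lcomm)
    then show "\<exists>u. u \<in> arr C T S \<and> t = cmp C T S A u h" using im[OF T] w(1) t(1) by blast
  qed (use S in simp_all)
  then show ?thesis by blast
qed

section \<open>Weak kernels recovered from properties of Q(P) and of the presenting cospans\<close>

lemma cls_free_eq:
  assumes X: "is_cospan C X" and 0: "syz C X T = {zero_arr C T (csA X)}" and T: "T \<in> obj C"
    and a: "a \<in> arr C T (csA X)" "b \<in> arr C T (csA X)"
  shows "cls C X T a = cls C X T b \<longleftrightarrow> a = b"
proof -
  interpret G: comm_group "homg C T (csA X)" using T cospanD[OF X] by (simp add: hom_comm_group)
  show ?thesis using assms by (simp add: cls_eq_iff G.inv_solve_right')
qed

text \<open>Between free cospans the morphisms are those of \<open>C\<close>, and a lift of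
  \<open>t\<close> through the kernel gives \<open>t = v k\<close> in \<open>C\<close> itself, as
  the free cospan on \<open>A\<close> has no nonzero syzygies. The kernel becomes weak because
  \<open>v\<close> counts only modulo the syzygies of \<open>K\<close>. The parameter
  \<open>S\<close> covers Q(P) and the presenting cospans at once.\<close>

lemma weak_kernels_of_subcat_kernels:
  assumes S: "presenting_cospans C \<subseteq> S" "S \<subseteq> Collect (is_cospan C)"
    and ker: "has_kernels (full_subcat (Q_cat C) S)"
  shows "has_weak_kernels C"
  unfolding has_weak_kernels_def
proof (intro ballI)
  fix A B f assume A: "A \<in> obj C" and B: "B \<in> obj C" and f: "f \<in> arr C A B"
  obtain FA where FA: "FA \<in> presenting_cospans C" "csA FA = A" and FA0: "\<And>T. T \<in> obj C \<Longrightarrow> syz C FA T = {zero_arr C T (csA FA)}"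
    using free_cospan[OF A] by metis
  obtain FB where FB: "FB \<in> presenting_cospans C" "csA FB = B" and FB0: "\<And>T. T \<in> obj C \<Longrightarrow> syz C FB T = {zero_arr C T (csA FB)}"
    using free_cospan[OF B] by metis
  note FA' = presenting_cospansD[OF FA(1)] and FB' = presenting_cospansD[OF FB(1)]
  note [simp] = FA(2) FB(2) FA' FB' A B f
  have f': "f \<in> arr (Aux C) FA FB" using free_cospan_Aux_arr[OF FA(1) FA0 FB'] f by simp
  have "\<exists>K k. is_kernel (full_subcat (Q_cat C) S) FA FB (cls C FB A f) K k"
    using ker cls_in_Q[OF FA' FB' f'] FA FB(1) S(1) unfolding has_kernels_def full_subcat_simps by blast
  then obtain K V where KV: "is_kernel (full_subcat (Q_cat C) S) FA FB (cls C FB A f) K V" by blast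
  have pre: "preadditive_cat (full_subcat (Q_cat C) S)"
    by (rule preadditive_full_subcat[OF preadditive_Q]) (use S in auto)
  note KV' = preadditive_cat.kernelD[OF pre KV, simplified]
  have K: "is_cospan C K" using KV'(1) S(2) by auto
  obtain k where k: "k \<in> arr (Aux C) K FA" "V = cls C FA (csA K) k" using Q_arrE[OF K FA' KV'(2)] .
  note [simp] = K cospanD[OF K] k(1) Aux_arrD[OF k(1), simplified]
  have "is_weak_kernel C A B f (csA K) k"
    unfolding is_weak_kernel_def
  proof (intro conjI ballI impI)
    have "cls C FB (csA K) (cmp C (csA K) A B k f) = zero_arr (Q_cat C) K FB"
      using KV'(3) Q_cmp[OF K FA' FB' k(1) f'] by (simp add: k(2))
    then have "cmp C (csA K) A B k f \<in> syz C FB (csA K)"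
      using Q_eq_zero_iff[OF K FB'] by simp
    then show "cmp C (csA K) A B k f = zero_arr C (csA K) B" using FB0[of "csA K"] by simp
    fix T t assume T: "T \<in> obj C" and t: "t \<in> arr C T A" "cmp C T A B t f = zero_arr C T B"
    obtain FT where FT: "FT \<in> presenting_cospans C" "csA FT = T" and FT0: "\<And>U. U \<in> obj C \<Longrightarrow> syz C FT U = {zero_arr C U (csA FT)}"
      using free_cospan[OF T] by metis
    note FT' = presenting_cospansD[OF FT(1)]
    note [simp] = FT' FT(2) T t(1)
    have t': "t \<in> arr (Aux C) FT FA" using free_cospan_Aux_arr[OF FT(1) FT0 FA'] by simp
    have "cmp (Q_cat C) FT FA FB (cls C FA T t) (cls C FB A f) = zero_arr (Q_cat C) FT FB"
      using Q_cmp[OF FT' FA' FB' t' f'] t(2) by (simp add: Q_zero)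
    then obtain U where U: "U \<in> arr (Q_cat C) FT K" "cls C FA T t = cmp (Q_cat C) FT K FA U V"
      using KV'(4)[of FT "cls C FA T t"] cls_in_Q[OF FT' FA' t'] FT(1) S(1) by auto
    obtain v where v: "v \<in> arr (Aux C) FT K" "U = cls C K T v" using Q_arrE[OF FT' K U(1)] by auto
    note [simp] = Aux_arrD[OF v(1), simplified]
    have "cls C FA T t = cls C FA T (cmp C T (csA K) A v k)"
      using U(2) Q_cmp[OF FT' K FA' v(1) k(1)] by (simp add: k(2) v(2))
    then have "t = cmp C T (csA K) A v k"
      using cls_free_eq[OF FA' FA0[OF T] T] by simp
    then show "\<exists>u. u \<in> arr C T (csA K) \<and> t = cmp C T (csA K) A u k"
      by (intro exI[of _ v]) simp
  qed simp_all
  then show "\<exists>K k. is_weak_kernel C A B f K k" by blast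
qed

text \<open>The assumption is applied to the image of (-,f), that is, to the cospan on
  \<open>A\<close> whose syzygies are the morphisms annihilated by \<open>f\<close>; a presentation
  of it contains a weak kernel.\<close>

lemma weak_kernels_of_presenting_dense:
  assumes dense: "\<And>X. is_cospan C X \<Longrightarrow> \<exists>Y\<in>presenting_cospans C. isomorphic (Q_cat C) X Y"
  shows "has_weak_kernels C"
  unfolding has_weak_kernels_def
proof (intro ballI)
  fix A B f assume A: "A \<in> obj C" and B: "B \<in> obj C" and f: "f \<in> arr C A B"
  obtain FB where FB: "FB \<in> presenting_cospans C" "csA FB = B" and FB0: "\<And>T. T \<in> obj C \<Longrightarrow> syz C FB T = {zero_arr C T B}"
    using free_cospan[OF B] by metis
  note FB' = presenting_cospansD[OF FB(1)]
  note [simp] = FB(2) FB' A B f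
  obtain X where X: "is_cospan C X" "csA X = A"
    and syzX: "\<And>T s. \<lbrakk>T \<in> obj C; s \<in> arr C T A\<rbrakk> \<Longrightarrow> s \<in> syz C X T \<longleftrightarrow> cmp C T A B s f \<in> syz C FB T"
    using pull_cospan[OF FB' A, of f] by auto
  obtain Y where Y: "Y \<in> presenting_cospans C" "isomorphic (Q_cat C) X Y" using dense X by blast
  note Y' = presenting_cospansD[OF Y(1)]
  note [simp] = X Y' cospanD[OF Y']
  obtain U V where UV: "U \<in> arr (Q_cat C) X Y" "V \<in> arr (Q_cat C) Y X" "cmp (Q_cat C) X Y X U V = idn (Q_cat C) X"
    using Y(2) unfolding isomorphic_def is_isomorphism_def by blast
  obtain \<phi> where phi: "\<phi> \<in> arr (Aux C) X Y" "U = cls C Y A \<phi>" using Q_arrE[OF X(1) Y' UV(1)] by auto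
  obtain \<psi> where psi: "\<psi> \<in> arr (Aux C) Y X" "V = cls C X (csA Y) \<psi>" using Q_arrE[OF Y' X(1) UV(2)] by auto
  note [simp] = Aux_arrD[OF phi(1), simplified] Aux_arrD[OF psi(1), simplified]
  have f': "f \<in> arr (Aux C) X FB" using syzX syz_arr[of _ X] by (auto simp: Aux_arr)
  show "\<exists>K k. is_weak_kernel C A B f K k"
  proof (rule weak_kernel_of_presentation[of A B "csA Y" "csR Y" f \<phi> \<psi> "rho Y"])
    show r: "rho Y \<in> arr C (csR Y) (csA Y)" using presenting_rho[OF Y(1)] .
    note [simp] = r
    have "rho Y \<in> syz C Y (csR Y)"
      using syz_presenting[OF Y(1), of "csR Y"] by (auto intro!: image_eqI[of _ _ "idn C (csR Y)"])
    then have "cmp C (csR Y) (csA Y) A (rho Y) \<psi> \<in> syz C X (csR Y)" using Aux_arr_syz[OF psi(1)] by simp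
    then have "cmp C (csR Y) A B (cmp C (csR Y) (csA Y) A (rho Y) \<psi>) f \<in> syz C FB (csR Y)" using Aux_arr_syz[OF f'] by simp
    then show "cmp C (csR Y) (csA Y) B (rho Y) (cmp C (csA Y) A B \<psi> f) = zero_arr C (csR Y) B"
      by (simp add: FB0 cmp_assoc)
    \<comment> \<open>\<open>\<phi> \<psi>\<close> is the identity only modulo syzygies of
      \<open>X\<close>, but \<open>f\<close> annihilates these, so
      \<open>\<phi> \<psi> f = f\<close> holds in \<open>C\<close> itself.\<close>
    have "cls C X A (cmp C A (csA Y) A \<phi> \<psi>) = cls C X A (idn C A)"
      using UV(3) Q_cmp[OF X(1) Y' X(1) phi(1) psi(1)] by (simp add: phi(2) psi(2) Q_idn)
    from cls_cmp_right[OF X(1) FB' _ _ _ f' this[folded X(2)]]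
    have "cls C FB A (cmp C A A B (cmp C A (csA Y) A \<phi> \<psi>) f) = cls C FB A f" by simp
    then show "cmp C A (csA Y) B \<phi> (cmp C (csA Y) A B \<psi> f) = f"
      using cls_free_eq[OF FB', of A] FB0 by (simp add: cmp_assoc)
    fix T t assume T: "T \<in> obj C" and t: "t \<in> arr C T A" "cmp C T A B t f = zero_arr C T B"
    have "t \<in> syz C X T" using syzX[OF T t(1)] t FB0[OF T] by simp
    then have "cmp C T A (csA Y) t \<phi> \<in> syz C Y T" using Aux_arr_syz[OF phi(1) T] by simp
    then show "\<exists>w\<in>arr C T (csR Y). cmp C T A (csA Y) t \<phi> = cmp C T (csR Y) (csA Y) w (rho Y)"
      unfolding syz_presenting[OF Y(1) T] by blast
  qed simp_all
qed

text \<open>For the factorization \<open>f = e m\<close> through a presenting cospan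
  \<open>I\<close>, the morphisms \<open>e\<close> and \<open>z\<close> act as \<phi> and \<psi>.
  That \<open>z\<close> splits \<open>e\<close> only modulo syzygies of \<open>I\<close> is enough,
  since \<open>m\<close> annihilates them.\<close>

lemma weak_kernels_of_epi_mono_factorizations:
  assumes emf: "has_epi_mono_factorizations (full_subcat (Q_cat C) (presenting_cospans C))"
  shows "has_weak_kernels C"
  unfolding has_weak_kernels_def
proof (intro ballI)
  fix A B f assume A: "A \<in> obj C" and B: "B \<in> obj C" and f: "f \<in> arr C A B"
  obtain FA where FA: "FA \<in> presenting_cospans C" "csA FA = A" and FA0: "\<And>T. T \<in> obj C \<Longrightarrow> syz C FA T = {zero_arr C T (csA FA)}"
    using free_cospan[OF A] by metis
  obtain FB where FB: "FB \<in> presenting_cospans C" "csA FB = B" and FB0: "\<And>T. T \<in> obj C \<Longrightarrow> syz C FB T = {zero_arr C T (csA FB)}"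
    using free_cospan[OF B] by metis
  note FA' = presenting_cospansD[OF FA(1)] and FB' = presenting_cospansD[OF FB(1)]
  note [simp] = FA(2) FB(2) FA' FB' A B f
  have f': "f \<in> arr (Aux C) FA FB" using free_cospan_Aux_arr[OF FA(1) FA0 FB'] f by simp
  have "\<exists>I e m. is_epi_mono_fact (full_subcat (Q_cat C) (presenting_cospans C)) FA FB (cls C FB A f) I e m"
    using emf cls_in_Q[OF FA' FB' f'] FA(1) FB(1) unfolding has_epi_mono_factorizations_def by auto
  then obtain I E M where I: "I \<in> presenting_cospans C" and E: "is_epi (full_subcat (Q_cat C) (presenting_cospans C)) FA I E"
    and M: "is_mono (full_subcat (Q_cat C) (presenting_cospans C)) I FB M" and EM: "cls C FB A f = cmp (Q_cat C) FA I FB E M"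
    by (auto simp: is_epi_mono_fact_def)
  note I' = presenting_cospansD[OF I]
  have "E \<in> arr (Q_cat C) FA I" "M \<in> arr (Q_cat C) I FB" using E M by (auto simp: is_epi_def is_mono_def)
  then obtain e m where e: "e \<in> arr (Aux C) FA I" "E = cls C I A e" and m: "m \<in> arr (Aux C) I FB" "M = cls C FB (csA I) m"
    using Q_arrE[OF FA' I'] Q_arrE[OF I' FB'] FA(2) by metis
  note [simp] = I' cospanD[OF I'] e(1) m(1) Aux_arrD[OF e(1), simplified] Aux_arrD[OF m(1), simplified]
  have pw: "pw_mono C I FB m" using Q_mono_imp_pw_mono[OF _ I' FB' m(1)] M m(2) by blast
  \<comment> \<open>The closure condition on the subcategory holds because a cospan is presenting by
    virtue of its middle object and \<open>gam\<close>, which cokernels keep.\<close>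
  have "\<exists>z\<in>arr C (csA I) (csA FA). cls C I (csA I) (idn C (csA I)) = cls C I (csA I) (cmp C (csA I) (csA FA) (csA I) z e)"
    by (rule Q_epi_imp_split[OF FA' I' e(1), of "presenting_cospans C"])
      (use E e(2) I in \<open>auto simp: presenting_cospans_def\<close>)
  then obtain z where z [simp]: "z \<in> arr C (csA I) A"
    and ze: "cls C I (csA I) (idn C (csA I)) = cls C I (csA I) (cmp C (csA I) A (csA I) z e)"
    by auto
  have "cls C FB A f = cls C FB A (cmp C A (csA I) B e m)"
    using EM Q_cmp[OF FA' I' FB' e(1) m(1)] by (simp add: e(2) m(2))
  then have em: "f = cmp C A (csA I) B e m" using cls_free_eq[OF FB', of A] FB0 by simp
  show "\<exists>K k. is_weak_kernel C A B f K k"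
  proof (rule weak_kernel_of_presentation[of A B "csA I" "csR I" f e z "rho I"])
    show r: "rho I \<in> arr C (csR I) (csA I)" using presenting_rho[OF I] .
    note [simp] = r
    have rI: "rho I \<in> syz C I (csR I)"
      using syz_presenting[OF I, of "csR I"] by (auto intro!: image_eqI[of _ _ "idn C (csR I)"])
    have zem: "cls C FB (csA I) m = cls C FB (csA I) (cmp C (csA I) A B z f)"
      using cls_cmp_right[OF I' FB' _ _ _ m(1) ze] by (simp add: cmp_assoc em)
    then have zf: "cmp C (csA I) A B z f = m" using cls_free_eq[OF FB', of "csA I"] FB0 by simp
    then show "cmp C (csR I) (csA I) B (rho I) (cmp C (csA I) A B z f) = zero_arr C (csR I) B"
      using Aux_arr_syz[OF m(1) _ rI] FB0 by simp
    show "cmp C A (csA I) B e (cmp C (csA I) A B z f) = f" unfolding zf by (rule em[symmetric])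
    fix T t assume T: "T \<in> obj C" and t: "t \<in> arr C T A" "cmp C T A B t f = zero_arr C T B"
    then have "cmp C T (csA I) B (cmp C T A (csA I) t e) m \<in> syz C FB T" using FB0 by (simp add: cmp_assoc em)
    then have "cmp C T A (csA I) t e \<in> syz C I T" using pw T t unfolding pw_mono_def by simp
    then show "\<exists>w\<in>arr C T (csR I). cmp C T A (csA I) t e = cmp C T (csR I) (csA I) w (rho I)"
      unfolding syz_presenting[OF I T] by blast
  qed simp_all
qed

end

section \<open>Quotients of representable functors\<close>

text \<open>The natural epimorphism from (-,A) before transport to the universe; it plays the part
  of \<open>q\<close> in \<open>cyclic\<close>.\<close>

definition coset_map :: "('o, 'm) acat \<Rightarrow> ('o, 'm) cospan \<Rightarrow> 'o \<Rightarrow> 'm \<Rightarrow> 'm set" where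
  "coset_map P X T t = (im_rho P X T \<inter> im_gam P X T) #>\<^bsub>homg P T (csO X)\<^esub> cmp P T (csA X) (csO X) t (gam X)"

text \<open>
  \<open>cyclic P F A N q\<close> says that \<open>q\<close> exhibits \<open>F\<close> as the quotient of \<open>(-,A)\<close> by the subfunctor \<open>N\<close>.
\<close>

definition cyclic :: "('o, 'm) acat \<Rightarrow> ('o, 'm, 'g) presheaf \<Rightarrow> 'o \<Rightarrow> ('o \<Rightarrow> 'm set) \<Rightarrow> ('o \<Rightarrow> 'm \<Rightarrow> 'g) \<Rightarrow> bool" where
  "cyclic P F A N q \<longleftrightarrow> A \<in> obj P \<and>
     (\<forall>T\<in>obj P. comm_group (fob F T) \<and> carrier (fob F T) = q T ` arr P T A \<and> q T \<in> hom (homg P T A) (fob F T) \<and>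
        (\<forall>t\<in>arr P T A. q T t = \<one>\<^bsub>fob F T\<^esub> \<longleftrightarrow> t \<in> N T)) \<and>
     (\<forall>T\<in>obj P. \<forall>T'\<in>obj P. \<forall>f\<in>arr P T' T. far F T T' f \<in> extensional (carrier (fob F T)) \<and>
        (\<forall>t\<in>arr P T A. far F T T' f (q T t) = q T' (cmp P T' T A f t)))"

lemma
  assumes "cyclic P F A N q"
  shows cyclic_obj: "A \<in> obj P"
    and cyclic_comm_group: "T \<in> obj P \<Longrightarrow> comm_group (fob F T)"
    and cyclic_carrier: "T \<in> obj P \<Longrightarrow> carrier (fob F T) = q T ` arr P T A"
    and cyclic_hom: "T \<in> obj P \<Longrightarrow> q T \<in> hom (homg P T A) (fob F T)"
    and cyclic_one_iff: "\<lbrakk>T \<in> obj P; t \<in> arr P T A\<rbrakk> \<Longrightarrow> q T t = \<one>\<^bsub>fob F T\<^esub> \<longleftrightarrow> t \<in> N T"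
    and cyclic_ext: "\<lbrakk>T \<in> obj P; T' \<in> obj P; f \<in> arr P T' T\<rbrakk> \<Longrightarrow> far F T T' f \<in> extensional (carrier (fob F T))"
    and cyclic_far: "\<lbrakk>T \<in> obj P; T' \<in> obj P; f \<in> arr P T' T; t \<in> arr P T A\<rbrakk> \<Longrightarrow>
      far F T T' f (q T t) = q T' (cmp P T' T A f t)"
  using assms unfolding cyclic_def by blast+

section \<open>Natural transformations of presheaves, elementwise\<close>

lemma Mod_obj [simp]: "obj (Mod_cat P) = {F. is_functor (op_cat P) Ab_cat F}"
  by (simp add: Mod_cat_def functor_cat_def)

lemma Mod_arr_iff: "h \<in> arr (Mod_cat P) F G \<longleftrightarrow> h \<in> extensional (obj P) \<and>
    (\<forall>T\<in>obj P. h T \<in> hom (fob F T) (fob G T) \<and> h T \<in> extensional (carrier (fob F T))) \<and>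
    (\<forall>T\<in>obj P. \<forall>T'\<in>obj P. \<forall>f\<in>arr P T' T. compose (carrier (fob F T)) (h T') (far F T T' f) = compose (carrier (fob F T)) (far G T T' f) (h T))"
  by (auto simp: Mod_cat_def functor_cat_def nat_trans_def PiE_def Ab_cat_def)

lemma Mod_cmp: "\<lbrakk>T \<in> obj P; x \<in> carrier (fob F T)\<rbrakk> \<Longrightarrow> cmp (Mod_cat P) F G H s t T x = t T (s T x)"
  by (simp add: Mod_cat_def functor_cat_def Ab_cat_def compose_def)

lemma Mod_idn: "\<lbrakk>T \<in> obj P; x \<in> carrier (fob F T)\<rbrakk> \<Longrightarrow> idn (Mod_cat P) F T x = x"
  by (simp add: Mod_cat_def functor_cat_def Ab_cat_def)

lemma Mod_add: "\<lbrakk>T \<in> obj P; x \<in> carrier (fob F T)\<rbrakk> \<Longrightarrow> (s \<otimes>\<^bsub>homg (Mod_cat P) F G\<^esub> t) T x = s T x \<otimes>\<^bsub>fob G T\<^esub> t T x"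
  by (simp add: Mod_cat_def functor_cat_def Ab_cat_def)

lemma Mod_arr_closed: "\<lbrakk>h \<in> arr (Mod_cat P) F G; T \<in> obj P; x \<in> carrier (fob F T)\<rbrakk> \<Longrightarrow> h T x \<in> carrier (fob G T)"
  unfolding Mod_arr_iff hom_def by auto

lemma Mod_arr_far:
  assumes "h \<in> arr (Mod_cat P) F G" "T \<in> obj P" "T' \<in> obj P" "f \<in> arr P T' T" "x \<in> carrier (fob F T)"
  shows "h T' (far F T T' f x) = far G T T' f (h T x)"
proof -
  have "compose (carrier (fob F T)) (h T') (far F T T' f) = compose (carrier (fob F T)) (far G T T' f) (h T)"
    using assms unfolding Mod_arr_iff by blast
  from fun_cong[OF this, of x] show ?thesis using assms(5) by (simp add: compose_def)
qed

lemma Mod_arr_eqI: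
  assumes "h \<in> arr (Mod_cat P) F G" "k \<in> arr (Mod_cat P) F G"
    and "\<And>T x. \<lbrakk>T \<in> obj P; x \<in> carrier (fob F T)\<rbrakk> \<Longrightarrow> h T x = k T x"
  shows "h = k"
proof (rule extensionalityI[of _ "obj P"])
  show "h \<in> extensional (obj P)" "k \<in> extensional (obj P)" using assms by (auto simp: Mod_arr_iff)
  show "h T = k T" if "T \<in> obj P" for T
    by (rule extensionalityI[of _ "carrier (fob F T)"]) (use assms that in \<open>auto simp: Mod_arr_iff\<close>)
qed

lemma image_group_comm_group:
  assumes G: "comm_group G" and inj: "inj_on e (carrier G)"
  shows "comm_group (image_group e G)"
proof -
  interpret G: comm_group G by fact
  show ?thesis
    using inj
    by (intro comm_groupI) (auto simp: image_group_def G.m_ac, metis G.inv_closed G.r_inv)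
qed

text \<open>The map of quotients induced by \<open>a\<close>, evaluated at a chosen representative
  of \<open>x\<close>. The choice is harmless once \<open>a\<close> carries the one subfunctor into
  the other.\<close>

definition cyclic_map :: "('o, 'm) acat \<Rightarrow> ('o, 'm, 'g) presheaf \<Rightarrow> 'o \<Rightarrow> ('o \<Rightarrow> 'm \<Rightarrow> 'g) \<Rightarrow> 'o \<Rightarrow> ('o \<Rightarrow> 'm \<Rightarrow> 'g) \<Rightarrow> 'm \<Rightarrow> 'o \<Rightarrow> 'g \<Rightarrow> 'g" where
  "cyclic_map P F A q B r a =
     (\<lambda>T\<in>obj P. \<lambda>x\<in>carrier (fob F T). r T (cmp P T A B (SOME t. t \<in> arr P T A \<and> q T t = x) a))"

context preadditive_cat
begin

section \<open>Calculus of quotients of representable functors\<close>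

lemma cyclic_add:
  "\<lbrakk>cyclic C F A N q; T \<in> obj C; s \<in> arr C T A; t \<in> arr C T A\<rbrakk> \<Longrightarrow> q T (s \<otimes>\<^bsub>homg C T A\<^esub> t) = q T s \<otimes>\<^bsub>fob F T\<^esub> q T t"
  using hom_mult[OF cyclic_hom] by metis

lemma cyclic_closed: "\<lbrakk>cyclic C F A N q; T \<in> obj C; t \<in> arr C T A\<rbrakk> \<Longrightarrow> q T t \<in> carrier (fob F T)"
  by (simp add: cyclic_carrier)

lemma cyclic_eq_iff:
  assumes c: "cyclic C F A N q" and T: "T \<in> obj C" and t: "s \<in> arr C T A" "t \<in> arr C T A"
  shows "q T s = q T t \<longleftrightarrow> s \<otimes>\<^bsub>homg C T A\<^esub> inv\<^bsub>homg C T A\<^esub> t \<in> N T"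
proof -
  note A = cyclic_obj[OF c]
  interpret F: comm_group "fob F T" by (rule cyclic_comm_group[OF c T])
  interpret q: group_hom "homg C T A" "fob F T" "q T"
    by (intro group_hom.intro group_hom_axioms.intro hom_group T A F.is_group cyclic_hom[OF c])
  have "q T (s \<otimes>\<^bsub>homg C T A\<^esub> inv\<^bsub>homg C T A\<^esub> t) = \<one>\<^bsub>fob F T\<^esub> \<longleftrightarrow> q T s = q T t"
    using t by (simp add: F.inv_solve_right')
  moreover have "s \<otimes>\<^bsub>homg C T A\<^esub> inv\<^bsub>homg C T A\<^esub> t \<in> arr C T A" using t T A by simp
  ultimately show ?thesis using cyclic_one_iff[OF c T] by metis
qed

text \<open>All laws are tested on the classes \<open>q T t\<close>, where they become laws of
  composition in \<open>C\<close>.\<close>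

lemma cyclic_is_functor:
  assumes c: "cyclic C F A N q" shows "is_functor (op_cat C) Ab_cat F"
proof -
  note A = cyclic_obj[OF c]
  have far_hom: "far F T T' f \<in> hom (fob F T) (fob F T')" if T: "T \<in> obj C" "T' \<in> obj C" "f \<in> arr C T' T" for T T' f
  proof (rule homI)
    fix x assume "x \<in> carrier (fob F T)"
    then obtain s where s: "s \<in> arr C T A" "x = q T s" using cyclic_carrier[OF c T(1)] by auto
    show "far F T T' f x \<in> carrier (fob F T')"
      using T s A by (simp add: cyclic_far[OF c] cyclic_closed[OF c])
    fix y assume "y \<in> carrier (fob F T)"
    then obtain t where t: "t \<in> arr C T A" "y = q T t" using cyclic_carrier[OF c T(1)] by auto
    show "far F T T' f (x \<otimes>\<^bsub>fob F T\<^esub> y) = far F T T' f x \<otimes>\<^bsub>fob F T'\<^esub> far F T T' f y"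
      using T s t A by (simp add: cyclic_far[OF c] cmp_add_right flip: cyclic_add[OF c])
  qed
  have far_Ab: "far F T T' f \<in> arr Ab_cat (fob F T) (fob F T')" if T: "T \<in> obj C" "T' \<in> obj C" "f \<in> arr C T' T" for T T' f
    using far_hom[OF that] cyclic_ext[OF c that] by (simp add: Ab_cat_def)
  have eqI: "h = k" if "h \<in> extensional (carrier (fob F T))" "k \<in> extensional (carrier (fob F T))" "T \<in> obj C"
    "\<And>t. t \<in> arr C T A \<Longrightarrow> h (q T t) = k (q T t)" for h k T
    by (rule extensionalityI[OF that(1,2)]) (use that cyclic_carrier[OF c that(3)] in auto)
  show ?thesis
    unfolding is_functor_def op_simps
  proof (intro conjI ballI)
    fix T assume T: "T \<in> obj C"
    show "fob F T \<in> obj Ab_cat" using cyclic_comm_group[OF c T] by (simp add: Ab_cat_def)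
    show "far F T T (idn C T) = idn Ab_cat (fob F T)"
      by (rule eqI[OF cyclic_ext[OF c] _ T]) (use T A in \<open>simp_all add: Ab_cat_def cyclic_far[OF c] cyclic_closed[OF c]\<close>)
    fix T' assume T': "T' \<in> obj C"
    show "far F T T' \<in> hom (homg C T' T) (homg Ab_cat (fob F T) (fob F T'))"
    proof (rule homI)
      fix f g assume f: "f \<in> arr C T' T" and g: "g \<in> arr C T' T"
      show "far F T T' (f \<otimes>\<^bsub>homg C T' T\<^esub> g) = far F T T' f \<otimes>\<^bsub>homg Ab_cat (fob F T) (fob F T')\<^esub> far F T T' g"
        by (rule eqI[OF cyclic_ext[OF c] _ T])
          (use T T' A f g in \<open>simp_all add: Ab_cat_def cyclic_far[OF c] cyclic_closed[OF c] cmp_add_left cyclic_add[OF c]\<close>)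
    qed (rule far_Ab[OF T T'])
    fix E f g assume E: "E \<in> obj C" and f: "f \<in> arr C T' T" and g: "g \<in> arr C E T'"
    show "far F T E (cmp C E T' T g f) = cmp Ab_cat (fob F T) (fob F T') (fob F E) (far F T T' f) (far F T' E g)"
      by (rule eqI[OF cyclic_ext[OF c] _ T])
        (use T T' E A f g in \<open>simp_all add: Ab_cat_def compose_def cyclic_far[OF c] cyclic_closed[OF c] cmp_assoc\<close>)
  qed
qed

text \<open>Yoneda: the class of the identity generates \<open>F\<close>.\<close>

lemma cyclic_far_idn:
  assumes c: "cyclic C F A N q" and T: "T \<in> obj C" and t: "t \<in> arr C T A"
  shows "far F A T t (q A (idn C A)) = q T t"
  using cyclic_far[OF c cyclic_obj[OF c] T t] cyclic_obj[OF c] T t by simp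

text \<open>The image of the generator is the class of some \<open>a\<close>, because
  \<open>r\<close> is onto; naturality then fixes \<open>h\<close> on every class.\<close>

lemma cyclic_hom_lift:
  assumes F: "cyclic C F A N q" and G: "cyclic C G B M r" and h: "h \<in> arr (Mod_cat C) F G"
  obtains a where "a \<in> arr C A B" "\<And>T t. \<lbrakk>T \<in> obj C; t \<in> arr C T A\<rbrakk> \<Longrightarrow> h T (q T t) = r T (cmp C T A B t a)"
    "\<And>T t. \<lbrakk>T \<in> obj C; t \<in> arr C T A; t \<in> N T\<rbrakk> \<Longrightarrow> cmp C T A B t a \<in> M T"
proof -
  note A = cyclic_obj[OF F] and B = cyclic_obj[OF G]
  have id: "q A (idn C A) \<in> carrier (fob F A)" using A by (simp add: cyclic_closed[OF F])
  then have "h A (q A (idn C A)) \<in> carrier (fob G A)" by (rule Mod_arr_closed[OF h A])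
  then obtain a where a: "a \<in> arr C A B" "h A (q A (idn C A)) = r A a" using cyclic_carrier[OF G A] by auto
  have *: "h T (q T t) = r T (cmp C T A B t a)" if T: "T \<in> obj C" and t: "t \<in> arr C T A" for T t
    using Mod_arr_far[OF h A T t id] cyclic_far_idn[OF F T t] cyclic_far[OF G A T t a(1)] a(2) by simp
  have "cmp C T A B t a \<in> M T" if T: "T \<in> obj C" and t: "t \<in> arr C T A" "t \<in> N T" for T t
  proof -
    have "h T \<in> hom (fob F T) (fob G T)" using h T by (simp add: Mod_arr_iff)
    then have "h T \<one>\<^bsub>fob F T\<^esub> = \<one>\<^bsub>fob G T\<^esub>"
      by (rule hom_one) (use cyclic_comm_group[OF F T] cyclic_comm_group[OF G T] comm_group.axioms(2) in auto)
    then have "r T (cmp C T A B t a) = \<one>\<^bsub>fob G T\<^esub>" using *[OF T t(1)] cyclic_one_iff[OF F T t(1)] t by simp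
    then show ?thesis using cyclic_one_iff[OF G T] T t A B a by simp
  qed
  with a(1) * that show thesis by blast
qed

lemma cyclic_map:
  assumes F: "cyclic C F A N q" and G: "cyclic C G B M r" and a: "a \<in> arr C A B"
    and NM: "\<And>T t. \<lbrakk>T \<in> obj C; t \<in> arr C T A; t \<in> N T\<rbrakk> \<Longrightarrow> cmp C T A B t a \<in> M T"
  shows cyclic_map_arr: "cyclic_map C F A q B r a \<in> arr (Mod_cat C) F G"
    and cyclic_map_apply: "\<lbrakk>T \<in> obj C; t \<in> arr C T A\<rbrakk> \<Longrightarrow> cyclic_map C F A q B r a T (q T t) = r T (cmp C T A B t a)"
proof -
  let ?h = "cyclic_map C F A q B r a"
  note A = cyclic_obj[OF F] and B = cyclic_obj[OF G]
  have wd: "r T (cmp C T A B s a) = r T (cmp C T A B t a)"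
    if T: "T \<in> obj C" and s: "s \<in> arr C T A" and t: "t \<in> arr C T A" and eq: "q T s = q T t" for T s t
  proof -
    have "s \<otimes>\<^bsub>homg C T A\<^esub> inv\<^bsub>homg C T A\<^esub> t \<in> N T" using eq cyclic_eq_iff[OF F T s t] by simp
    from NM[OF T _ this] show ?thesis
      using T s t A B a by (simp add: cyclic_eq_iff[OF G] cmp_add_left cmp_neg_left)
  qed
  show ap: "?h T (q T t) = r T (cmp C T A B t a)" if T: "T \<in> obj C" and t: "t \<in> arr C T A" for T t
  proof -
    let ?s = "SOME s. s \<in> arr C T A \<and> q T s = q T t"
    have "?s \<in> arr C T A \<and> q T ?s = q T t"
      by (rule someI[of _ t]) (use t in simp)
    then have "r T (cmp C T A B ?s a) = r T (cmp C T A B t a)" using wd[OF T _ t] by blast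
    moreover have "?h T (q T t) = r T (cmp C T A B ?s a)"
      unfolding cyclic_map_def using T cyclic_closed[OF F T t] by simp
    ultimately show ?thesis by simp
  qed
  show "?h \<in> arr (Mod_cat C) F G"
    unfolding Mod_arr_iff
  proof (intro conjI ballI homI)
    fix T assume T: "T \<in> obj C"
    show "?h T \<in> extensional (carrier (fob F T))" using T by (simp add: cyclic_map_def)
    { fix x assume "x \<in> carrier (fob F T)"
      then obtain s where s: "s \<in> arr C T A" "x = q T s" using cyclic_carrier[OF F T] by auto
      show "?h T x \<in> carrier (fob G T)" using T s a A B by (simp add: ap cyclic_closed[OF G])
      fix y assume "y \<in> carrier (fob F T)"
      then obtain t where t: "t \<in> arr C T A" "y = q T t" using cyclic_carrier[OF F T] by auto
      show "?h T (x \<otimes>\<^bsub>fob F T\<^esub> y) = ?h T x \<otimes>\<^bsub>fob G T\<^esub> ?h T y"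
        using T s t a A B by (simp add: ap cyclic_add[OF G] cmp_add_left flip: cyclic_add[OF F]) }
    fix T' f assume T': "T' \<in> obj C" and f: "f \<in> arr C T' T"
    show "compose (carrier (fob F T)) (?h T') (far F T T' f) = compose (carrier (fob F T)) (far G T T' f) (?h T)"
      unfolding compose_def
    proof (rule restrict_ext)
      fix x assume "x \<in> carrier (fob F T)"
      then obtain s where s: "s \<in> arr C T A" "x = q T s" using cyclic_carrier[OF F T] by auto
      show "?h T' (far F T T' f x) = far G T T' f (?h T x)"
        using T T' f s a A B by (simp add: ap cyclic_far[OF F] cyclic_far[OF G] cmp_assoc)
    qed
  qed (simp add: cyclic_map_def)
qed

lemma cyclic_hom_eqI:
  assumes F: "cyclic C F A N q" and hk: "h \<in> arr (Mod_cat C) F G" "k \<in> arr (Mod_cat C) F G"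
    and eq: "\<And>T t. \<lbrakk>T \<in> obj C; t \<in> arr C T A\<rbrakk> \<Longrightarrow> h T (q T t) = k T (q T t)"
  shows "h = k"
  by (rule Mod_arr_eqI[OF hk]) (use eq cyclic_carrier[OF F] in auto)

lemma cyclic_isomorphic:
  assumes F: "cyclic C F A N q" and G: "cyclic C G A M r"
    and NM: "\<And>T. T \<in> obj C \<Longrightarrow> N T = M T"
  shows "isomorphic (Mod_cat C) F G"
proof -
  note A = cyclic_obj[OF F]
  interpret Mod: preadditive_cat "Mod_cat C" by (rule preadditive_Mod_cat)
  have FG: "F \<in> obj (Mod_cat C)" "G \<in> obj (Mod_cat C)"
    using cyclic_is_functor[OF F] cyclic_is_functor[OF G] by simp_all
  let ?h = "cyclic_map C F A q A r (idn C A)" and ?k = "cyclic_map C G A r A q (idn C A)"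
  have NMid: "cmp C T A A t (idn C A) \<in> M T" if "T \<in> obj C" "t \<in> arr C T A" "t \<in> N T" for T t
    using that NM A by simp
  have MNid: "cmp C T A A t (idn C A) \<in> N T" if "T \<in> obj C" "t \<in> arr C T A" "t \<in> M T" for T t
    using that NM A by simp
  note h = cyclic_map[OF F G idn_closed[OF A] NMid] and k = cyclic_map[OF G F idn_closed[OF A] MNid]
  have "cmp (Mod_cat C) F G F ?h ?k = idn (Mod_cat C) F"
    by (rule cyclic_hom_eqI[OF F, where G = F]) (use FG h k A in \<open>simp_all add: Mod_cmp Mod_idn cyclic_closed[OF F]\<close>)
  moreover have "cmp (Mod_cat C) G F G ?k ?h = idn (Mod_cat C) G"
    by (rule cyclic_hom_eqI[OF G, where G = G]) (use FG h k A in \<open>simp_all add: Mod_cmp Mod_idn cyclic_closed[OF G]\<close>)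
  ultimately show ?thesis
    unfolding isomorphic_def is_isomorphism_def using h(1) k(1) by blast
qed

text \<open>The projection is composed with the isomorphism. Hence being finitely presented, once
  expressed by \<open>cyclic\<close>, is invariant under isomorphism.\<close>

lemma cyclic_cong_iso:
  assumes F: "cyclic C F A N q" and G: "G \<in> obj (Mod_cat C)" and iso: "isomorphic (Mod_cat C) F G"
  obtains r where "cyclic C G A N r"
proof -
  note A = cyclic_obj[OF F]
  obtain h k where h: "h \<in> arr (Mod_cat C) F G" and k: "k \<in> arr (Mod_cat C) G F"
    and hk: "cmp (Mod_cat C) F G F h k = idn (Mod_cat C) F" and kh: "cmp (Mod_cat C) G F G k h = idn (Mod_cat C) G"
    using iso unfolding isomorphic_def is_isomorphism_def by blast
  have hk': "k T (h T x) = x" if "T \<in> obj C" "x \<in> carrier (fob F T)" for T x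
    using Mod_cmp[OF that, of G F h k] Mod_idn[OF that] hk by simp
  have kh': "h T (k T x) = x" if "T \<in> obj C" "x \<in> carrier (fob G T)" for T x
    using Mod_cmp[OF that, of F G k h] Mod_idn[OF that] kh by simp
  have cg: "comm_group (fob G T)" if "T \<in> obj C" for T
    using G that by (auto simp: is_functor_def Ab_cat_def)
  have ext: "far G T T' f \<in> extensional (carrier (fob G T))" if "T \<in> obj C" "T' \<in> obj C" "f \<in> arr C T' T" for T T' f
    using functor_ar[of "op_cat C" Ab_cat G T T' f] G that by (simp add: Ab_cat_def)
  have hh: "h T \<in> hom (fob F T) (fob G T)" if "T \<in> obj C" for T using h that by (simp add: Mod_arr_iff)
  have "cyclic C G A N (\<lambda>T t. h T (q T t))"
    unfolding cyclic_def
  proof (intro conjI ballI)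
    fix T assume T: "T \<in> obj C"
    show "carrier (fob G T) = (\<lambda>t. h T (q T t)) ` arr C T A"
    proof
      show "carrier (fob G T) \<subseteq> (\<lambda>t. h T (q T t)) ` arr C T A"
      proof
        fix y assume y: "y \<in> carrier (fob G T)"
        then obtain t where "t \<in> arr C T A" "k T y = q T t"
          using Mod_arr_closed[OF k T y] cyclic_carrier[OF F T] by auto
        then show "y \<in> (\<lambda>t. h T (q T t)) ` arr C T A" using kh'[OF T y] by (metis imageI)
      qed
    qed (use Mod_arr_closed[OF h T] cyclic_closed[OF F T] in auto)
    show "(\<lambda>t. h T (q T t)) \<in> hom (homg C T A) (fob G T)"
      using hom_compose[OF cyclic_hom[OF F T] hh[OF T]] by (simp add: comp_def)
    have one: "h T \<one>\<^bsub>fob F T\<^esub> = \<one>\<^bsub>fob G T\<^esub>"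
      by (rule hom_one[OF hh[OF T]]) (use cyclic_comm_group[OF F T] cg[OF T] comm_group.axioms(2) in auto)
    fix t assume t: "t \<in> arr C T A"
    have 1: "\<one>\<^bsub>fob F T\<^esub> \<in> carrier (fob F T)"
      using cyclic_comm_group[OF F T] by (simp add: comm_group_def comm_monoid_def monoid.one_closed)
    have "h T (q T t) = \<one>\<^bsub>fob G T\<^esub> \<longleftrightarrow> q T t = \<one>\<^bsub>fob F T\<^esub>"
      using one hk'[OF T cyclic_closed[OF F T t]] hk'[OF T 1] by metis
    then show "h T (q T t) = \<one>\<^bsub>fob G T\<^esub> \<longleftrightarrow> t \<in> N T" using cyclic_one_iff[OF F T t] by simp
  next
    fix T T' f t assume T: "T \<in> obj C" "T' \<in> obj C" "f \<in> arr C T' T" and t: "t \<in> arr C T A"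
    show "far G T T' f (h T (q T t)) = h T' (q T' (cmp C T' T A f t))"
      using Mod_arr_far[OF h T cyclic_closed[OF F T(1) t]] cyclic_far[OF F T t] by simp
  qed (use A cg ext in auto)
  then show thesis by (rule that)
qed

lemma cyclic_transport:
  assumes F: "cyclic C F A N q" and inj: "inj e"
  shows "cyclic C (transport e F) A N (\<lambda>T t. e (q T t))"
proof -
  note A = cyclic_obj[OF F]
  have inv [simp]: "inv_into (carrier (fob F T)) e (e x) = x" if "x \<in> carrier (fob F T)" for T x
    using inv_into_f_f[of e "carrier (fob F T)"] inj that by (auto simp: inj_on_def)
  show ?thesis
    unfolding cyclic_def
  proof (intro conjI ballI)
    fix T assume T: "T \<in> obj C"
    show "comm_group (fob (transport e F) T)"
      using image_group_comm_group[OF cyclic_comm_group[OF F T] inj_on_subset[OF inj subset_UNIV]] by (simp add: transport_def)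
    show "carrier (fob (transport e F) T) = (\<lambda>t. e (q T t)) ` arr C T A"
      by (auto simp: transport_def image_group_def cyclic_carrier[OF F T])
    show "(\<lambda>t. e (q T t)) \<in> hom (homg C T A) (fob (transport e F) T)"
      using T A by (intro homI) (simp_all add: transport_def image_group_def cyclic_closed[OF F] cyclic_add[OF F])
    fix t assume t: "t \<in> arr C T A"
    show "e (q T t) = \<one>\<^bsub>fob (transport e F) T\<^esub> \<longleftrightarrow> t \<in> N T"
      using inj cyclic_one_iff[OF F T t] by (simp add: transport_def image_group_def inj_eq)
  next
    fix T T' f assume T: "T \<in> obj C" "T' \<in> obj C" "f \<in> arr C T' T"
    show "far (transport e F) T T' f \<in> extensional (carrier (fob (transport e F) T))"
      by (simp add: transport_def image_group_def)
    fix t assume t: "t \<in> arr C T A"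
    show "far (transport e F) T T' f (e (q T t)) = e (q T' (cmp C T' T A f t))"
      using T t by (simp add: transport_def cyclic_closed[OF F] cyclic_far[OF F])
  qed (rule A)
qed

lemma cyclic_hom_functor:
  assumes "A \<in> obj C"
  shows "cyclic C (hom_functor C A) A (\<lambda>T. {zero_arr C T A}) (\<lambda>T t. t)"
  using assms by (auto simp: cyclic_def hom_functor_def hom_comm_group intro!: homI)

text \<open>The coset of \<open>t gamma\<close> is trivial iff \<open>t gamma\<close> lies in the
  image of \<open>rho\<close>, and this is the definition of a syzygy.\<close>

lemma cyclic_M_functor:
  assumes X: "is_cospan C X"
  shows "cyclic C (M_functor C X) (csA X) (syz C X) (coset_map C X)"
proof -
  note [simp] = cospanD[OF X]
  let ?G = "\<lambda>T. (homg C T (csO X))\<lparr>carrier := im_gam C X T\<rparr>" and ?H = "\<lambda>T. im_rho C X T \<inter> im_gam C X T"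
  have sub_im: "subgroup ((\<lambda>t. cmp C T A B t g) ` arr C T A) (homg C T B)"
    if "T \<in> obj C" "A \<in> obj C" "B \<in> obj C" "g \<in> arr C A B" for T A B g
    by (rule group_hom.img_is_subgroup[OF group_hom.intro[OF hom_group hom_group group_hom_axioms.intro[OF cmp_left_hom]]])
      (use that in simp_all)
  have sub_gam: "subgroup (im_gam C X T) (homg C T (csO X))" if "T \<in> obj C" for T
    unfolding im_gam_def using that by (intro sub_im) simp_all
  have sub_rho: "subgroup (im_rho C X T) (homg C T (csO X))" if "T \<in> obj C" for T
    unfolding im_rho_def using that by (intro sub_im) simp_all
  have sub_H: "subgroup (?H T) (homg C T (csO X))" if "T \<in> obj C" for T
    using group.subgroups_Inter_pair[OF hom_group sub_rho[OF that] sub_gam[OF that]] that by simp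
  have sub_HG: "subgroup (?H T) (?G T)" if "T \<in> obj C" for T
    using group.subgroup_incl[OF hom_group sub_H[OF that] sub_gam[OF that]] that by simp
  have G: "comm_group (?G T)" if "T \<in> obj C" for T
    using comm_group_sub[OF hom_comm_group sub_gam[OF that]] that by simp
  have rc: "B #>\<^bsub>?G T\<^esub> x = B #>\<^bsub>homg C T (csO X)\<^esub> x" for B T x by (simp add: r_coset_def)
  have car: "carrier (?G T Mod ?H T) = coset_map C X T ` arr C T (csA X)" for T
    by (auto simp: carrier_FactGroup rc coset_map_def im_gam_def image_image)
  have gam_mem: "cmp C T (csA X) (csO X) t (gam X) \<in> im_gam C X T" if "t \<in> arr C T (csA X)" for T t
    using that by (simp add: im_gam_def)
  have H_mem: "cmp C T (csA X) (csO X) t (gam X) \<in> ?H T \<longleftrightarrow> t \<in> syz C X T" if "t \<in> arr C T (csA X)" for T t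
    using that by (auto simp: im_rho_def im_gam_def syz_def)
  show ?thesis
    unfolding cyclic_def
  proof (intro conjI ballI)
    fix T assume T: "T \<in> obj C"
    interpret O: comm_group "homg C T (csO X)" using T by (simp add: hom_comm_group)
    interpret G: comm_group "?G T" by (rule G[OF T])
    show "comm_group (fob (M_functor C X) T)"
      using G.abelian_FactGroup[OF sub_HG[OF T]] by (simp add: M_functor_def)
    show "carrier (fob (M_functor C X) T) = coset_map C X T ` arr C T (csA X)"
      by (simp add: M_functor_def car)
    show "coset_map C X T \<in> hom (homg C T (csA X)) (fob (M_functor C X) T)"
    proof (rule homI)
      fix s t assume s: "s \<in> arr C T (csA X)" and t: "t \<in> arr C T (csA X)"
      have "?H T \<lhd> ?G T" by (rule G.subgroup_imp_normal[OF sub_HG[OF T]])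
      from normal.rcos_sum[OF this, of "cmp C T (csA X) (csO X) s (gam X)" "cmp C T (csA X) (csO X) t (gam X)"]
      show "coset_map C X T (s \<otimes>\<^bsub>homg C T (csA X)\<^esub> t) = coset_map C X T s \<otimes>\<^bsub>fob (M_functor C X) T\<^esub> coset_map C X T t"
        using s t T gam_mem by (simp add: M_functor_def coset_map_def rc cmp_add_left)
    qed (simp add: M_functor_def car)
    fix t assume t: "t \<in> arr C T (csA X)"
    have "coset_map C X T t = ?H T #>\<^bsub>homg C T (csO X)\<^esub> zero_arr C T (csO X) \<longleftrightarrow> t \<in> syz C X T"
      unfolding coset_map_def using O.rcos_eq_iff[OF sub_H[OF T]] H_mem[OF t] T t by simp
    then show "coset_map C X T t = \<one>\<^bsub>fob (M_functor C X) T\<^esub> \<longleftrightarrow> t \<in> syz C X T"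
      using O.coset_mult_one[OF subgroup.subset[OF sub_H[OF T]]] by (simp add: M_functor_def)
  next
    fix T T' f assume T: "T \<in> obj C" "T' \<in> obj C" and f: "f \<in> arr C T' T"
    interpret O: comm_group "homg C T (csO X)" using T by (simp add: hom_comm_group)
    interpret O': comm_group "homg C T' (csO X)" using T by (simp add: hom_comm_group)
    show "far (M_functor C X) T T' f \<in> extensional (carrier (fob (M_functor C X) T))"
      by (simp add: M_functor_def)
    fix t assume t: "t \<in> arr C T (csA X)"
    \<comment> \<open>Representatives of one class differ by \<open>h = y gamma\<close> with
      \<open>y\<close> a syzygy. Since \<open>f y\<close> is again one, the union over
      representatives collapses.\<close>
    have "?H T' #>\<^bsub>homg C T' (csO X)\<^esub> cmp C T' T (csO X) f s = coset_map C X T' (cmp C T' T (csA X) f t)"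
      if s: "s \<in> coset_map C X T t" for s
    proof -
      obtain h where h: "h \<in> ?H T" and sh: "s = h \<otimes>\<^bsub>homg C T (csO X)\<^esub> cmp C T (csA X) (csO X) t (gam X)"
        using s by (auto simp: coset_map_def r_coset_def)
      obtain y where y: "y \<in> arr C T (csA X)" "h = cmp C T (csA X) (csO X) y (gam X)" using h by (auto simp: im_gam_def)
      have "y \<in> syz C X T" using H_mem[OF y(1)] h y(2) by simp
      then have "cmp C T' T (csA X) f y \<in> syz C X T'" using syz_cmp[OF X T] f by blast
      then have fh: "cmp C T' T (csO X) f h \<in> ?H T'"
        using H_mem[of "cmp C T' T (csA X) f y" T'] y f T by (simp add: cmp_assoc)
      have har: "h \<in> arr C T (csO X)" using y T by simp
      have "cmp C T' T (csO X) f s = cmp C T' T (csO X) f h \<otimes>\<^bsub>homg C T' (csO X)\<^esub> cmp C T' (csA X) (csO X) (cmp C T' T (csA X) f t) (gam X)"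
        unfolding sh using T f t har by (simp add: cmp_add_right cmp_assoc)
      then show ?thesis
        unfolding coset_map_def
        using T f t har fh by (simp add: O'.rcos_eq_iff[OF sub_H[OF T(2)]] O'.m_assoc)
    qed
    moreover have "cmp C T (csA X) (csO X) t (gam X) \<in> coset_map C X T t"
      unfolding coset_map_def by (rule O.rcos_self[OF _ sub_H[OF T(1)]]) (use T t in simp)
    moreover have "coset_map C X T t \<in> carrier (?G T Mod ?H T)" using t by (simp add: car)
    ultimately show "far (M_functor C X) T T' f (coset_map C X T t) = coset_map C X T' (cmp C T' T (csA X) f t)"
      by (auto simp: M_functor_def)
  qed simp
qed

end

section \<open>Realization of the quotient category by functors\<close>

lemma cyclic_cong:
  assumes c: "cyclic P F A N q" and NM: "\<And>T. T \<in> obj P \<Longrightarrow> N T = M T"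
  shows "cyclic P F A M q"
  unfolding cyclic_def
proof (intro conjI ballI)
  show "q T t = \<one>\<^bsub>fob F T\<^esub> \<longleftrightarrow> t \<in> M T" if "T \<in> obj P" "t \<in> arr P T A" for T t
    using cyclic_one_iff[OF c that] NM that by simp
qed (rule cyclic_obj[OF c] cyclic_comm_group[OF c] cyclic_carrier[OF c] cyclic_hom[OF c] cyclic_ext[OF c] cyclic_far[OF c];
  assumption)+

text \<open>The set on the right is replete by transitivity and contains all values, and any replete
  set with these values contains it.\<close>

lemma ess_image_eq:
  assumes D: "preadditive_cat D" and F: "\<And>A. A \<in> obj C \<Longrightarrow> fob F A \<in> obj D"
  shows "ess_image C D F = {B \<in> obj D. \<exists>A\<in>obj C. isomorphic D (fob F A) B}" (is "_ = ?S")
proof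
  interpret D: preadditive_cat D by fact
  have "B' \<in> ?S" if B: "B \<in> ?S" and B': "B' \<in> obj D" "isomorphic D B B'" for B B'
  proof -
    obtain A where A: "A \<in> obj C" "isomorphic D (fob F A) B" and "B \<in> obj D" using B by blast
    then have "isomorphic D (fob F A) B'" using D.isomorphic_trans[OF F[OF A(1)] _ B'(1) A(2) B'(2)] by blast
    then show ?thesis using A(1) B'(1) by blast
  qed
  then have rep: "replete D ?S" unfolding replete_def by blast
  have im: "fob F ` obj C \<subseteq> ?S" using F D.isomorphic_refl by blast
  show "ess_image C D F \<subseteq> ?S"
    unfolding ess_image_def by (intro Inter_lower CollectI conjI rep im Collect_restrict)
  show "?S \<subseteq> ess_image C D F" unfolding ess_image_def replete_def by blast
qed

text \<open>Agrees with \<open>M_bar\<close> on objects, which is all that the essential image sees;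
  on morphisms an explicit induced map takes the place of the definite description.\<close>

definition realization :: "('m set \<Rightarrow> 'g) \<Rightarrow> ('o, 'm) acat \<Rightarrow>
    (('o, 'm) cospan, 'm set, ('o, 'm, 'g) presheaf, 'o \<Rightarrow> 'g \<Rightarrow> 'g) afunctor" where
  "realization u P = \<lparr>fob = (\<lambda>X. transport u (M_functor P X)),
     far = (\<lambda>X Y V. cyclic_map P (transport u (M_functor P X)) (csA X) (\<lambda>T t. u (coset_map P X T t))
       (csA Y) (\<lambda>T t. u (coset_map P Y T t)) (SOME a. a \<in> V))\<rparr>"

context additive_cat
begin

lemma realization_cyclic:
  "\<lbrakk>inj u; is_cospan C X\<rbrakk> \<Longrightarrow> cyclic C (fob (realization u C) X) (csA X) (syz C X) (\<lambda>T t. u (coset_map C X T t))"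
  unfolding realization_def by (simp add: cyclic_transport cyclic_M_functor)

lemma realization_class_eq_iff:
  assumes "inj u" "is_cospan C X" "T \<in> obj C" "s \<in> arr C T (csA X)" "t \<in> arr C T (csA X)"
  shows "u (coset_map C X T s) = u (coset_map C X T t) \<longleftrightarrow> cls C X T s = cls C X T t"
  using cyclic_eq_iff[OF realization_cyclic[OF assms(1,2)] assms(3-5)] cls_eq_iff[OF assms(2-5)] by simp

lemma
  assumes u: "inj u" and X: "is_cospan C X" and Y: "is_cospan C Y" and a: "a \<in> arr (Aux C) X Y"
  shows realization_arr: "far (realization u C) X Y (cls C Y (csA X) a)
      \<in> arr (Mod_cat C) (fob (realization u C) X) (fob (realization u C) Y)"
    and realization_apply: "\<lbrakk>T \<in> obj C; t \<in> arr C T (csA X)\<rbrakk> \<Longrightarrow>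
      far (realization u C) X Y (cls C Y (csA X) a) T (u (coset_map C X T t))
        = u (coset_map C Y T (cmp C T (csA X) (csA Y) t a))"
proof -
  note [simp] = X Y cospanD[OF X] cospanD[OF Y] a Aux_arrD[OF a]
  \<comment> \<open>The representative chosen by \<open>realization\<close> may differ from
    \<open>a\<close>; both lie in one class and so induce the same map.\<close>
  let ?b = "SOME b. b \<in> cls C Y (csA X) a"
  have b: "?b \<in> cls C Y (csA X) a"
    using cls_self[OF Y cospanD(1)[OF X] Aux_arrD[OF a]] by (rule someI)
  have bA: "?b \<in> arr (Aux C) X Y" by (rule cls_mem_Aux[OF X Y a b])
  have bc: "cls C Y (csA X) ?b = cls C Y (csA X) a" by (rule cls_mem(2)[OF Y _ _ b]) simp_all
  have NM: "cmp C T (csA X) (csA Y) t ?b \<in> syz C Y T" if "T \<in> obj C" "t \<in> arr C T (csA X)" "t \<in> syz C X T" for T t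
    using Aux_arr_syz[OF bA] that by blast
  have ap: "cyclic_map C (fob (realization u C) X) (csA X) (\<lambda>T t. u (coset_map C X T t)) (csA Y)
      (\<lambda>T t. u (coset_map C Y T t)) ?b T (u (coset_map C X T t)) = u (coset_map C Y T (cmp C T (csA X) (csA Y) t ?b))"
    if "T \<in> obj C" "t \<in> arr C T (csA X)" for T t
    by (rule cyclic_map_apply[OF realization_cyclic[OF u X] realization_cyclic[OF u Y] Aux_arrD[OF bA] _ that]) (rule NM)
  have eq: "far (realization u C) X Y (cls C Y (csA X) a) = cyclic_map C (fob (realization u C) X) (csA X)
      (\<lambda>T t. u (coset_map C X T t)) (csA Y) (\<lambda>T t. u (coset_map C Y T t)) ?b"
    by (simp add: realization_def)
  show "far (realization u C) X Y (cls C Y (csA X) a)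
      \<in> arr (Mod_cat C) (fob (realization u C) X) (fob (realization u C) Y)"
    unfolding eq
    by (rule cyclic_map_arr[OF realization_cyclic[OF u X] realization_cyclic[OF u Y] Aux_arrD[OF bA]]) (rule NM)
  fix T t assume T: "T \<in> obj C" and t: "t \<in> arr C T (csA X)"
  have "cls C Y T (cmp C T (csA X) (csA Y) t ?b) = cls C Y T (cmp C T (csA X) (csA Y) t a)"
    by (rule cls_cmp_left) (use T t bc Aux_arrD[OF bA] in simp_all)
  then show "far (realization u C) X Y (cls C Y (csA X) a) T (u (coset_map C X T t))
        = u (coset_map C Y T (cmp C T (csA X) (csA Y) t a))"
    unfolding eq using ap[OF T t] T t Aux_arrD[OF bA] by (simp add: realization_class_eq_iff[OF u])
qed

lemma realization_obj: "\<lbrakk>inj u; is_cospan C X\<rbrakk> \<Longrightarrow> fob (realization u C) X \<in> obj (Mod_cat C)"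
  using cyclic_is_functor[OF realization_cyclic] by simp

lemma realization_hom_eqI:
  assumes "inj u" "is_cospan C X"
    and "h \<in> arr (Mod_cat C) (fob (realization u C) X) G" "k \<in> arr (Mod_cat C) (fob (realization u C) X) G"
    and "\<And>T t. \<lbrakk>T \<in> obj C; t \<in> arr C T (csA X)\<rbrakk> \<Longrightarrow> h T (u (coset_map C X T t)) = k T (u (coset_map C X T t))"
  shows "h = k"
  using cyclic_hom_eqI[OF realization_cyclic] assms by blast

lemma realization_is_functor:
  assumes u: "inj u" shows "is_functor (Q_cat C) (Mod_cat C) (realization u C)"
proof -
  interpret Mod: preadditive_cat "Mod_cat C" by (rule preadditive_Mod_cat)
  let ?R = "realization u C"
  note ap = realization_apply[OF u] and ar = realization_arr[OF u] and ob = realization_obj[OF u]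
  have cl: "u (coset_map C X T t) \<in> carrier (fob (fob ?R X) T)" if "is_cospan C X" "T \<in> obj C" "t \<in> arr C T (csA X)" for X T t
    using cyclic_closed[OF realization_cyclic[OF u]] that by simp
  show ?thesis
    unfolding is_functor_def
  proof (intro conjI ballI)
    fix X assume "X \<in> obj (Q_cat C)"
    then have X: "is_cospan C X" by simp
    note [simp] = X cospanD[OF X]
    show "fob ?R X \<in> obj (Mod_cat C)" by (rule ob[OF X])
    show "far ?R X X (idn (Q_cat C) X) = idn (Mod_cat C) (fob ?R X)"
      unfolding Q_idn[OF X]
      by (rule realization_hom_eqI[OF u X ar[OF X X Aux_idn[OF X]] Mod.idn_closed[OF ob[OF X]]])
        (simp add: ap[OF X X Aux_idn[OF X]] Mod_idn cl)
    fix Y assume "Y \<in> obj (Q_cat C)"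
    then have Y: "is_cospan C Y" by simp
    note [simp] = Y cospanD[OF Y]
    show "far ?R X Y \<in> hom (homg (Q_cat C) X Y) (homg (Mod_cat C) (fob ?R X) (fob ?R Y))"
    proof (rule homI)
      fix V assume V: "V \<in> arr (Q_cat C) X Y"
      obtain a where a: "a \<in> arr (Aux C) X Y" "V = cls C Y (csA X) a" using Q_arrE[OF X Y V] .
      show "far ?R X Y V \<in> arr (Mod_cat C) (fob ?R X) (fob ?R Y)" unfolding a(2) by (rule ar[OF X Y a(1)])
      fix W assume W: "W \<in> arr (Q_cat C) X Y"
      obtain b where b: "b \<in> arr (Aux C) X Y" "W = cls C Y (csA X) b" using Q_arrE[OF X Y W] .
      note ab = Aux_add[OF X Y a(1) b(1)]
      note [simp] = Aux_arrD[OF a(1)] Aux_arrD[OF b(1)]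
      show "far ?R X Y (V \<otimes>\<^bsub>homg (Q_cat C) X Y\<^esub> W) = far ?R X Y V \<otimes>\<^bsub>homg (Mod_cat C) (fob ?R X) (fob ?R Y)\<^esub> far ?R X Y W"
        unfolding a(2) b(2) Q_add[OF X Y a(1) b(1)]
        by (rule realization_hom_eqI[OF u X ar[OF X Y ab] Mod.add_closed[OF ob[OF X] ob[OF Y] ar[OF X Y a(1)] ar[OF X Y b(1)]]])
          (simp add: ap[OF X Y a(1)] ap[OF X Y b(1)] ap[OF X Y ab] Mod_add cl cmp_add_right
            cyclic_add[OF realization_cyclic[OF u Y]])
    qed
    fix Z V W assume "Z \<in> obj (Q_cat C)" and V: "V \<in> arr (Q_cat C) X Y" and W: "W \<in> arr (Q_cat C) Y Z"
    then have Z: "is_cospan C Z" by simp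
    obtain a where a: "a \<in> arr (Aux C) X Y" "V = cls C Y (csA X) a" using Q_arrE[OF X Y V] .
    obtain b where b: "b \<in> arr (Aux C) Y Z" "W = cls C Z (csA Y) b" using Q_arrE[OF Y Z W] .
    note ab = Aux_cmp[OF X Y Z a(1) b(1)]
    note [simp] = Z cospanD[OF Z] Aux_arrD[OF a(1)] Aux_arrD[OF b(1)]
    show "far ?R X Z (cmp (Q_cat C) X Y Z V W) = cmp (Mod_cat C) (fob ?R X) (fob ?R Y) (fob ?R Z) (far ?R X Y V) (far ?R Y Z W)"
      unfolding a(2) b(2) Q_cmp[OF X Y Z a(1) b(1)]
      by (rule realization_hom_eqI[OF u X ar[OF X Z ab] Mod.cmp_closed[OF ob[OF X] ob[OF Y] ob[OF Z] ar[OF X Y a(1)] ar[OF Y Z b(1)]]])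
        (simp add: ap[OF X Y a(1)] ap[OF Y Z b(1)] ap[OF X Z ab] Mod_cmp cl cmp_assoc)
  qed
qed

text \<open>Injectivity evaluates at the class of the identity. For surjectivity,
  \<open>cyclic_hom_lift\<close> gives a morphism of \<open>C\<close> that respects syzygies and so
  belongs to \<open>Aux\<close>.\<close>

lemma realization_bij:
  assumes u: "inj u" and X: "is_cospan C X" and Y: "is_cospan C Y"
  shows "bij_betw (far (realization u C) X Y) (arr (Q_cat C) X Y)
    (arr (Mod_cat C) (fob (realization u C) X) (fob (realization u C) Y))"
proof -
  let ?R = "realization u C"
  note [simp] = X Y cospanD[OF X] cospanD[OF Y]
  have "V = W" if V: "V \<in> arr (Q_cat C) X Y" and W: "W \<in> arr (Q_cat C) X Y" and eq: "far ?R X Y V = far ?R X Y W" for V W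
  proof -
    obtain a where a: "a \<in> arr (Aux C) X Y" "V = cls C Y (csA X) a" using Q_arrE[OF X Y V] .
    obtain b where b: "b \<in> arr (Aux C) X Y" "W = cls C Y (csA X) b" using Q_arrE[OF X Y W] .
    note [simp] = Aux_arrD[OF a(1)] Aux_arrD[OF b(1)]
    have "u (coset_map C Y (csA X) a) = u (coset_map C Y (csA X) b)"
      using eq realization_apply[OF u X Y a(1), of "csA X" "idn C (csA X)"] realization_apply[OF u X Y b(1), of "csA X" "idn C (csA X)"]
      by (simp add: a(2) b(2))
    then show ?thesis by (simp add: a(2) b(2) realization_class_eq_iff[OF u])
  qed
  moreover have "\<exists>V\<in>arr (Q_cat C) X Y. h = far ?R X Y V" if h: "h \<in> arr (Mod_cat C) (fob ?R X) (fob ?R Y)" for h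
  proof -
    obtain a where a: "a \<in> arr C (csA X) (csA Y)"
      and ha: "\<And>T t. \<lbrakk>T \<in> obj C; t \<in> arr C T (csA X)\<rbrakk> \<Longrightarrow> h T (u (coset_map C X T t)) = u (coset_map C Y T (cmp C T (csA X) (csA Y) t a))"
      and sa: "\<And>T t. \<lbrakk>T \<in> obj C; t \<in> arr C T (csA X); t \<in> syz C X T\<rbrakk> \<Longrightarrow> cmp C T (csA X) (csA Y) t a \<in> syz C Y T"
      by (rule cyclic_hom_lift[OF realization_cyclic[OF u X] realization_cyclic[OF u Y] h]) blast
    have aA: "a \<in> arr (Aux C) X Y" unfolding Aux_arr using a sa syz_arr by blast
    have "h = far ?R X Y (cls C Y (csA X) a)"
      by (rule realization_hom_eqI[OF u X h realization_arr[OF u X Y aA]]) (simp add: ha realization_apply[OF u X Y aA])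
    then show ?thesis using cls_in_Q[OF X Y aA] by blast
  qed
  moreover have "far ?R X Y V \<in> arr (Mod_cat C) (fob ?R X) (fob ?R Y)" if "V \<in> arr (Q_cat C) X Y" for V
    using functor_ar[OF realization_is_functor[OF u] _ _ that] by simp
  ultimately show ?thesis unfolding bij_betw_def inj_on_def image_def by blast
qed

text \<open>Stated for a set \<open>S\<close> of cospans: all cospans give the essential image, the
  presenting ones give the finitely presented functors.\<close>

lemma realization_equivalence:
  assumes u: "inj u" and S: "S \<subseteq> Collect (is_cospan C)"
    and D: "D = {F \<in> obj (Mod_cat C). \<exists>X\<in>S. isomorphic (Mod_cat C) (fob (realization u C) X) F}"
  shows "cat_equivalence (full_subcat (Q_cat C) S) (full_subcat (Mod_cat C) D) (realization u C)"
proof -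
  have SQ: "S \<subseteq> obj (Q_cat C)" using S by simp
  have ob: "fob (realization u C) X \<in> D" if "X \<in> S" for X
    using that S realization_obj[OF u] preadditive_cat.isomorphic_refl[OF preadditive_Mod_cat realization_obj[OF u]]
    by (auto simp: D)
  have "is_functor (full_subcat (Q_cat C) S) (full_subcat (Mod_cat C) D) (realization u C)"
    using realization_is_functor[OF u] SQ ob unfolding is_functor_def full_subcat_simps by blast
  moreover have "ess_surj (full_subcat (Q_cat C) S) (full_subcat (Mod_cat C) D) (realization u C)"
    by (auto simp: ess_surj_def D)
  ultimately show ?thesis
    unfolding cat_equivalence_def cat_equivalence_axioms_def fully_faithful_def
    using preadditive_full_subcat[OF preadditive_Q SQ] preadditive_full_subcat[OF preadditive_Mod_cat, of D] realization_bij[OF u] S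
    by (auto simp: D)
qed

section \<open>Finitely presented functors and the essential image\<close>

lemma cyclic_rep:
  assumes "inj u" "A \<in> obj C"
  shows "cyclic C (rep u C A) A (\<lambda>T. {zero_arr C T A}) (\<lambda>T t. u {t})"
  unfolding rep_def
  by (rule cyclic_transport[OF cyclic_hom_functor[OF assms(2)]]) (use assms(1) in \<open>auto simp: inj_on_def\<close>)

lemma rep_map_image:
  assumes u: "inj u" and A: "A \<in> obj C" "B \<in> obj C" and T: "T \<in> obj C"
  shows "rep_map u C B A a T ` carrier (fob (rep u C B) T) = (\<lambda>w. u {cmp C T B A w a}) ` arr C T B"
proof -
  have car: "carrier (fob (rep u C B) T) = (\<lambda>t. u {t}) ` arr C T B" by (rule cyclic_carrier[OF cyclic_rep[OF u A(2)] T])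
  have inv: "inv_into (arr C T B) (\<lambda>f. u {f}) (u {w}) = w" if "w \<in> arr C T B" for w
    using inv_into_f_f[of "\<lambda>f. u {f}" "arr C T B" w] u that by (auto simp: inj_on_def)
  have "rep_map u C B A a T (u {w}) = u {cmp C T B A w a}" if "w \<in> arr C T B" for w
    using that T by (simp add: rep_map_def transport_trans_def hom_functor_def inv)
  then show ?thesis unfolding car by (simp add: image_image)
qed

text \<open>The epimorphism \<open>e\<close> and the projection \<open>q\<close> correspond by
  \<open>q T t = e T (u {t})\<close>; exactness says that \<open>q\<close> is onto and that its
  kernel is the image of (-,a).\<close>

lemma finitely_presented_iff:
  assumes u: "inj u" and F: "F \<in> obj (Mod_cat C)"
  shows "finitely_presented u C F \<longleftrightarrow> (\<exists>A\<in>obj C. \<exists>B\<in>obj C. \<exists>a\<in>arr C B A. \<exists>q.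
    cyclic C F A (\<lambda>T. (\<lambda>w. cmp C T B A w a) ` arr C T B) q)"
proof
  assume "finitely_presented u C F"
  then obtain A B a e where A: "A \<in> obj C" "B \<in> obj C" and a: "a \<in> arr C B A" and e: "e \<in> arr (Mod_cat C) (rep u C A) F"
    and ex: "\<forall>T\<in>obj C. rep_map u C B A a T ` carrier (fob (rep u C B) T) = kernel (fob (rep u C A) T) (fob F T) (e T) \<and>
      e T ` carrier (fob (rep u C A) T) = carrier (fob F T)"
    unfolding finitely_presented_def by (elim bexE) (rule that)
  note ker = ex[THEN bspec, THEN conjunct1] and surj = ex[THEN bspec, THEN conjunct2]
  note c = cyclic_rep[OF u A(1)]
  have "cyclic C F A (\<lambda>T. (\<lambda>w. cmp C T B A w a) ` arr C T B) (\<lambda>T t. e T (u {t}))"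
    unfolding cyclic_def
  proof (intro conjI ballI)
    fix T assume T: "T \<in> obj C"
    show "comm_group (fob F T)" using F T by (auto simp: is_functor_def Ab_cat_def)
    show "carrier (fob F T) = (\<lambda>t. e T (u {t})) ` arr C T A"
      using surj[OF T] by (simp add: cyclic_carrier[OF c T] image_image)
    have "e T \<in> hom (fob (rep u C A) T) (fob F T)" using e T by (simp add: Mod_arr_iff)
    from hom_compose[OF cyclic_hom[OF c T] this]
    show "(\<lambda>t. e T (u {t})) \<in> hom (homg C T A) (fob F T)" by (simp add: comp_def)
    fix t assume t: "t \<in> arr C T A"
    have "e T (u {t}) = \<one>\<^bsub>fob F T\<^esub> \<longleftrightarrow> u {t} \<in> kernel (fob (rep u C A) T) (fob F T) (e T)"
      using t by (simp add: kernel_def cyclic_carrier[OF c T])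
    also have "\<dots> \<longleftrightarrow> u {t} \<in> (\<lambda>w. u {cmp C T B A w a}) ` arr C T B"
      unfolding ker[OF T, symmetric] rep_map_image[OF u A T] ..
    also have "\<dots> \<longleftrightarrow> t \<in> (\<lambda>w. cmp C T B A w a) ` arr C T B"
      using u by (auto simp: inj_eq)
    finally show "e T (u {t}) = \<one>\<^bsub>fob F T\<^esub> \<longleftrightarrow> t \<in> (\<lambda>w. cmp C T B A w a) ` arr C T B" .
  next
    fix T T' f assume T: "T \<in> obj C" "T' \<in> obj C" "f \<in> arr C T' T"
    show "far F T T' f \<in> extensional (carrier (fob F T))"
      using functor_ar[of "op_cat C" Ab_cat F T T' f] F T by (simp add: Ab_cat_def)
    fix t assume t: "t \<in> arr C T A"
    show "far F T T' f (e T (u {t})) = e T' (u {cmp C T' T A f t})"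
      using Mod_arr_far[OF e T cyclic_closed[OF c T(1) t]] cyclic_far[OF c T t] by simp
  qed (rule A)
  then show "\<exists>A\<in>obj C. \<exists>B\<in>obj C. \<exists>a\<in>arr C B A. \<exists>q. cyclic C F A (\<lambda>T. (\<lambda>w. cmp C T B A w a) ` arr C T B) q"
    using A a by blast
next
  assume "\<exists>A\<in>obj C. \<exists>B\<in>obj C. \<exists>a\<in>arr C B A. \<exists>q. cyclic C F A (\<lambda>T. (\<lambda>w. cmp C T B A w a) ` arr C T B) q"
  then obtain A B a q where A: "A \<in> obj C" "B \<in> obj C" and a: "a \<in> arr C B A"
    and q: "cyclic C F A (\<lambda>T. (\<lambda>w. cmp C T B A w a) ` arr C T B) q" by blast
  note c = cyclic_rep[OF u A(1)]
  let ?e = "cyclic_map C (rep u C A) A (\<lambda>T t. u {t}) A q (idn C A)"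
  have zero: "cmp C T A A t (idn C A) \<in> (\<lambda>w. cmp C T B A w a) ` arr C T B"
    if "T \<in> obj C" "t \<in> arr C T A" "t \<in> {zero_arr C T A}" for T t
    using that A a by (auto intro!: image_eqI[of _ _ "zero_arr C T B"])
  note e = cyclic_map[OF c q idn_closed[OF A(1)] zero]
  have ap: "?e T (u {t}) = q T t" if "T \<in> obj C" "t \<in> arr C T A" for T t using e(2) that A by simp
  have "rep_map u C B A a T ` carrier (fob (rep u C B) T) = kernel (fob (rep u C A) T) (fob F T) (?e T)"
    "?e T ` carrier (fob (rep u C A) T) = carrier (fob F T)" if T: "T \<in> obj C" for T
  proof -
    show "?e T ` carrier (fob (rep u C A) T) = carrier (fob F T)"
      by (simp add: cyclic_carrier[OF c T] cyclic_carrier[OF q T] image_image ap[OF T])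
    have "kernel (fob (rep u C A) T) (fob F T) (?e T) = (\<lambda>t. u {t}) ` {t \<in> arr C T A. q T t = \<one>\<^bsub>fob F T\<^esub>}"
      by (auto simp: kernel_def cyclic_carrier[OF c T] ap[OF T])
    also have "{t \<in> arr C T A. q T t = \<one>\<^bsub>fob F T\<^esub>} = (\<lambda>w. cmp C T B A w a) ` arr C T B"
      using cyclic_one_iff[OF q T] T A a by auto
    finally show "rep_map u C B A a T ` carrier (fob (rep u C B) T) = kernel (fob (rep u C A) T) (fob F T) (?e T)"
      unfolding rep_map_image[OF u A T] by (simp add: image_image)
  qed
  then show "finitely_presented u C F"
    unfolding finitely_presented_def using A a e(1) by blast
qed

text \<open>Both conditions say that \<open>F\<close> is the quotient of some (-,A) by the image of
  one morphism, and such quotients are isomorphic once their subfunctors agree.\<close>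

lemma fp_objs_eq:
  assumes u: "inj u"
  shows "fp_objs u C = {F \<in> obj (Mod_cat C). \<exists>X\<in>presenting_cospans C. isomorphic (Mod_cat C) (fob (realization u C) X) F}"
proof -
  have "finitely_presented u C F \<longleftrightarrow> (\<exists>X\<in>presenting_cospans C. isomorphic (Mod_cat C) (fob (realization u C) X) F)"
    if F: "F \<in> obj (Mod_cat C)" for F
  proof
    assume "finitely_presented u C F"
    then obtain A B a q where A: "A \<in> obj C" "B \<in> obj C" and a: "a \<in> arr C B A"
      and q: "cyclic C F A (\<lambda>T. (\<lambda>w. cmp C T B A w a) ` arr C T B) q"
      unfolding finitely_presented_iff[OF u F] by blast
    let ?X = "\<lparr>csA = A, csO = A, csR = B, gam = idn C A, rho = a\<rparr>"
    have X: "?X \<in> presenting_cospans C" by (rule presenting_cospan[OF A a])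
    have "isomorphic (Mod_cat C) (fob (realization u C) ?X) F"
      by (rule cyclic_isomorphic[OF realization_cyclic[OF u presenting_cospansD[OF X], simplified] q])
        (simp add: syz_presenting[OF X])
    then show "\<exists>X\<in>presenting_cospans C. isomorphic (Mod_cat C) (fob (realization u C) X) F" using X by blast
  next
    assume "\<exists>X\<in>presenting_cospans C. isomorphic (Mod_cat C) (fob (realization u C) X) F"
    then obtain X where X: "X \<in> presenting_cospans C" "isomorphic (Mod_cat C) (fob (realization u C) X) F" by blast
    note X' = presenting_cospansD[OF X(1)]
    obtain r where r: "cyclic C F (csA X) (syz C X) r"
      by (rule cyclic_cong_iso[OF realization_cyclic[OF u X'] F X(2)])
    have "cyclic C F (csA X) (\<lambda>T. (\<lambda>w. cmp C T (csR X) (csA X) w (rho X)) ` arr C T (csR X)) r"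
      by (rule cyclic_cong[OF r]) (rule syz_presenting[OF X(1)])
    then show "finitely_presented u C F"
      unfolding finitely_presented_iff[OF u F] using cospanD(1,3)[OF X'] presenting_rho[OF X(1)] by blast
  qed
  then show ?thesis unfolding fp_objs_def by blast
qed

lemma ess_image_M_bar:
  assumes u: "inj u"
  shows "ess_image (Q_cat C) (Mod_cat C) (M_bar u C)
    = {F \<in> obj (Mod_cat C). \<exists>X\<in>Collect (is_cospan C). isomorphic (Mod_cat C) (fob (realization u C) X) F}"
proof -
  have "fob (M_bar u C) = fob (realization u C)" by (simp add: M_bar_def realization_def)
  then show ?thesis
    using ess_image_eq[OF preadditive_Mod_cat, of "Q_cat C" "M_bar u C" C] realization_obj[OF u] by (simp del: Mod_obj)
qed

end

theorem theorem4p1: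
  fixes P :: "('o, 'm) acat" and u :: "'m set \<Rightarrow> 'g"
  assumes "additive_cat P" and "inj u"
  shows "(has_weak_kernels P \<longleftrightarrow> has_kernels (Q_cat P)) \<and>
    (has_kernels (Q_cat P) \<longleftrightarrow> abelian_cat (Q_cat P)) \<and>
    (abelian_cat (Q_cat P) \<longleftrightarrow> abelian_cat (fp_cat u P)) \<and>
    (abelian_cat (fp_cat u P) \<longleftrightarrow>
       full_subcat (Mod_cat P) (ess_image (Q_cat P) (Mod_cat P) (M_bar u P)) = fp_cat u P) \<and>
    (full_subcat (Mod_cat P) (ess_image (Q_cat P) (Mod_cat P) (M_bar u P)) = fp_cat u P \<longleftrightarrow>
       equivalent_cats (Q_cat P) (fp_cat u P)) \<and>
    (equivalent_cats (Q_cat P) (fp_cat u P) \<longleftrightarrow>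
       has_epi_mono_factorizations (fp_cat u P))"
proof -
  interpret P: additive_cat P by fact
  let ?Q = "Q_cat P" and ?fp = "fp_cat u P" and ?pr = "presenting_cospans P" and ?M = "Mod_cat P" and ?R = "realization u P"
  let ?E = "ess_image ?Q ?M (M_bar u P)"
  note u = \<open>inj u\<close>
  have pr: "?pr \<subseteq> Collect (is_cospan P)" using P.presenting_cospansD by blast
  have Qall: "full_subcat ?Q (Collect (is_cospan P)) = ?Q" using full_subcat_obj[of ?Q] by simp
  have eq_pr: "cat_equivalence (full_subcat ?Q ?pr) ?fp ?R"
    unfolding fp_cat_def by (rule P.realization_equivalence[OF u pr P.fp_objs_eq[OF u]])
  have eq_E: "cat_equivalence ?Q (full_subcat ?M ?E) ?R"
    using P.realization_equivalence[OF u subset_refl P.ess_image_M_bar[OF u]] unfolding Qall .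
  interpret E: cat_equivalence ?Q "full_subcat ?M ?E" ?R by (rule eq_E)
  interpret fp: cat_equivalence "full_subcat ?Q ?pr" ?fp ?R by (rule eq_pr)
  have fp_E: "fp_objs u P \<subseteq> ?E"
    unfolding P.fp_objs_eq[OF u] P.ess_image_M_bar[OF u] using pr by blast
  have 1: "has_weak_kernels P" if "has_kernels ?Q"
    using P.weak_kernels_of_subcat_kernels[OF pr subset_refl] that unfolding Qall by blast
  have 2: "abelian_cat ?Q" if "has_weak_kernels P" using P.abelian_Q that by blast
  have 4: "has_weak_kernels P" if "has_kernels ?fp"
    using P.weak_kernels_of_subcat_kernels[OF subset_refl pr] fp.has_kernels_transfer that by blast
  \<comment> \<open>With weak kernels every cospan is isomorphic to a presenting one, and
    \<open>?R\<close> carries this over to the functors.\<close>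
  have 5: "full_subcat ?M ?E = ?fp" if wk: "has_weak_kernels P"
  proof -
    have "F \<in> fp_objs u P" if FE: "F \<in> ?E" for F
    proof -
      obtain X where F: "F \<in> obj ?M" and X: "is_cospan P X" "isomorphic ?M (fob ?R X) F"
        using FE unfolding P.ess_image_M_bar[OF u] by blast
      obtain Y where Y: "Y \<in> ?pr" "isomorphic ?Q X Y" using P.Q_isomorphic_presenting[OF wk X(1)] by blast
      note Y' = P.presenting_cospansD[OF Y(1)]
      have "isomorphic ?M (fob ?R Y) (fob ?R X)"
        using E.isomorphic_iff[of Y X] X(1) Y' E.C.isomorphic_sym[OF Y(2)] by simp
      then have "isomorphic ?M (fob ?R Y) F"
        using preadditive_cat.isomorphic_trans[OF preadditive_Mod_cat P.realization_obj[OF u Y'] P.realization_obj[OF u X(1)] F] X(2)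
        by blast
      then show ?thesis unfolding P.fp_objs_eq[OF u] using F Y(1) by blast
    qed
    then show ?thesis unfolding fp_cat_def using fp_E by (metis subsetI subset_antisym)
  qed
  \<comment> \<open>\<open>?R\<close> reflects isomorphy, so equality of the object sets yields a
    presenting cospan isomorphic to each \<open>X\<close> already in Q(P).\<close>
  have 6: "has_weak_kernels P" if eq: "full_subcat ?M ?E = ?fp"
  proof (rule P.weak_kernels_of_presenting_dense)
    fix X assume X: "is_cospan P X"
    have "?E = fp_objs u P"
      using arg_cong[OF eq, of obj] by (simp add: fp_cat_def)
    moreover have "fob ?R X \<in> ?E" using E.F_ob[of X] X by simp
    ultimately obtain Y where Y: "Y \<in> ?pr" "isomorphic ?M (fob ?R Y) (fob ?R X)"
      unfolding P.fp_objs_eq[OF u] by blast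
    then have "isomorphic ?Q Y X"
      using E.isomorphic_iff[of Y X] X P.presenting_cospansD by simp
    then show "\<exists>Y\<in>?pr. isomorphic ?Q X Y" using Y(1) E.C.isomorphic_sym by blast
  qed
  have 7: "equivalent_cats ?Q ?fp" if "full_subcat ?M ?E = ?fp"
    using E.equivalent_cats unfolding that .
  \<comment> \<open>Properties move from the target of an equivalence to its source, so the finitely
    presented functors must be the source.\<close>
  have inverse: "\<exists>G. cat_equivalence ?fp ?Q G" if "equivalent_cats ?Q ?fp"
    using equivalent_cats_imp_cat_equivalence[OF fp.D.preadditive_cat_axioms P.preadditive_Q equivalent_cats_sym[OF that]] .
  have 8: "abelian_cat ?fp" if "has_weak_kernels P"
    using inverse[OF 7[OF 5[OF that]]] cat_equivalence.abelian_transfer 2[OF that] by blast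
  \<comment> \<open>The given equivalence may be unrelated to \<open>?R\<close>; invariance of
    factorizations is all that it has to supply.\<close>
  have 9: "has_epi_mono_factorizations ?fp" if "equivalent_cats ?Q ?fp"
    using inverse[OF that] cat_equivalence.epi_mono_factorizations_transfer P.Q_has_epi_mono_factorizations by blast
  have 10: "has_weak_kernels P" if "has_epi_mono_factorizations ?fp"
    using P.weak_kernels_of_epi_mono_factorizations fp.epi_mono_factorizations_transfer that by blast
  have "has_kernels ?Q \<longleftrightarrow> has_weak_kernels P" "abelian_cat ?Q \<longleftrightarrow> has_weak_kernels P"
    using 1 2 abelian_cat.kernels[of ?Q] by iprover+
  moreover have "abelian_cat ?fp \<longleftrightarrow> has_weak_kernels P"
    using 4 8 abelian_cat.kernels[of ?fp] by iprover
  moreover have "full_subcat ?M ?E = ?fp \<longleftrightarrow> has_weak_kernels P"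
    using 5 6 by iprover
  moreover have "equivalent_cats ?Q ?fp \<longleftrightarrow> has_weak_kernels P" "has_epi_mono_factorizations ?fp \<longleftrightarrow> has_weak_kernels P"
    using 5 7 9 10 by iprover+
  ultimately show ?thesis by simp
qed

end
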